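(* Let $O,g,\mathbf x_0,U_0,\psi,\tau,h$ be as in the context and suppose that the Condition stated there holds. Then there exists a constant $C\in(0,+\infty)$ such that: for every $f\in W^{1,2}(U_0\cap O)$ one has $f\circ\tau\in W^{1,2}(\psi(U_0)\cap\mathbb H)$ and $$C^{-1}\|f\|_{W^{1,2}(U_0\cap O)}\le\|f\circ\tau\|_{W^{1,2}(\psi(U_0)\cap\mathbb H)}\le C\|f\|_{W^{1,2}(U_0\cap O)};$$ and conversely, for every $v\in W^{1,2}(\psi(U_0)\cap\mathbb H)$ one has $v\circ\psi\in W^{1,2}(U_0\cap O)$ and $$C^{-1}\|v\|_{W^{1,2}(\psi(U_0)\cap\mathbb H)}\le\|v\circ\psi\|_{W^{1,2}(U_0\cap O)}\le C\|v\|_{W^{1,2}(\psi(U_0)\cap\mathbb H)} .$$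
   Context: Fix positive numbers $(a_i)_{i\ge1}$ with $\sum_ia_i<\infty$. $\ell^2$ is the real space of square-summable sequences $\mathbf x=(x_i)_{i\in\mathbb N}$, $(\mathbf e_i)$ its standard basis, $D_i$ the partial derivative along $\mathbf e_i$, $B_r(\mathbf x)$ the open ball. $P$ is the Borel probability measure on $\ell^2$ obtained by restricting $\prod_i\frac1{\sqrt{2\pi a_i^2}}e^{-x_i^2/(2a_i^2)}dx_i$ from $\mathbb R^{\mathbb N}$. For $V\subset\ell^2$ open: $f:V\to\mathbb R$ is $F$-continuous if for all $\mathbf x\in V$, $n\in\mathbb N$ the map $(s_1,\dots,s_n)\mapsto f(\mathbf x+\sum_{k\le n}s_k\mathbf e_k)$ is continuous on the open set where it is defined. $C_F^\infty(V)$ is the set of $F$-continuous Borel functions on $V$ all of whose partial derivatives of all orders exist and are bounded, $F$-continuous and Borel. $E\stackrel{\circ}{\subset}V$ means: there are $\rho,R>0$ with $\bigcup_{\mathbf x\in E}B_\rho(\mathbf x)\subset V$ and $E\subset B_R(0)$. The test class $C_{F,0}^\infty(V)$ is the set of $f\in C_F^\infty(V)$ with $\sup_V(|f|+\sum_i|D_if|^2)<\infty$ and $\operatorname{supp}f\stackrel{\circ}{\subset}V$. With $D_i^*\varphi=-D_i\varphi+\frac{x_i}{a_i^2}\varphi$, $f\in L^2(V,P)$ has weak derivative $D_if=q\in L^2(V,P)$ if $\int_Vq\varphi\,dP=\int_VfD_i^*\varphi\,dP$ for all $\varphi\in C_{F,0}^\infty(V)$. $W^{1,2}(V)$ is the set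 of $f\in L^2(V,P)$ with all $D_if\in L^2(V,P)$ and $\|f\|^2_{W^{1,2}(V)}=\int_V|f|^2dP+\sum_ia_i^2\int_V|D_if|^2dP<\infty$. $\mathbb H=\{\mathbf x\in\ell^2:x_1>0\}$. Setting: $O\subset\ell^2$ is open, $g:\ell^2\to\mathbb R$ is continuously Fréchet differentiable with $\partial O=\{g=0\}$, $O=\{g>0\}$, $Dg(\mathbf x)\ne0$ on $\partial O$. $\mathbf x_0\in\partial O$ with $D_1g(\mathbf x_0)>0$, and $U_0=B_r(\mathbf x_0)$ with $r>0$ such that $\inf_{U_0}D_1g>0$ and $\sup_{U_0}D_1g<\infty$. $\psi(\mathbf x)=(g(\mathbf x),x_2,x_3,\dots)$ for $\mathbf x\in U_0$; $\psi$ is a homeomorphism of $U_0$ onto the open set $\psi(U_0)$ with $\psi(U_0\cap O)=\psi(U_0)\cap\mathbb H$. For $\widehat{\mathbf x}=\psi(\mathbf x)$ set $h(\widehat{\mathbf x})=x_1$; $h$ is assumed continuously Fréchet differentiable on $\psi(U_0)$; $\tau(\widehat{\mathbf x})=(h(\widehat{\mathbf x}),\widehat x_2,\widehat x_3,\dots)$, so $\tau=\psi^{-1}$. Condition: $h\in C_F^\infty(\psi(U_0))$, $g\in C_F^\infty(U_0)$, and there is $\delta\in(0,\infty)$ such that for all $\mathbf x\in U_0$ and $\widehat{\mathbf x}\in\psi(U_0)$: $|x_1|<\delta$, $|\widehat x_1|<\delta$, $|h(\widehat{\mathbf x})|<\delta$, $|g(\mathbf x)|<\delta$, $\frac1\delta<D_1h(\widehat{\mathbf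 x})<\delta$, $\frac1\delta<D_1g(\mathbf x)<\delta$, $\sum_ia_i^2|D_ih(\widehat{\mathbf x})|^2<\delta$; moreover $\psi(E)\stackrel{\circ}{\subset}\psi(U_0)\cap\mathbb H$ for every $E\stackrel{\circ}{\subset}U_0\cap O$, and $\tau(E')\stackrel{\circ}{\subset}U_0\cap O$ for every $E'\stackrel{\circ}{\subset}\psi(U_0)\cap\mathbb H$. *)

theory Defs
  imports "HOL-Probability.Probability"
begin

section \<open>The real Hilbert space of square-summable sequences\<close>

text \<open>Coordinates are indexed by \<^typ>\<open>nat\<close> starting from 0, so the first coordinate $x_1$ is
  \<open>coord x 0\<close>, and $a_1$, $D_1$ are \<open>a 0\<close>, \<open>partial 0\<close>.\<close>

typedef l2 = "{x :: nat \<Rightarrow> real. summable (\<lambda>i. (x i)\<^sup>2)}"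
  morphisms coord Abs_l2
  by (rule exI[of _ "\<lambda>_. 0"]) simp

setup_lifting type_definition_l2

lemma summable_coord_sq [simp, intro]: "summable (\<lambda>i. (coord x i)\<^sup>2)"
  using coord[of x] by simp

lemma l2_eqI: "(\<And>i. coord x i = coord y i) \<Longrightarrow> x = y"
  by (metis coord_inject ext)

lemma summable_sq_add:
  fixes x y :: "nat \<Rightarrow> real"
  assumes "summable (\<lambda>i. (x i)\<^sup>2)" "summable (\<lambda>i. (y i)\<^sup>2)"
  shows "summable (\<lambda>i. (x i + y i)\<^sup>2)"
proof (rule summable_comparison_test')
  show "summable (\<lambda>i. 2 * ((x i)\<^sup>2 + (y i)\<^sup>2))"
    by (intro summable_mult summable_add assms)
next
  fix i
  have "0 \<le> (x i - y i)\<^sup>2" by simp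
  moreover have "norm ((x i + y i)\<^sup>2) = (x i + y i)\<^sup>2" by simp
  ultimately show "norm ((x i + y i)\<^sup>2) \<le> 2 * ((x i)\<^sup>2 + (y i)\<^sup>2)"
    unfolding power2_sum power2_diff by argo
qed

lemma summable_coord_mult [simp, intro]: "summable (\<lambda>i. coord x i * coord y i)"
proof (rule summable_comparison_test')
  show "summable (\<lambda>i. (coord x i)\<^sup>2 + (coord y i)\<^sup>2)"
    by (intro summable_add) auto
next
  fix i
  have "2 * (\<bar>coord x i\<bar> * \<bar>coord y i\<bar>) \<le> (coord x i)\<^sup>2 + (coord y i)\<^sup>2"
    using sum_squares_bound[of "\<bar>coord x i\<bar>" "\<bar>coord y i\<bar>"] by simp
  moreover have "0 \<le> \<bar>coord x i\<bar> * \<bar>coord y i\<bar>" by simp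
  ultimately show "norm (coord x i * coord y i) \<le> (coord x i)\<^sup>2 + (coord y i)\<^sup>2"
    unfolding real_norm_def abs_mult by linarith
qed

instantiation l2 :: real_vector
begin

lift_definition zero_l2 :: l2 is "\<lambda>_. 0" by simp
lift_definition plus_l2 :: "l2 \<Rightarrow> l2 \<Rightarrow> l2" is "\<lambda>x y i. x i + y i"
  by (rule summable_sq_add)
lift_definition uminus_l2 :: "l2 \<Rightarrow> l2" is "\<lambda>x i. - x i" by simp
lift_definition minus_l2 :: "l2 \<Rightarrow> l2 \<Rightarrow> l2" is "\<lambda>x y i. x i - y i"
proof -
  fix x y :: "nat \<Rightarrow> real"
  assume "summable (\<lambda>i. (x i)\<^sup>2)" "summable (\<lambda>i. (y i)\<^sup>2)"
  then show "summable (\<lambda>i. (x i - y i)\<^sup>2)"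
    using summable_sq_add[of x "\<lambda>i. - y i"] by simp
qed
lift_definition scaleR_l2 :: "real \<Rightarrow> l2 \<Rightarrow> l2" is "\<lambda>c x i. c * x i"
  by (simp add: power_mult_distrib summable_mult)

instance
  by standard (transfer; simp add: algebra_simps; fail)+

end

lemma coord_simps [simp]:
  "coord 0 i = 0" "coord (x + y) i = coord x i + coord y i" "coord (- x) i = - coord x i"
  "coord (x - y) i = coord x i - coord y i" "coord (c *\<^sub>R x) i = c * coord x i"
  by (transfer; simp)+

lemma coord_sum [simp]: "coord (sum f A) i = (\<Sum>k\<in>A. coord (f k) i)"
  by (induction A rule: infinite_finite_induct) auto

instantiation l2 :: real_inner
begin

definition inner_l2 :: "l2 \<Rightarrow> l2 \<Rightarrow> real" where
  "inner_l2 x y = (\<Sum>i. coord x i * coord y i)"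
definition norm_l2 :: "l2 \<Rightarrow> real" where
  "norm_l2 x = sqrt (\<Sum>i. (coord x i)\<^sup>2)"
definition dist_l2 :: "l2 \<Rightarrow> l2 \<Rightarrow> real" where
  "dist_l2 x y = norm (x - y)"
definition sgn_l2 :: "l2 \<Rightarrow> l2" where
  "sgn_l2 x = x /\<^sub>R norm x"
definition uniformity_l2 :: "(l2 \<times> l2) filter" where
  "uniformity_l2 = (INF e\<in>{0<..}. principal {(x, y). dist x y < e})"
definition open_l2 :: "l2 set \<Rightarrow> bool" where
  "open_l2 U \<longleftrightarrow> (\<forall>x\<in>U. \<forall>\<^sub>F (x', y) in uniformity. x' = x \<longrightarrow> y \<in> U)"

instance
proof
  fix x y z :: l2 and r :: real
  show "dist x y = norm (x - y)" by (rule dist_l2_def)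
  show "sgn x = x /\<^sub>R norm x" by (rule sgn_l2_def)
  show "uniformity = (INF e\<in>{0<..}. principal {(x :: l2, y). dist x y < e})"
    by (rule uniformity_l2_def)
  show "open U \<longleftrightarrow> (\<forall>x\<in>U. \<forall>\<^sub>F (x', y) in uniformity. x' = x \<longrightarrow> y \<in> U)" for U :: "l2 set"
    by (rule open_l2_def)
  show "inner x y = inner y x"
    by (simp add: inner_l2_def mult.commute)
  show "inner (x + y) z = inner x z + inner y z"
    unfolding inner_l2_def by (subst suminf_add) (auto simp: algebra_simps)
  show "inner (r *\<^sub>R x) y = r * inner x y"
    unfolding inner_l2_def by (subst suminf_mult[symmetric]) (auto simp: algebra_simps)
  show "0 \<le> inner x x"
    unfolding inner_l2_def by (rule suminf_nonneg) auto
  show "inner x x = 0 \<longleftrightarrow> x = 0"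
  proof
    assume "inner x x = 0"
    then have "\<forall>i. coord x i * coord x i = 0"
      unfolding inner_l2_def by (subst (asm) suminf_eq_zero_iff) auto
    then show "x = 0" by (auto intro: l2_eqI)
  qed (simp add: inner_l2_def)
  show "norm x = sqrt (inner x x)"
    by (simp add: norm_l2_def inner_l2_def power2_eq_square)
qed

end

lemma norm_l2_sq: "(norm x)\<^sup>2 = (\<Sum>i. (coord x i)\<^sup>2)" for x :: l2
  unfolding norm_l2_def by (simp add: suminf_nonneg)

lemma sum_coord_le_norm_sq: "(\<Sum>i<n. (coord x i)\<^sup>2) \<le> (norm x)\<^sup>2" for x :: l2
  unfolding norm_l2_sq by (rule sum_le_suminf) auto

lemma abs_coord_le_norm: "\<bar>coord x i\<bar> \<le> norm x" for x :: l2
proof -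
  have "(coord x i)\<^sup>2 \<le> (\<Sum>k<Suc i. (coord x k)\<^sup>2)"
    by (rule member_le_sum) auto
  also have "\<dots> \<le> (norm x)\<^sup>2" by (rule sum_coord_le_norm_sq)
  finally show ?thesis
    by (simp add: abs_le_square_iff[symmetric])
qed

instance l2 :: complete_space
proof
  fix X :: "nat \<Rightarrow> l2"
  assume X: "Cauchy X"
  have "Cauchy (\<lambda>n. coord (X n) i)" for i
  proof (rule metric_CauchyI)
    fix e :: real
    assume "0 < e"
    then obtain M where M: "\<And>m n. m \<ge> M \<Longrightarrow> n \<ge> M \<Longrightarrow> dist (X m) (X n) < e"
      using X unfolding Cauchy_def by blast
    have "dist (coord (X m) i) (coord (X n) i) < e" if "m \<ge> M" "n \<ge> M" for m n
      using abs_coord_le_norm[of "X m - X n" i] M[OF that] by (simp add: dist_norm)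
    then show "\<exists>M. \<forall>m\<ge>M. \<forall>n\<ge>M. dist (coord (X m) i) (coord (X n) i) < e" by blast
  qed
  then obtain y where y: "\<And>i. (\<lambda>n. coord (X n) i) \<longlonglongrightarrow> y i"
    unfolding Cauchy_convergent_iff convergent_def by metis
  have tail: "(\<Sum>i<k. (coord (X n) i - y i)\<^sup>2) \<le> e\<^sup>2"
    if M: "\<And>m n. m \<ge> M \<Longrightarrow> n \<ge> M \<Longrightarrow> dist (X m) (X n) < e" and n: "n \<ge> M" for e M n k
  proof (rule LIMSEQ_le_const2)
    show "(\<lambda>m. \<Sum>i<k. (coord (X n) i - coord (X m) i)\<^sup>2) \<longlonglongrightarrow> (\<Sum>i<k. (coord (X n) i - y i)\<^sup>2)"
      by (intro tendsto_intros y)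
    have "(\<Sum>i<k. (coord (X n) i - coord (X m) i)\<^sup>2) \<le> e\<^sup>2" if "m \<ge> M" for m
    proof -
      have "(\<Sum>i<k. (coord (X n) i - coord (X m) i)\<^sup>2) \<le> (norm (X n - X m))\<^sup>2"
        using sum_coord_le_norm_sq[where n = k and x = "X n - X m"] by simp
      also have "\<dots> \<le> e\<^sup>2"
        using M[OF n that] by (intro power_mono) (auto simp: dist_norm)
      finally show ?thesis .
    qed
    then show "\<exists>N. \<forall>m\<ge>N. (\<Sum>i<k. (coord (X n) i - coord (X m) i)\<^sup>2) \<le> e\<^sup>2" by blast
  qed
  have diff: "summable (\<lambda>i. (coord (X n) i - y i)\<^sup>2) \<and> (\<Sum>i. (coord (X n) i - y i)\<^sup>2) \<le> e\<^sup>2"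
    if "\<And>m n. m \<ge> M \<Longrightarrow> n \<ge> M \<Longrightarrow> dist (X m) (X n) < e" "n \<ge> M" for e M n
  proof -
    have "summable (\<lambda>i. (coord (X n) i - y i)\<^sup>2)"
      by (rule summableI_nonneg_bounded) (use tail[OF that] in auto)
    then show ?thesis
      using suminf_le_const tail[OF that] by blast
  qed
  obtain M1 where M1: "\<And>m n. m \<ge> M1 \<Longrightarrow> n \<ge> M1 \<Longrightarrow> dist (X m) (X n) < 1"
    using X unfolding Cauchy_def by (meson zero_less_one)
  have "summable (\<lambda>i. (y i)\<^sup>2)"
  proof -
    have "summable (\<lambda>i. (y i - coord (X M1) i)\<^sup>2)"
      using diff[OF M1, of M1] by (simp add: power2_commute)
    from summable_sq_add[OF this summable_coord_sq[of "X M1"]] show ?thesis by simp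
  qed
  then have cy: "coord (Abs_l2 y) = y" by (simp add: Abs_l2_inverse)
  have "X \<longlonglongrightarrow> Abs_l2 y"
  proof (rule metric_LIMSEQ_I)
    fix r :: real
    assume "0 < r"
    then obtain M where M: "\<And>m n. m \<ge> M \<Longrightarrow> n \<ge> M \<Longrightarrow> dist (X m) (X n) < r / 2"
      using X unfolding Cauchy_def by (meson half_gt_zero)
    have "dist (X n) (Abs_l2 y) < r" if "n \<ge> M" for n
    proof -
      have "(norm (X n - Abs_l2 y))\<^sup>2 \<le> (r / 2)\<^sup>2"
        using diff[OF M that] unfolding norm_l2_sq by (simp add: cy)
      then have "norm (X n - Abs_l2 y) \<le> r / 2"
        by (rule power2_le_imp_le) (use \<open>0 < r\<close> in simp)
      then show ?thesis using \<open>0 < r\<close> by (simp add: dist_norm)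
    qed
    then show "\<exists>no. \<forall>n\<ge>no. dist (X n) (Abs_l2 y) < r" by blast
  qed
  then show "convergent X" by (auto simp: convergent_def)
qed

lift_definition basis :: "nat \<Rightarrow> l2" is "\<lambda>i j. if j = i then 1 else 0"
proof -
  show "summable (\<lambda>j. (if j = i then 1 else 0 :: real)\<^sup>2)" for i :: nat
    by (rule summable_finite[of "{i}"]) auto
qed

lift_definition set_first :: "l2 \<Rightarrow> real \<Rightarrow> l2" is "\<lambda>x t. x(0 := t)"
proof -
  fix x :: "nat \<Rightarrow> real" and t :: real
  assume "summable (\<lambda>i. (x i)\<^sup>2)"
  then have "summable (\<lambda>i. (x (Suc i))\<^sup>2)"
    by (subst summable_Suc_iff)
  then have "summable (\<lambda>i. ((x(0 := t)) (Suc i))\<^sup>2)" by simp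
  then show "summable (\<lambda>i. ((x(0 := t)) i)\<^sup>2)"
    by (rule summable_Suc_iff[THEN iffD1])
qed

lemma coord_basis: "coord (basis i) j = (if j = i then 1 else 0)"
  by transfer simp

lemma coord_set_first: "coord (set_first x t) i = (if i = 0 then t else coord x i)"
  by transfer simp

lemma norm_basis [simp]: "norm (basis i) = 1"
proof -
  have "(\<Sum>j. (coord (basis i) j)\<^sup>2) = (\<Sum>j\<in>{i}. (coord (basis i) j)\<^sup>2)"
    by (rule suminf_finite) (auto simp: coord_basis)
  then show ?thesis by (simp add: norm_l2_def coord_basis)
qed

definition halfspace :: "l2 set" where
  "halfspace = {x. coord x 0 > 0}"

lemma l2_separable:
  "\<exists>D :: l2 set. countable D \<and> (\<forall>x e. e > 0 \<longrightarrow> (\<exists>d\<in>D. dist x d < e))"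
proof -
  define D where "D = (\<lambda>qs. \<Sum>i<length qs. (qs ! i) *\<^sub>R basis i) ` lists \<rat>"
  have "countable D"
    unfolding D_def by (intro countable_image countable_lists countable_rat)
  moreover have "\<exists>d\<in>D. dist x d < e" if e: "e > 0" for x e
  proof -
    define t where "t = (\<lambda>n. \<Sum>i<n. coord x i *\<^sub>R basis i)"
    have ct: "coord (t n) j = (if j < n then coord x j else 0)" for n j
    proof -
      have "coord (t n) j = (\<Sum>i<n. if i = j then coord x i else 0)"
        unfolding t_def by (simp add: coord_basis if_distrib cong: if_cong)
      then show ?thesis by simp
    qed
    have nt: "(norm (x - t n))\<^sup>2 = (\<Sum>i. (coord x (i + n))\<^sup>2)" for n
    proof -
      have s: "summable (\<lambda>i. (coord (x - t n) i)\<^sup>2)" by (rule summable_coord_sq)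
      have "(norm (x - t n))\<^sup>2 = (\<Sum>i. (coord (x - t n) (i + n))\<^sup>2) + (\<Sum>i<n. (coord (x - t n) i)\<^sup>2)"
        unfolding norm_l2_sq by (rule suminf_split_initial_segment[OF s])
      then show ?thesis by (simp add: ct)
    qed
    have "(e / 2)\<^sup>2 > 0" using e by simp
    from suminf_exist_split[OF this summable_coord_sq[of x]]
    obtain n where n: "norm (\<Sum>i. (coord x (i + n))\<^sup>2) < (e / 2)\<^sup>2" by auto
    then have "(norm (x - t n))\<^sup>2 < (e / 2)\<^sup>2" unfolding nt by simp
    then have 1: "norm (x - t n) < e / 2"
      by (rule power2_less_imp_less) (use e in simp)
    define c where "c = e / (2 * (real n + 1))"
    have c: "c > 0" using e by (simp add: c_def)
    have "\<exists>q\<in>\<rat>. \<bar>coord x i - q\<bar> < c" for i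
    proof -
      obtain r where "r \<in> \<rat>" "coord x i - c < r" "r < coord x i"
        using Rats_dense_in_real[of "coord x i - c" "coord x i"] c by auto
      then show ?thesis by (intro bexI[of _ r]) auto
    qed
    then obtain q where q: "\<And>i. q i \<in> \<rat>" "\<And>i. \<bar>coord x i - q i\<bar> < c" by metis
    define d where "d = (\<Sum>i<n. q i *\<^sub>R basis i)"
    have "d \<in> D"
      unfolding D_def d_def
      by (rule image_eqI[of _ _ "map q [0..<n]"]) (use q(1) in auto)
    moreover have "dist x d < e"
    proof -
      have "norm (t n - d) = norm (\<Sum>i<n. (coord x i - q i) *\<^sub>R basis i)"
        by (simp add: t_def d_def sum_subtractf scaleR_diff_left)
      also have "\<dots> \<le> (\<Sum>i<n. norm ((coord x i - q i) *\<^sub>R basis i))"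
        by (rule norm_sum)
      also have "\<dots> \<le> (\<Sum>i<n. c)"
        by (rule sum_mono) (use q(2) less_imp_le in auto)
      also have "\<dots> \<le> e / 2"
        using e by (simp add: c_def field_simps)
      finally have "norm (t n - d) \<le> e / 2" .
      moreover have "norm (x - d) \<le> norm (x - t n) + norm (t n - d)"
        using norm_triangle_ineq[of "x - t n" "t n - d"] by simp
      ultimately show ?thesis using 1 by (simp add: dist_norm)
    qed
    ultimately show ?thesis by blast
  qed
  ultimately show ?thesis by blast
qed

instance l2 :: polish_space
proof
  obtain D :: "l2 set" where D: "countable D" "\<And>x e. e > 0 \<Longrightarrow> \<exists>d\<in>D. dist x d < e"
    using l2_separable by blast
  define B where "B = (\<lambda>(d, r). ball d r) ` (D \<times> (\<rat> :: real set))"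
  have "topological_basis B"
  proof (rule topological_basisI)
    show "open b" if "b \<in> B" for b using that by (auto simp: B_def)
    fix U and x :: l2
    assume "open U" "x \<in> U"
    then obtain e where e: "e > 0" "ball x e \<subseteq> U" by (meson open_contains_ball)
    obtain r where r: "r \<in> \<rat>" "e / 4 < r" "r < e / 2"
      using Rats_dense_in_real[of "e / 4" "e / 2"] e by auto
    obtain d where d: "d \<in> D" "dist x d < e / 4" using D(2)[of "e / 4" x] e by auto
    have "ball d r \<subseteq> ball x e"
    proof
      fix y assume "y \<in> ball d r"
      then have "dist d y < e / 2" using r by simp
      then show "y \<in> ball x e" using dist_triangle[of x y d] d e by simp
    qed
    then show "\<exists>B'\<in>B. x \<in> B' \<and> B' \<subseteq> U"
      using d r e by (intro bexI[of _ "ball d r"]) (auto simp: B_def dist_commute)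
  qed
  moreover have "countable B"
    unfolding B_def by (intro countable_image countable_SIGMA D countable_rat)
  ultimately show "\<exists>B :: l2 set set. countable B \<and> open = generate_topology B"
    by (blast dest: topological_basis_imp_subbasis)
qed


section \<open>The Gaussian measure\<close>

definition gauss_prod :: "(nat \<Rightarrow> real) \<Rightarrow> (nat \<Rightarrow> real) measure" where
  "gauss_prod a = (\<Pi>\<^sub>M i\<in>UNIV. density lborel (\<lambda>x. ennreal (normal_density 0 (a i) x)))"

text \<open>The restriction of the product measure to the square-summable sequences,
  carried over to the Borel sets of \<^typ>\<open>l2\<close>. On the range of \<^const>\<open>coord\<close>,
  \<^const>\<open>Abs_l2\<close> is the inverse of \<^const>\<open>coord\<close>, so a Borel set \<open>A\<close> has measure
  \<open>emeasure (gauss_prod a) (coord ` A)\<close>; see \<open>emeasure_gauss_l2\<close> and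
  \<open>prob_space_gauss_l2\<close> below.\<close>

definition gauss_l2 :: "(nat \<Rightarrow> real) \<Rightarrow> l2 measure" where
  "gauss_l2 a = distr (restrict_space (gauss_prod a) (range coord)) borel Abs_l2"

lemma sets_gauss_l2 [simp, measurable_cong]: "sets (gauss_l2 a) = sets borel"
  by (simp add: gauss_l2_def)

lemma space_gauss_l2 [simp]: "space (gauss_l2 a) = UNIV"
  by (simp add: gauss_l2_def)

lemma sets_gauss_prod [measurable_cong]: "sets (gauss_prod a) = sets (\<Pi>\<^sub>M i\<in>UNIV. borel)"
  unfolding gauss_prod_def by (rule sets_PiM_cong) auto

lemma range_coord: "range coord = {x. summable (\<lambda>i. (x i)\<^sup>2)}"
  using type_definition.Rep_range[OF type_definition_l2] by simp

lemma space_gauss_prod [simp]: "space (gauss_prod a) = UNIV"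
  by (simp add: gauss_prod_def space_PiM)

lemma range_coord_sets: "range coord \<in> sets (gauss_prod a)"
proof -
  have [measurable]: "(\<lambda>x. x i) \<in> borel_measurable (gauss_prod a)" for i
    by measurable
  have "{x. summable (\<lambda>i. (x i)\<^sup>2)} = {x \<in> space (gauss_prod a). Cauchy (\<lambda>n. \<Sum>i<n. (x i)\<^sup>2)}"
    by (auto simp: summable_iff_convergent Cauchy_convergent_iff)
  also have "\<dots> \<in> sets (gauss_prod a)"
    by measurable
  finally show ?thesis by (simp add: range_coord)
qed

lemma measurable_Abs_l2:
  "Abs_l2 \<in> restrict_space (gauss_prod a) (range coord) \<rightarrow>\<^sub>M borel"
proof (rule borel_measurableI)
  let ?M = "restrict_space (gauss_prod a) (range coord)"
  have [measurable]: "(\<lambda>x. x i) \<in> borel_measurable ?M" for i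
    by (rule measurable_restrict_space1) measurable
  have sp: "space ?M = {x. summable (\<lambda>i. (x i)\<^sup>2)}"
    by (simp add: space_restrict_space range_coord)
  fix S :: "l2 set"
  assume "open S"
  have ball: "Abs_l2 -` ball d r \<inter> space ?M \<in> sets ?M" for d r
  proof -
    have "Abs_l2 -` ball d r \<inter> space ?M =
        {x \<in> space ?M. sqrt (\<Sum>i. (coord d i - x i)\<^sup>2) < r}"
      unfolding sp by (auto simp: dist_norm norm_l2_def Abs_l2_inverse)
    also have "\<dots> \<in> sets ?M" by measurable
    finally show ?thesis .
  qed
  obtain \<B> where \<B>: "countable \<B>" "\<And>C. C \<in> \<B> \<Longrightarrow> \<exists>d r. C = ball d r" "S = \<Union>\<B>"
  proof -
    define G where "G = {ball d r | d r. ball d r \<subseteq> S}"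
    have "\<And>C. C \<in> G \<Longrightarrow> open C" by (auto simp: G_def)
    then obtain G' where G': "G' \<subseteq> G" "countable G'" "\<Union>G' = \<Union>G"
      using Lindelof[of G] by blast
    have "\<Union>G = S"
    proof
      show "S \<subseteq> \<Union>G"
      proof
        fix x assume "x \<in> S"
        then obtain e where "e > 0" "ball x e \<subseteq> S"
          using \<open>open S\<close> by (meson open_contains_ball)
        then show "x \<in> \<Union>G" by (auto simp: G_def intro!: exI[of _ "ball x e"])
      qed
    qed (auto simp: G_def)
    moreover have "\<exists>d r. C = ball d r" if "C \<in> G'" for C
      using that G'(1) unfolding G_def by blast
    ultimately show ?thesis using G'(2,3) by (intro that[of G']) simp_all
  qed
  have "Abs_l2 -` S \<inter> space ?M = (\<Union>C\<in>\<B>. Abs_l2 -` C \<inter> space ?M)"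
    using \<B>(3) by auto
  also have "\<dots> \<in> sets ?M"
  proof -
    have "Abs_l2 -` C \<inter> space ?M \<in> sets ?M" if "C \<in> \<B>" for C
      using \<B>(2)[OF that] ball by auto
    then show ?thesis by (rule sets.countable_UN''[OF \<B>(1)])
  qed
  finally show "Abs_l2 -` S \<inter> space ?M \<in> sets ?M" .
qed

lemma emeasure_gauss_l2:
  assumes "A \<in> sets borel"
  shows "emeasure (gauss_l2 a) A = emeasure (gauss_prod a) (coord ` A)"
proof -
  let ?M = "restrict_space (gauss_prod a) (range coord)"
  have "emeasure (gauss_l2 a) A = emeasure ?M (Abs_l2 -` A \<inter> space ?M)"
    unfolding gauss_l2_def by (rule emeasure_distr[OF measurable_Abs_l2 assms])
  also have "Abs_l2 -` A \<inter> space ?M = coord ` A"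
    by (auto simp: space_restrict_space coord_inverse image_iff) 
  also have "emeasure ?M (coord ` A) = emeasure (gauss_prod a) (coord ` A)"
    using range_coord_sets[of a] by (intro emeasure_restrict_space) auto
  finally show ?thesis .
qed

lemma prob_space_gauss_l2:
  assumes a: "\<And>i. a i > 0" and summ: "summable a"
  shows "prob_space (gauss_l2 a)"
proof -
  define N where "N = (\<lambda>i. density lborel (\<lambda>x. ennreal (normal_density 0 (a i) x)))"
  interpret N: prob_space "N i" for i
    unfolding N_def by (rule prob_space_normal_density[OF a])
  interpret product_prob_space N UNIV by unfold_locales
  have P: "gauss_prod a = PiM UNIV N" by (simp add: gauss_prod_def N_def)
  have pP: "prob_space (gauss_prod a)"
    unfolding P by (rule prob_space_PiM) unfold_locales
    have setsN [measurable_cong]: "sets (N i) = sets borel" for i by (simp add: N_def)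
  have [measurable]: "(\<lambda>x. x i) \<in> borel_measurable (gauss_prod a)" for i
    by measurable
  have comp: "(\<lambda>x. x i) \<in> gauss_prod a \<rightarrow>\<^sub>M N i" for i
    unfolding P by (rule measurable_component_singleton) simp
  have sq: "(\<lambda>y. ennreal (y\<^sup>2)) \<in> borel_measurable (N i)" for i
    unfolding measurable_cong_sets[OF setsN refl] by measurable
  have mom: "(\<integral>\<^sup>+ x. ennreal ((x i)\<^sup>2) \<partial>gauss_prod a) = ennreal ((a i)\<^sup>2)" for i
  proof -
    have "(\<integral>\<^sup>+ x. ennreal ((x i)\<^sup>2) \<partial>gauss_prod a) = (\<integral>\<^sup>+ y. ennreal (y\<^sup>2) \<partial>N i)"
    proof -
      have "N i = distr (gauss_prod a) (N i) (\<lambda>x. x i)"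
        unfolding P by (rule PiM_component[symmetric]) simp
      then have "(\<integral>\<^sup>+ y. ennreal (y\<^sup>2) \<partial>N i) =
          (\<integral>\<^sup>+ y. ennreal (y\<^sup>2) \<partial>distr (gauss_prod a) (N i) (\<lambda>x. x i))"
        by simp
      also have "\<dots> = (\<integral>\<^sup>+ x. ennreal ((x i)\<^sup>2) \<partial>gauss_prod a)"
        by (rule nn_integral_distr[OF comp]) (simp add: sq)
      finally show ?thesis by simp
    qed
    also have "\<dots> = (\<integral>\<^sup>+ y. ennreal (normal_density 0 (a i) y * y\<^sup>2) \<partial>lborel)"
      unfolding N_def by (subst nn_integral_density) (auto simp: ennreal_mult normal_density_nonneg)
    also have "\<dots> = ennreal ((a i)\<^sup>2)"
      using normal_moment_even[OF a[of i], of 0 1]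
      by (subst nn_integral_eq_integral) (auto simp: has_bochner_integral_iff power2_eq_square)
    finally show ?thesis .
  qed
  have "summable (\<lambda>i. (a i)\<^sup>2)"
  proof (rule summable_comparison_test_ev[OF _ summ])
    have "a \<longlonglongrightarrow> 0" by (rule summable_LIMSEQ_zero[OF summ])
    then have "\<forall>\<^sub>F i in sequentially. a i < 1" by (rule order_tendstoD) simp
    then show "\<forall>\<^sub>F i in sequentially. norm ((a i)\<^sup>2) \<le> a i"
    proof eventually_elim
      case (elim i)
      then show ?case using a[of i] by (simp add: power2_eq_square mult_left_le)
    qed
  qed
  then have "(\<integral>\<^sup>+ x. (\<Sum>i. ennreal ((x i)\<^sup>2)) \<partial>gauss_prod a) < \<infinity>"
    by (subst nn_integral_suminf) (auto simp: mom ennreal_suminf_neq_top less_top[symmetric])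
  then have "AE x in gauss_prod a. (\<Sum>i. ennreal ((x i)\<^sup>2)) \<noteq> \<infinity>"
    by (intro nn_integral_PInf_AE) auto
  then have "AE x in gauss_prod a. x \<in> range coord"
    unfolding range_coord by eventually_elim (auto intro: summable_suminf_not_top)
  then have "emeasure (gauss_prod a) (range coord) = 1"
    using prob_space.emeasure_eq_1_AE[OF pP range_coord_sets] by simp
  then show ?thesis
    by (intro prob_spaceI) (simp add: emeasure_gauss_l2)
qed


section \<open>Function classes\<close>

text \<open>All functions are total functions on \<^typ>\<open>l2\<close>; for an open set \<open>V\<close> the notions below
  depend only on their values on \<open>V\<close>.\<close>

text \<open>\<^const>\<open>Euclidean_space\<close>~\<open>n\<close> is $\mathbb{R}^n$, realised as the sequences vanishing from
  index \<open>n\<close> on.\<close>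

definition F_continuous_on :: "l2 set \<Rightarrow> (l2 \<Rightarrow> real) \<Rightarrow> bool" where
  "F_continuous_on V f \<longleftrightarrow>
    (\<forall>x\<in>V. \<forall>n. continuous_map
      (subtopology (Euclidean_space n) {s. x + (\<Sum>k<n. s k *\<^sub>R basis k) \<in> V}) euclideanreal
      (\<lambda>s. f (x + (\<Sum>k<n. s k *\<^sub>R basis k))))"

definition partial :: "nat \<Rightarrow> (l2 \<Rightarrow> real) \<Rightarrow> l2 \<Rightarrow> real" where
  "partial i f x = deriv (\<lambda>t. f (x + t *\<^sub>R basis i)) 0"

definition has_partial_at :: "nat \<Rightarrow> (l2 \<Rightarrow> real) \<Rightarrow> l2 \<Rightarrow> bool" where
  "has_partial_at i f x \<longleftrightarrow> (\<lambda>t. f (x + t *\<^sub>R basis i)) differentiable (at 0)"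

text \<open>\<open>partials [i\<^sub>1, \<dots>, i\<^sub>k] f\<close> is the iterated derivative $D_{i_1} \cdots D_{i_k} f$.
  Boundedness is required of the derivatives of order at least 1, not of \<open>f\<close>, and with a
  bound depending on the derivative.\<close>

definition partials :: "nat list \<Rightarrow> (l2 \<Rightarrow> real) \<Rightarrow> l2 \<Rightarrow> real" where
  "partials is f = foldr partial is f"

definition C_F_inf :: "l2 set \<Rightarrow> (l2 \<Rightarrow> real) set" where
  "C_F_inf V = {f.
    F_continuous_on V f \<and> f \<in> borel_measurable (restrict_space borel V) \<and>
    (\<forall>is i. (\<forall>x\<in>V. has_partial_at i (partials is f) x) \<and>
      bounded (partials (i # is) f ` V) \<and>
      F_continuous_on V (partials (i # is) f) \<and>
      partials (i # is) f \<in> borel_measurable (restrict_space borel V))}"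

definition inside :: "l2 set \<Rightarrow> l2 set \<Rightarrow> bool"  (infix "\<Subset>\<^sub>o" 50) where
  "E \<Subset>\<^sub>o V \<longleftrightarrow> (\<exists>\<rho>>0. \<exists>R>0. (\<Union>x\<in>E. ball x \<rho>) \<subseteq> V \<and> E \<subseteq> ball 0 R)"

text \<open>The closure in the support is taken in the whole space; because \<open>\<Subset>\<^sub>o\<close> asks for a
  uniform distance to the complement, the closure relative to \<open>V\<close> gives the same class.\<close>

definition C_F_0 :: "l2 set \<Rightarrow> (l2 \<Rightarrow> real) set" where
  "C_F_0 V = {f \<in> C_F_inf V.
    (SUP x\<in>V. ennreal \<bar>f x\<bar> + (\<Sum>i. ennreal ((partial i f x)\<^sup>2))) < \<infinity> \<and>
    closure {x \<in> V. f x \<noteq> 0} \<Subset>\<^sub>o V}"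

definition L2_on :: "(nat \<Rightarrow> real) \<Rightarrow> l2 set \<Rightarrow> (l2 \<Rightarrow> real) set" where
  "L2_on a V = {f. f \<in> borel_measurable (restrict_space borel V) \<and>
    set_integrable (gauss_l2 a) V (\<lambda>x. (f x)\<^sup>2)}"

definition adj_partial :: "(nat \<Rightarrow> real) \<Rightarrow> nat \<Rightarrow> (l2 \<Rightarrow> real) \<Rightarrow> l2 \<Rightarrow> real" where
  "adj_partial a i \<phi> x = - partial i \<phi> x + coord x i / (a i)\<^sup>2 * \<phi> x"

definition has_weak_partial ::
  "(nat \<Rightarrow> real) \<Rightarrow> l2 set \<Rightarrow> nat \<Rightarrow> (l2 \<Rightarrow> real) \<Rightarrow> (l2 \<Rightarrow> real) \<Rightarrow> bool" where
  "has_weak_partial a V i f q \<longleftrightarrow> f \<in> L2_on a V \<and> q \<in> L2_on a V \<and>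
    (\<forall>\<phi>\<in>C_F_0 V. (LINT x:V|gauss_l2 a. q x * \<phi> x) = (LINT x:V|gauss_l2 a. f x * adj_partial a i \<phi> x))"

text \<open>The weak derivative is unique only up to null sets; \<open>weak_partial\<close> selects a representative.\<close>

definition weak_partial :: "(nat \<Rightarrow> real) \<Rightarrow> l2 set \<Rightarrow> nat \<Rightarrow> (l2 \<Rightarrow> real) \<Rightarrow> l2 \<Rightarrow> real" where
  "weak_partial a V i f = (SOME q. has_weak_partial a V i f q)"

definition W12 :: "(nat \<Rightarrow> real) \<Rightarrow> l2 set \<Rightarrow> (l2 \<Rightarrow> real) set" where
  "W12 a V = {f \<in> L2_on a V. (\<forall>i. \<exists>q. has_weak_partial a V i f q) \<and>
    summable (\<lambda>i. (a i)\<^sup>2 * (LINT x:V|gauss_l2 a. (weak_partial a V i f x)\<^sup>2))}"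

definition W12_norm :: "(nat \<Rightarrow> real) \<Rightarrow> l2 set \<Rightarrow> (l2 \<Rightarrow> real) \<Rightarrow> real" where
  "W12_norm a V f = sqrt ((LINT x:V|gauss_l2 a. (f x)\<^sup>2) +
    (\<Sum>i. (a i)\<^sup>2 * (LINT x:V|gauss_l2 a. (weak_partial a V i f x)\<^sup>2)))"

definition C1_on :: "l2 set \<Rightarrow> (l2 \<Rightarrow> real) \<Rightarrow> bool" where
  "C1_on V f \<longleftrightarrow> (\<exists>f' :: l2 \<Rightarrow> (l2 \<Rightarrow>\<^sub>L real).
    (\<forall>x\<in>V. (f has_derivative blinfun_apply (f' x)) (at x)) \<and> continuous_on V f')"

text \<open>The set \<open>Q\<close> is the domain usually written $O$; that letter is reserved for relation
  composition.\<close>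

definition flattening_condition ::
  "(nat \<Rightarrow> real) \<Rightarrow> l2 set \<Rightarrow> l2 set \<Rightarrow> (l2 \<Rightarrow> real) \<Rightarrow> (l2 \<Rightarrow> real) \<Rightarrow>
    (l2 \<Rightarrow> l2) \<Rightarrow> (l2 \<Rightarrow> l2) \<Rightarrow> bool" where
  "flattening_condition a Q U g h \<psi> \<tau> \<longleftrightarrow>
    h \<in> C_F_inf (\<psi> ` U) \<and> g \<in> C_F_inf U \<and>
    (\<exists>\<delta>>0. \<forall>x\<in>U. \<forall>y\<in>\<psi> ` U.
      \<bar>coord x 0\<bar> < \<delta> \<and> \<bar>coord y 0\<bar> < \<delta> \<and> \<bar>h y\<bar> < \<delta> \<and> \<bar>g x\<bar> < \<delta> \<and>
      1 / \<delta> < partial 0 h y \<and> partial 0 h y < \<delta> \<and>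
      1 / \<delta> < partial 0 g x \<and> partial 0 g x < \<delta> \<and>
      (\<Sum>i. ennreal ((a i)\<^sup>2 * (partial i h y)\<^sup>2)) < ennreal \<delta>) \<and>
    (\<forall>E. E \<Subset>\<^sub>o U \<inter> Q \<longrightarrow> \<psi> ` E \<Subset>\<^sub>o \<psi> ` U \<inter> halfspace) \<and>
    (\<forall>E. E \<Subset>\<^sub>o \<psi> ` U \<inter> halfspace \<longrightarrow> \<tau> ` E \<Subset>\<^sub>o U \<inter> Q)"

end

theory Submission
  imports Defs "HOL-Computational_Algebra.Polynomial"
begin

text \<open>Write \<open>u = \<phi> \<circ> \<psi>\<close> for a test function \<open>\<phi>\<close> on the flattened side, and let \<open>w\<close> be the quotient
  of the one-dimensional Gaussian densities at \<open>g x\<close> and at the first coordinate of \<open>x\<close>. The change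
  of variables in the first coordinate has Jacobian \<open>w D\<^sub>1 g\<close>, which is bounded. As
  \<open>D\<^sub>i h \<circ> \<psi> = - D\<^sub>i g / D\<^sub>1 g\<close>, testing the expected derivative
  \<open>D\<^sub>i f \<circ> \<tau> + (D\<^sub>1 f \<circ> \<tau>) D\<^sub>i h\<close> against \<open>\<phi>\<close> amounts to testing \<open>D\<^sub>i f\<close> against \<open>u w D\<^sub>1 g\<close> and
  \<open>D\<^sub>1 f\<close> against \<open>- u w D\<^sub>i g\<close>, and the symmetry of the second derivatives of \<open>g\<close> gives the weak
  chain rule. The norm estimate follows from the bound on the sum of the \<open>a\<^sub>i\<^sup>2 (D\<^sub>i h)\<^sup>2\<close>, and the
  situation is symmetric in \<open>\<psi>\<close> and \<open>\<tau>\<close>.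

  The obstacle is that \<open>u w D\<^sub>1 g\<close> need not have a bounded full gradient, so that it is not a
  test function. But the defining identity of the \<open>i\<close>-th weak derivative extends to functions that
  are continuously differentiable in the \<open>i\<close>-th direction alone. Bump functions on balls, multiplied
  by functions of single coordinates, are test functions; a monotone class argument allows an
  arbitrary bounded Borel factor not depending on \<open>x\<^sub>i\<close>; a superposition of such products
  treats the dependence on \<open>x\<^sub>i\<close>; and compactness of the support on each line parallel to \<open>e\<^sub>i\<close> allows
  passing from balls to the whole domain by means of Borel sets of lines.\<close>

section \<open>Smooth functions of one variable\<close>

text \<open>Two features of infinite dimension shape the argument. Membership in the test class
  requires a bound on the whole gradient; on a ball the squared distance to the centre has one, so
  localisation is done by balls. And a bounded closed set need not be compact, so finitely many
  balls need not cover the support of a test function. On a single line finitely many do, but how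
  many depends on the line. The lines for which the first K balls suffice form a Borel set invariant
  under shifts along e_i, and multiplying by its indicator costs no regularity in that direction.
  The factor D_1 g of the Jacobian clears the denominator of D_i h o psi before anything is
  differentiated, so only first and second partial derivatives of g occur. Each transport is
  estimated from above only: the lower bound is the upper bound for the inverse map, applied to the
  transported function.\<close>

definition smooth :: "(real \<Rightarrow> real) \<Rightarrow> bool" where
  "smooth \<theta> \<longleftrightarrow> (\<exists>m :: nat \<Rightarrow> real \<Rightarrow> real. m 0 = \<theta> \<and>
    (\<forall>k t. (m k has_real_derivative m (Suc k) t) (at t)))"

lemma smooth_obtain_deriv:
  assumes "smooth \<theta>"
  obtains \<theta>' where "smooth \<theta>'" "\<And>t. (\<theta> has_real_derivative \<theta>' t) (at t)"
proof -
  obtain m where m: "m 0 = \<theta>" "\<And>k t. (m k has_real_derivative m (Suc k) t) (at t)"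
    using assms unfolding smooth_def by blast
  show ?thesis
  proof (rule that)
    show "smooth (m 1)"
      unfolding smooth_def by (rule exI[of _ "\<lambda>k. m (Suc k)"]) (auto simp: m(2))
    show "(\<theta> has_real_derivative m 1 t) (at t)" for t
      using m(2)[of 0 t] m(1) by simp
  qed
qed

lemma smooth_continuous: "smooth \<theta> \<Longrightarrow> continuous_on A \<theta>"
  by (metis smooth_obtain_deriv DERIV_isCont continuous_at_imp_continuous_on)

lemma smooth_comp_affine:
  assumes "smooth \<theta>"
  shows "smooth (\<lambda>t. \<theta> (c * t + d))"
proof -
  obtain m where m: "m 0 = \<theta>" "\<And>k t. (m k has_real_derivative m (Suc k) t) (at t)"
    using assms unfolding smooth_def by blast
  have "((\<lambda>t. c ^ k * m k (c * t + d)) has_real_derivative c ^ Suc k * m (Suc k) (c * t + d)) (at t)"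
    for k t
    by (auto intro!: derivative_eq_intros DERIV_chain2[OF m(2)] simp: algebra_simps)
  then show ?thesis
    unfolding smooth_def by (intro exI[of _ "\<lambda>k t. c ^ k * m k (c * t + d)"]) (simp add: m(1))
qed

lemma smooth_affine: "smooth (\<lambda>t. c * t + d)"
proof -
  let ?m = "\<lambda>k t. if k = 0 then c * t + d else if k = 1 then c else 0 :: real"
  have "(?m k has_real_derivative ?m (Suc k) t) (at t)" for k :: nat and t
    by (cases k) (auto intro!: derivative_eq_intros)
  then show ?thesis unfolding smooth_def by (intro exI[of _ ?m]) auto
qed

text \<open>Differentiating \<open>exp (- (1 / t))\<close> produces powers of \<open>1 / t\<close>.
  With a polynomial factor the family is closed under differentiation: \<open>p\<close> is replaced
  by \<open>X^2 (p - p')\<close>.\<close>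

definition flat_exp :: "real poly \<Rightarrow> real \<Rightarrow> real" where
  "flat_exp p t = (if t \<le> 0 then 0 else poly p (1 / t) * exp (- (1 / t)))"

lemma poly_times_exp_uminus_tendsto_0:
  "((\<lambda>x. poly p x * exp (- x)) \<longlongrightarrow> 0) at_top" for p :: "real poly"
proof -
  have "((\<lambda>x. \<Sum>i\<le>degree p. coeff p i * (x ^ i / exp x)) \<longlongrightarrow> (\<Sum>i\<le>degree p. coeff p i * 0)) at_top"
    by (intro tendsto_sum tendsto_mult tendsto_const tendsto_power_div_exp_0)
  then show ?thesis
    by (simp add: poly_altdef exp_minus sum_distrib_right divide_inverse mult.assoc)
qed

lemma flat_exp_tendsto_0: "(flat_exp p \<longlongrightarrow> 0) (at 0)"
proof (rule filterlim_split_at_real)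
  show "(flat_exp p \<longlongrightarrow> 0) (at_left 0)"
    by (rule tendsto_eventually) (auto simp: flat_exp_def eventually_at_filter)
  have "((\<lambda>t. poly p (inverse t) * exp (- inverse t)) \<longlongrightarrow> 0) (at_right 0)"
    by (rule filterlim_compose[OF poly_times_exp_uminus_tendsto_0 filterlim_inverse_at_top_right])
  moreover have "\<forall>\<^sub>F t in at_right 0. poly p (inverse t) * exp (- inverse t) = flat_exp p t"
    by (auto simp: flat_exp_def eventually_at_filter inverse_eq_divide)
  ultimately show "(flat_exp p \<longlongrightarrow> 0) (at_right 0)"
    by (rule Lim_transform_eventually)
qed

lemma flat_exp_has_derivative:
  "(flat_exp p has_real_derivative flat_exp (monom 1 2 * (p - pderiv p)) t) (at t)"
proof (cases t "0 :: real" rule: linorder_cases)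
  case less
  have "((\<lambda>_. 0 :: real) has_real_derivative 0) (at t)" by simp
  then have "(flat_exp p has_real_derivative 0) (at t)"
    by (rule has_field_derivative_transform_within_open[of _ _ _ "{..<0}"])
       (use less in \<open>auto simp: flat_exp_def\<close>)
  then show ?thesis using less by (simp add: flat_exp_def)
next
  case greater
  have "((\<lambda>t. poly p (1 / t) * exp (- (1 / t))) has_real_derivative
      poly (monom 1 2 * (p - pderiv p)) (1 / t) * exp (- (1 / t))) (at t)"
    using greater by (auto intro!: derivative_eq_intros DERIV_chain2[OF poly_DERIV]
        simp: poly_monom field_simps power2_eq_square)
  then have "(flat_exp p has_real_derivative
      poly (monom 1 2 * (p - pderiv p)) (1 / t) * exp (- (1 / t))) (at t)"
    by (rule has_field_derivative_transform_within_open[of _ _ _ "{0<..}"])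
       (use greater in \<open>auto simp: flat_exp_def\<close>)
  then show ?thesis using greater by (simp add: flat_exp_def)
next
  case equal
  \<comment> \<open>Division by \<open>h\<close> multiplies the polynomial by X, so the difference
    quotient at 0 is itself a member of the family and tends to 0.\<close>
  have "((\<lambda>h. (flat_exp p (0 + h) - flat_exp p 0) / h) \<longlongrightarrow> 0) (at 0)"
  proof (rule Lim_transform_eventually[OF flat_exp_tendsto_0[of "monom 1 1 * p"]])
    show "\<forall>\<^sub>F h in at 0. flat_exp (monom 1 1 * p) h = (flat_exp p (0 + h) - flat_exp p 0) / h"
      by (rule eventuallyI) (auto simp: flat_exp_def poly_monom)
  qed
  then show ?thesis using equal by (simp add: DERIV_def flat_exp_def)
qed

lemma smooth_flat_exp: "smooth (flat_exp p)"
proof -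
  define m where "m = (\<lambda>k. flat_exp (((\<lambda>p. monom 1 2 * (p - pderiv p)) ^^ k) p))"
  show ?thesis
    unfolding smooth_def
    by (rule exI[of _ m]) (auto simp: m_def flat_exp_has_derivative)
qed

section \<open>A smooth transition function and its derivative\<close>

definition ramp :: "real \<Rightarrow> real" where
  "ramp = flat_exp 1"

definition ramp' :: "real \<Rightarrow> real" where
  "ramp' = flat_exp (monom 1 2)"

lemma ramp_eq: "ramp t = (if t \<le> 0 then 0 else exp (- (1 / t)))"
  by (simp add: ramp_def flat_exp_def)

lemma ramp'_eq: "ramp' t = (if t \<le> 0 then 0 else exp (- (1 / t)) / t\<^sup>2)"
  by (simp add: ramp'_def flat_exp_def poly_monom power_divide)

lemma smooth_ramp [simp]: "smooth ramp" and smooth_ramp' [simp]: "smooth ramp'"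
  by (simp_all add: ramp_def ramp'_def smooth_flat_exp)

lemma ramp_has_derivative: "(ramp has_real_derivative ramp' t) (at t)"
  using flat_exp_has_derivative[of 1 t] by (simp add: ramp_def ramp'_def pderiv_1)

text \<open>Smooth approximations of the Heaviside function. Their derivatives \<open>steep'\<close>
  form an approximate identity, by \<open>ramp'_integral\<close>.\<close>

abbreviation steep :: "nat \<Rightarrow> real \<Rightarrow> real" where
  "steep n u \<equiv> ramp (real (Suc n) * u)"

abbreviation steep' :: "nat \<Rightarrow> real \<Rightarrow> real" where
  "steep' n u \<equiv> real (Suc n) * ramp' (real (Suc n) * u)"

lemma ramp_nonneg [simp]: "0 \<le> ramp t" and ramp_le_1 [simp]: "ramp t \<le> 1"
  and ramp_pos_iff [simp]: "0 < ramp t \<longleftrightarrow> 0 < t"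
  by (auto simp: ramp_eq)

lemma ramp'_nonneg [simp]: "0 \<le> ramp' t"
  by (auto simp: ramp'_eq)

lemma ramp'_le_2: "ramp' t \<le> 2"
proof (cases "t \<le> 0")
  case False
  then have "0 \<le> 1 / t" by simp
  then have "(1 / t)\<^sup>2 / 2 \<le> exp (1 / t)"
    using exp_lower_Taylor_quadratic[of "1 / t"] by linarith
  then show ?thesis using False by (simp add: ramp'_eq exp_minus field_simps)
qed (simp add: ramp'_eq)

lemma borel_measurable_ramp [measurable]:
  "ramp \<in> borel_measurable borel" "ramp' \<in> borel_measurable borel"
  by (simp_all add: smooth_continuous borel_measurable_continuous_onI)

lemma ramp_tendsto_1: "(ramp \<longlongrightarrow> 1) at_top"
proof -
  have "((\<lambda>t :: real. exp (- (inverse t))) \<longlongrightarrow> exp (- 0)) at_top"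
    by (intro tendsto_intros tendsto_inverse_0_at_top filterlim_ident)
  moreover have "\<forall>\<^sub>F t in at_top. exp (- (inverse t)) = ramp t"
    using eventually_gt_at_top[of 0] by eventually_elim (auto simp: ramp_eq inverse_eq_divide)
  ultimately show ?thesis by (simp add: Lim_transform_eventually)
qed

lemma ramp_scaled_tendsto:
  "(\<lambda>n. ramp (real (Suc n) * t)) \<longlonglongrightarrow> indicator {0<..} t"
proof (cases "t > 0")
  case True
  have "filterlim (\<lambda>n. t * real (Suc n)) at_top sequentially"
    by (rule filterlim_tendsto_pos_mult_at_top[OF tendsto_const True])
       (rule filterlim_compose[OF filterlim_real_sequentially filterlim_Suc])
  from filterlim_compose[OF ramp_tendsto_1 this] show ?thesis
    using True by (simp add: mult.commute)
next
  case False
  then have "ramp (real (Suc n) * t) = 0" for n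
    using mult_nonneg_nonpos[of "real (Suc n)" t] by (simp add: ramp_eq)
  then show ?thesis using False by simp
qed

lemma ramp'_integral: "integrable lborel ramp'" "(\<integral>t. ramp' t \<partial>lborel) = 1"
proof -
  have "(\<integral>\<^sup>+t. ennreal (ramp' t) * indicator {0..} t \<partial>lborel) = ennreal (1 - ramp 0)"
    by (rule nn_integral_FTC_atLeast) (auto simp: ramp_has_derivative ramp_tendsto_1)
  also have "(\<integral>\<^sup>+t. ennreal (ramp' t) * indicator {0..} t \<partial>lborel) = (\<integral>\<^sup>+t. ennreal (ramp' t) \<partial>lborel)"
    by (rule nn_integral_cong) (auto simp: ramp'_eq split: split_indicator)
  finally have *: "(\<integral>\<^sup>+t. ennreal (ramp' t) \<partial>lborel) = ennreal 1" by (simp add: ramp_eq)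
  have "has_bochner_integral lborel ramp' 1"
    by (rule has_bochner_integral_nn_integral) (use * in auto)
  then show "integrable lborel ramp'" "(\<integral>t. ramp' t \<partial>lborel) = 1"
    by (auto simp: has_bochner_integral_iff)
qed

section \<open>Coordinates and lines in the sequence space\<close>

lemma bounded_linear_coord: "bounded_linear (\<lambda>x. coord x i)"
  by (rule bounded_linear_intro[where K = 1]) (simp_all add: abs_coord_le_norm)

lemmas continuous_on_coord [continuous_intros] =
  bounded_linear.continuous_on[OF bounded_linear_coord]

lemma borel_measurable_coord [measurable]: "(\<lambda>x. coord x i) \<in> borel_measurable borel"
  by (rule borel_measurable_continuous_onI) (intro continuous_intros)

text \<open>A map with measurable coordinates is measurable into the countable product, and
  \<open>measurable_Abs_l2\<close> leads back from there. The weights 1 are a placeholder: the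
  sigma-algebra of \<open>gauss_prod\<close> is the same for all weights.\<close>

lemma measurable_l2I:
  assumes [measurable]: "\<And>i. (\<lambda>x. coord (f x) i) \<in> borel_measurable M"
  shows "f \<in> borel_measurable M"
proof -
  let ?N = "restrict_space (gauss_prod (\<lambda>_. 1)) (range coord)"
  have "(\<lambda>x. coord (f x)) \<in> measurable M (gauss_prod (\<lambda>_. 1))"
    unfolding measurable_cong_sets[OF refl sets_gauss_prod]
    by (rule measurable_PiM_single') (auto simp: space_PiM)
  then have "(\<lambda>x. coord (f x)) \<in> measurable M ?N"
    by (rule measurable_restrict_space2[rotated]) auto
  from measurable_compose[OF this measurable_Abs_l2]
  show ?thesis by (simp add: coord_inverse)
qed

lemma inner_basis [simp]: "inner x (basis i) = coord x i"
proof -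
  have "inner x (basis i) = (\<Sum>j\<in>{i}. coord x j * coord (basis i) j)"
    unfolding inner_l2_def by (rule suminf_finite) (auto simp: coord_basis)
  then show ?thesis by (simp add: coord_basis)
qed

lemma norm_sq_add_basis:
  "(norm (x + t *\<^sub>R basis i - c))\<^sup>2 = (norm (x - c))\<^sup>2 + 2 * t * (coord x i - coord c i) + t\<^sup>2"
proof -
  have *: "(norm (y + t *\<^sub>R basis i))\<^sup>2 = (norm y)\<^sup>2 + 2 * t * coord y i + t\<^sup>2" for y
    unfolding power2_norm_eq_inner using inner_commute[of "basis i" y]
    by (simp add: inner_add coord_basis power2_eq_square algebra_simps)
  have "x + t *\<^sub>R basis i - c = (x - c) + t *\<^sub>R basis i" by simp
  then show ?thesis using *[of "x - c"] by (simp only: coord_simps)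
qed

abbreviation line :: "l2 \<Rightarrow> nat \<Rightarrow> real \<Rightarrow> l2" where
  "line x i t \<equiv> x + t *\<^sub>R basis i"

abbreviation has_partial :: "nat \<Rightarrow> (l2 \<Rightarrow> real) \<Rightarrow> l2 \<Rightarrow> real \<Rightarrow> bool" where
  "has_partial i f x d \<equiv> ((\<lambda>t. f (line x i t)) has_real_derivative d) (at 0)"

abbreviation borel_on :: "l2 set \<Rightarrow> (l2 \<Rightarrow> 'a :: topological_space) set" where
  "borel_on W \<equiv> borel_measurable (restrict_space borel W)"

lemma partial_eqI:
  assumes "has_partial i f x d"
  shows "partial i f x = d" "has_partial_at i f x"
  unfolding partial_def has_partial_at_def
  using DERIV_imp_deriv[OF assms] assms by (auto simp only: real_differentiable_def)

lemma has_partial_atD: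
  assumes "has_partial_at i f x"
  shows "has_partial i f x (partial i f x)"
  using assms unfolding has_partial_at_def partial_def
  by (simp add: DERIV_deriv_iff_real_differentiable)

lemma has_partial_shift:
  assumes "((\<lambda>s. f (line x i t + s *\<^sub>R basis i)) has_real_derivative d) (at 0)"
  shows "((\<lambda>s. f (line x i s)) has_real_derivative d) (at t)"
proof -
  have "((\<lambda>s. f (x + (s + t) *\<^sub>R basis i)) has_real_derivative d) (at 0)"
    using assms by (simp add: algebra_simps)
  then show ?thesis using DERIV_shift[of "\<lambda>s. f (line x i s)" d 0 t] by simp
qed

lemma continuous_on_sum_basis:
  "continuous_on UNIV (\<lambda>s :: nat \<Rightarrow> real. x + (\<Sum>k<n. s k *\<^sub>R basis k))"
  by (intro continuous_intros continuous_on_product_coordinates)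

lemma F_continuous_on_continuous:
  assumes "continuous_on UNIV f"
  shows "F_continuous_on V f"
proof -
  have "continuous_map (powertop_real UNIV) euclideanreal (\<lambda>s. f (x + (\<Sum>k<n. s k *\<^sub>R basis k)))" for x n
    using continuous_on_compose2[OF assms continuous_on_sum_basis, of x n]
    by (simp add: euclidean_product_topology)
  then show ?thesis
    unfolding F_continuous_on_def Euclidean_space_def
    by (intro ballI allI continuous_map_from_subtopology)
qed

section \<open>Bump functions\<close>

text \<open>Iterated partial derivatives never leave a set closed under \<open>partial\<close>, so
  conditions on all orders reduce to one check per member of \<open>S\<close>.\<close>

lemma C_F_infI:
  assumes cont: "\<And>f. f \<in> S \<Longrightarrow> continuous_on UNIV f"
    and bdd: "\<And>f. f \<in> S \<Longrightarrow> \<exists>B. \<forall>x. \<bar>f x\<bar> \<le> B"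
    and der: "\<And>f i. f \<in> S \<Longrightarrow> \<exists>f'\<in>S. \<forall>x. has_partial i f x (f' x)"
    and f: "f \<in> S"
  shows "f \<in> C_F_inf V"
proof -
  have part: "partial i f \<in> S" if fS: "f \<in> S" for f i
  proof -
    obtain f' where f': "f' \<in> S"
      "\<And>x. has_partial i f x (f' x)"
      using der[OF fS] by blast
    then have "partial i f = f'" by (auto intro: partial_eqI)
    then show ?thesis using f' by simp
  qed
  have parts: "partials is f \<in> S" for "is"
    by (induction "is") (auto simp: partials_def f part)
  have "continuous_on UNIV f \<and> f \<in> borel_on V \<and> F_continuous_on V f"
    if "f \<in> S" for f
    using cont[OF that] borel_measurable_continuous_onI F_continuous_on_continuous
    by (blast intro: measurable_restrict_space1)
  moreover have "has_partial_at i f x" if "f \<in> S" for f i x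
    using der[OF that] partial_eqI(2) by blast
  moreover have "bounded (f ` V)" if "f \<in> S" for f
    using bdd[OF that] by (auto simp: bounded_iff)
  ultimately show ?thesis
    unfolding C_F_inf_def using f parts by blast
qed

lemma C_F_infD:
  assumes "f \<in> C_F_inf W"
  shows "f \<in> borel_on W"
    "partial i f \<in> borel_on W"
    "x \<in> W \<Longrightarrow> has_partial_at i f x" "x \<in> W \<Longrightarrow> has_partial_at j (partial i f) x"
    "bounded (partial i f ` W)" "bounded (partial j (partial i f) ` W)"
    "F_continuous_on W f" "F_continuous_on W (partial i f)" "F_continuous_on W (partial j (partial i f))"
    "partial j (partial i f) \<in> borel_on W"
proof -
  have *: "\<And>is i x. x \<in> W \<Longrightarrow> has_partial_at i (partials is f) x" "\<And>is i. bounded (partials (i # is) f ` W)"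
    "\<And>is i. F_continuous_on W (partials (i # is) f)"
    "\<And>is i. partials (i # is) f \<in> borel_on W"
    using assms unfolding C_F_inf_def by blast+
  show "f \<in> borel_on W" "F_continuous_on W f"
    using assms unfolding C_F_inf_def by blast+
  show "x \<in> W \<Longrightarrow> has_partial_at i f x" using *(1)[of x i "[]"] by (simp add: partials_def)
  show "x \<in> W \<Longrightarrow> has_partial_at j (partial i f) x" using *(1)[of x j "[i]"] by (simp add: partials_def)
  show "bounded (partial i f ` W)" "F_continuous_on W (partial i f)"
    "partial i f \<in> borel_on W"
    using *(2-4)[of i "[]"] by (simp_all add: partials_def)
  show "bounded (partial j (partial i f) ` W)" "F_continuous_on W (partial j (partial i f))"
    "partial j (partial i f) \<in> borel_on W"
    using *(2-4)[of j "[i]"] by (simp_all add: partials_def)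
qed

lemma C_F_inf_subset:
  assumes "f \<in> C_F_inf W" "W' \<subseteq> W"
  shows "f \<in> C_F_inf W'"
proof -
  have F: "F_continuous_on W' u" if "F_continuous_on W u" for u
    using that assms(2) unfolding F_continuous_on_def
    by (blast intro: continuous_map_from_subtopology_mono)
  have m: "u \<in> borel_on W'"
    if "u \<in> borel_on W" for u :: "l2 \<Rightarrow> real"
    by (rule measurable_restrict_mono[OF that assms(2)])
  have b: "bounded (u ` W')" if "bounded (u ` W)" for u :: "l2 \<Rightarrow> real"
    by (rule bounded_subset[OF that]) (use assms(2) in blast)
  show ?thesis
    using assms F m b unfolding C_F_inf_def by blast
qed

lemma C_F_inf_partial:
  assumes "f \<in> C_F_inf W"
  shows "partial i f \<in> C_F_inf W"
proof -
  have "(\<forall>x\<in>W. has_partial_at k (partials (js @ [i]) f) x) \<and> bounded (partials (k # (js @ [i])) f ` W) \<and>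
      F_continuous_on W (partials (k # (js @ [i])) f) \<and>
      partials (k # (js @ [i])) f \<in> borel_on W" for js k
    using assms unfolding C_F_inf_def by blast
  moreover have "partials (js @ [i]) f = partials js (partial i f)"
    "partials (k # (js @ [i])) f = partials (k # js) (partial i f)" for js k
    by (simp_all add: partials_def)
  ultimately show ?thesis
    using C_F_infD(2)[OF assms] C_F_infD(8)[OF assms] unfolding C_F_inf_def by simp
qed

lemma C_F_inf_const: "(\<lambda>_. c) \<in> C_F_inf W"
proof (rule C_F_infI[where S = "range (\<lambda>c _. c)"])
  show "\<exists>f'\<in>range (\<lambda>c _. c). \<forall>x. has_partial i f x (f' x)"
    if "f \<in> range (\<lambda>c _. c)" for f :: "l2 \<Rightarrow> real" and i
    by (rule bexI[of _ "\<lambda>_. 0"]) (use that in auto)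
qed auto

lemma partial_const [simp]: "partial i (\<lambda>_. c) x = 0"
  by (rule partial_eqI) simp

inductive_set bumps :: "l2 \<Rightarrow> real \<Rightarrow> (l2 \<Rightarrow> real) set" for c r where
  radial: "(\<lambda>x. flat_exp p (r\<^sup>2 - (norm (x - c))\<^sup>2)) \<in> bumps c r"
| add: "f \<in> bumps c r \<Longrightarrow> f' \<in> bumps c r \<Longrightarrow> (\<lambda>x. f x + f' x) \<in> bumps c r"
| mult: "f \<in> bumps c r \<Longrightarrow> smooth \<theta> \<Longrightarrow> (\<lambda>x. \<theta> (coord x j) * f x) \<in> bumps c r"

definition radial :: "l2 \<Rightarrow> real \<Rightarrow> l2 \<Rightarrow> real" where
  "radial c r x = ramp (r\<^sup>2 - (norm (x - c))\<^sup>2)"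

lemma radial_bumps: "radial c r \<in> bumps c r"
  using bumps.radial[of 1 r c] by (simp add: radial_def[abs_def] ramp_def)

lemma radial_nonneg: "0 \<le> radial c r x"
  by (simp add: radial_def)

lemma radial_pos: "x \<in> ball c r \<Longrightarrow> 0 < radial c r x"
  by (simp add: radial_def dist_norm norm_minus_commute power_strict_mono)

lemma bumps_zero:
  assumes "f \<in> bumps c r" "r \<le> norm (x - c)" "0 \<le> r"
  shows "f x = 0"
  using assms
proof induction
  case (radial p)
  then have "r\<^sup>2 - (norm (x - c))\<^sup>2 \<le> 0" by (simp add: power_mono)
  then show ?case by (simp add: flat_exp_def)
qed auto

lemma bumps_continuous: "f \<in> bumps c r \<Longrightarrow> continuous_on A f"
proof (induction rule: bumps.induct)
  case (radial p)
  show ?case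
    by (rule continuous_on_compose2[OF smooth_continuous[OF smooth_flat_exp, of UNIV]])
       (auto intro!: continuous_intros)
next
  case (mult f \<theta> j)
  then show ?case
    by (intro continuous_intros continuous_on_compose2[OF smooth_continuous[OF mult(2), of UNIV]]) auto
qed (auto intro: continuous_intros)

lemma smooth_bounded_Icc:
  assumes "smooth \<theta>"
  obtains B where "B \<ge> 0" "\<And>t. t \<in> {u..v} \<Longrightarrow> \<bar>\<theta> t\<bar> \<le> B"
proof -
  have "compact (\<theta> ` {u..v})"
    by (intro compact_continuous_image smooth_continuous assms) simp
  then obtain B where "\<forall>y\<in>\<theta> ` {u..v}. norm y \<le> B"
    using compact_imp_bounded bounded_iff by metis
  then show ?thesis by (intro that[of "\<bar>B\<bar>"]) force+
qed

lemma bumps_bounded: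
  assumes "f \<in> bumps c r" "0 \<le> r"
  shows "\<exists>B\<ge>0. \<forall>x. \<bar>f x\<bar> \<le> B"
  using assms
proof induction
  case (radial p)
  obtain B where B: "B \<ge> 0" "\<And>t. t \<in> {0..r\<^sup>2} \<Longrightarrow> \<bar>flat_exp p t\<bar> \<le> B"
    using smooth_bounded_Icc[OF smooth_flat_exp] by blast
  have "\<bar>flat_exp p (r\<^sup>2 - (norm (x - c))\<^sup>2)\<bar> \<le> B" for x
  proof (cases "norm (x - c) \<le> r")
    case True
    then show ?thesis by (intro B(2)) (auto simp: power_mono)
  next
    case False
    then have "r\<^sup>2 - (norm (x - c))\<^sup>2 \<le> 0" using radial by (simp add: power_mono)
    then show ?thesis using B(1) by (simp add: flat_exp_def)
  qed
  then show ?case using B(1) by blast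
next
  case (add f f')
  then obtain B B' where "B \<ge> 0" "\<forall>x. \<bar>f x\<bar> \<le> B" "B' \<ge> 0" "\<forall>x. \<bar>f' x\<bar> \<le> B'" by blast
  then show ?case
    by (intro exI[of _ "B + B'"]) (auto intro: order_trans[OF abs_triangle_ineq] add_mono)
next
  case (mult f \<theta> j)
  obtain B where B: "B \<ge> 0" "\<forall>x. \<bar>f x\<bar> \<le> B" using mult by blast
  \<comment> \<open>\<theta> may be unbounded on the real line, but on the ball the j-th coordinate
    stays within \<open>r\<close> of that of the centre.\<close>
  obtain B' where B': "B' \<ge> 0" "\<And>t. t \<in> {coord c j - r..coord c j + r} \<Longrightarrow> \<bar>\<theta> t\<bar> \<le> B'"
    using smooth_bounded_Icc[OF mult(2)] by blast
  have "\<bar>\<theta> (coord x j) * f x\<bar> \<le> B' * B" for x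
  proof (cases "norm (x - c) \<le> r")
    case True
    then have "\<bar>coord x j - coord c j\<bar> \<le> r"
      using abs_coord_le_norm[of "x - c" j] by simp
    then have "\<bar>\<theta> (coord x j)\<bar> \<le> B'" by (intro B') auto
    then show ?thesis using B B' by (simp add: abs_mult mult_mono)
  next
    case False
    then have "f x = 0" using bumps_zero[OF mult(1)] mult.prems by simp
    then show ?thesis using B B' by simp
  qed
  then show ?case using B B' by (intro exI[of _ "B' * B"]) auto
qed

lemma power2_add_le: "(s + t)\<^sup>2 \<le> 2 * s\<^sup>2 + 2 * t\<^sup>2" for s t :: real
  using zero_le_power2[of "s - t"] unfolding power2_sum power2_diff by argo

lemma sum_power2_add_le:
  fixes f g :: "'i \<Rightarrow> real"
  shows "(\<Sum>i\<in>A. (f i + g i)\<^sup>2) \<le> 2 * (\<Sum>i\<in>A. (f i)\<^sup>2) + 2 * (\<Sum>i\<in>A. (g i)\<^sup>2)"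
  unfolding sum_distrib_left sum.distrib[symmetric] by (intro sum_mono power2_add_le)

text \<open>The bound on the gradient has to be carried through the induction. For a radial
  generator the squares of the partial derivatives sum to at most \<open>4 (norm (x - c))^2\<close>
  times a bounded function; a factor depending on the j-th coordinate rescales all of them by a
  bounded amount and adds a term to the j-th only.\<close>

lemma bumps_partials:
  assumes "f \<in> bumps c r" "0 \<le> r"
  shows "\<exists>D. (\<forall>i. D i \<in> bumps c r) \<and>
    (\<forall>i x. has_partial i f x (D i x)) \<and>
    (\<exists>M. \<forall>x n. (\<Sum>i<n. (D i x)\<^sup>2) \<le> M)"
  using assms
proof induction
  case (radial p)
  let ?p' = "monom 1 2 * (p - pderiv p)"
  let ?F = "\<lambda>x. flat_exp ?p' (r\<^sup>2 - (norm (x - c))\<^sup>2)"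
  define D where "D = (\<lambda>i x. (- 2 * coord x i + 2 * coord c i) * ?F x)"
  have F: "?F \<in> bumps c r" by (rule bumps.radial)
  then have D: "D i \<in> bumps c r" for i
    unfolding D_def by (rule bumps.mult[of _ _ _ "\<lambda>t. - 2 * t + 2 * coord c i"]) (rule smooth_affine)
  obtain B where B: "B \<ge> 0" "\<forall>x. \<bar>?F x\<bar> \<le> B" using bumps_bounded[OF F radial] by blast
  have "((\<lambda>t. flat_exp p (r\<^sup>2 - (norm (line x i t - c))\<^sup>2)) has_real_derivative D i x) (at 0)" for i x
    unfolding norm_sq_add_basis
    by (rule DERIV_cong, rule DERIV_chain2[OF flat_exp_has_derivative])
       (auto intro!: derivative_eq_intros simp: D_def)
  moreover have "(\<Sum>i<n. (D i x)\<^sup>2) \<le> 4 * r\<^sup>2 * B\<^sup>2" for x n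
  proof (cases "norm (x - c) \<le> r")
    case True
    have "(\<Sum>i<n. (D i x)\<^sup>2) = 4 * (\<Sum>i<n. (coord (x - c) i)\<^sup>2) * (?F x)\<^sup>2"
      unfolding D_def sum_distrib_left sum_distrib_right
      by (intro sum.cong refl) (simp add: power2_eq_square algebra_simps)
    also have "\<dots> \<le> 4 * r\<^sup>2 * B\<^sup>2"
    proof (intro mult_mono)
      show "(\<Sum>i<n. (coord (x - c) i)\<^sup>2) \<le> r\<^sup>2"
        using sum_coord_le_norm_sq[where n = n and x = "x - c"] True power_mono[OF True, of 2] by simp
      show "(?F x)\<^sup>2 \<le> B\<^sup>2" using B by (subst abs_le_square_iff[symmetric]) simp
    qed (auto intro: sum_nonneg)
    finally show ?thesis .
  next
    case False
    then have "D i x = 0" for i using bumps_zero[OF D] radial by simp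
    then show ?thesis by simp
  qed
  ultimately show ?case using D by blast
next
  case (add f f')
  obtain D M where D: "\<And>i. D i \<in> bumps c r"
    "\<And>i x. has_partial i f x (D i x)"
    and M: "\<And>x n. (\<Sum>i<n. (D i x)\<^sup>2) \<le> M"
    using add.IH(1)[OF add.prems] by blast
  obtain D' M' where D': "\<And>i. D' i \<in> bumps c r"
    "\<And>i x. has_partial i f' x (D' i x)"
    and M': "\<And>x n. (\<Sum>i<n. (D' i x)\<^sup>2) \<le> M'"
    using add.IH(2)[OF add.prems] by blast
  have "(\<Sum>i<n. (D i x + D' i x)\<^sup>2) \<le> 2 * M + 2 * M'" for x n
    using sum_power2_add_le[of "\<lambda>i. D i x" "\<lambda>i. D' i x" "{..<n}"] M[where n = n and x = x] M'[where n = n and x = x] by linarith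
  then show ?case
    using D D' by (intro exI[of _ "\<lambda>i x. D i x + D' i x"]) (fast intro: bumps.add DERIV_add)
next
  case (mult f \<theta> j)
  obtain D M where D: "\<And>i. D i \<in> bumps c r"
    "\<And>i x. has_partial i f x (D i x)"
    and M: "\<And>x n. (\<Sum>i<n. (D i x)\<^sup>2) \<le> M"
    using mult.IH[OF mult.prems] by blast
  obtain \<theta>' where \<theta>': "smooth \<theta>'" "\<And>t. (\<theta> has_real_derivative \<theta>' t) (at t)"
    using smooth_obtain_deriv[OF mult(2)] by blast
  define D' where "D' = (\<lambda>i x. \<theta> (coord x j) * D i x + (if i = j then \<theta>' (coord x j) * f x else 0))"
  have "D' i \<in> bumps c r" for i
    unfolding D'_def using mult(1,2) D(1) \<theta>'(1)
    by (cases "i = j") (auto intro!: bumps.add bumps.mult)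
  moreover have "((\<lambda>t. \<theta> (coord (line x i t) j) * f (line x i t))
      has_real_derivative D' i x) (at 0)" for i x
  proof -
    have "((\<lambda>t. coord (line x i t) j) has_real_derivative coord (basis i) j) (at 0)"
      by (auto intro!: derivative_eq_intros)
    from DERIV_chain2[where f = \<theta>, OF \<theta>'(2) this]
    have "((\<lambda>t. \<theta> (coord (line x i t) j)) has_real_derivative
        \<theta>' (coord x j) * coord (basis i) j) (at 0)" by simp
    from DERIV_mult[OF this D(2)] show ?thesis
      by (rule DERIV_cong) (simp add: D'_def coord_basis)
  qed
  moreover have "\<exists>M. \<forall>x n. (\<Sum>i<n. (D' i x)\<^sup>2) \<le> M"
  proof -
    obtain B where B: "B \<ge> 0" "\<And>x. \<bar>\<theta>' (coord x j) * f x\<bar> \<le> B"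
      using bumps_bounded[OF bumps.mult[OF mult(1) \<theta>'(1)] mult.prems] by blast
    obtain C where C: "C \<ge> 0" "\<And>t. t \<in> {coord c j - r..coord c j + r} \<Longrightarrow> \<bar>\<theta> t\<bar> \<le> C"
      using smooth_bounded_Icc[OF mult(2)] by blast
    have "M \<ge> 0" using M[where n = 0] by simp
    have "(\<Sum>i<n. (D' i x)\<^sup>2) \<le> 2 * (C\<^sup>2 * M) + 2 * B\<^sup>2" for x n
    proof -
      have 1: "(\<Sum>i<n. (\<theta> (coord x j) * D i x)\<^sup>2) \<le> C\<^sup>2 * M"
      proof (cases "norm (x - c) \<le> r")
        case True
        then have "\<bar>coord x j - coord c j\<bar> \<le> r"
          using abs_coord_le_norm[of "x - c" j] by simp
        then have "\<bar>\<theta> (coord x j)\<bar> \<le> C" by (intro C) auto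
        then have "(\<theta> (coord x j))\<^sup>2 \<le> C\<^sup>2" using C(1) by (subst abs_le_square_iff[symmetric]) simp
        then show ?thesis
          using M[where n = n and x = x] \<open>M \<ge> 0\<close>
          by (simp add: power_mult_distrib sum_distrib_left[symmetric] mult_mono sum_nonneg)
      next
        case False
        then have "D i x = 0" for i using bumps_zero[OF D(1)] mult.prems by simp
        then show ?thesis using \<open>M \<ge> 0\<close> by simp
      qed
      have "(\<theta>' (coord x j) * f x)\<^sup>2 \<le> B\<^sup>2" using B by (subst abs_le_square_iff[symmetric]) simp
      moreover have "(\<Sum>i<n. (if i = j then \<theta>' (coord x j) * f x else 0)\<^sup>2) \<le> (\<theta>' (coord x j) * f x)\<^sup>2"
        by (simp add: if_distrib[of "\<lambda>y. y\<^sup>2"] cong: if_cong)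
      ultimately show ?thesis
        using 1 sum_power2_add_le[of "\<lambda>i. \<theta> (coord x j) * D i x"
            "\<lambda>i. if i = j then \<theta>' (coord x j) * f x else 0" "{..<n}"]
        unfolding D'_def by linarith
    qed
    then show ?thesis by blast
  qed
  ultimately show ?case by blast
qed

text \<open>The support lies in the closed ball of radius \<open>r\<close>, and the gap
  \<open>r' - r\<close> is the uniform distance to the complement of \<open>V\<close> that the test
  class asks for.\<close>

lemma bumps_C_F_0:
  assumes f: "f \<in> bumps c r" and r: "0 \<le> r" "r < r'" "ball c r' \<subseteq> V"
  shows "f \<in> C_F_0 V"
proof -
  have "f \<in> C_F_inf V"
  proof (rule C_F_infI[OF _ _ _ f])
    show "\<exists>f'\<in>bumps c r. \<forall>x. has_partial i f x (f' x)"
      if "f \<in> bumps c r" for f i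
      using bumps_partials[OF that r(1)] by blast
  qed (use bumps_continuous bumps_bounded r in blast)+
  moreover have "(SUP x\<in>V. ennreal \<bar>f x\<bar> + (\<Sum>i. ennreal ((partial i f x)\<^sup>2))) < \<infinity>"
  proof -
    obtain B where B: "\<And>x. \<bar>f x\<bar> \<le> B" using bumps_bounded[OF f r(1)] by blast
    obtain D M where D: "\<And>i x. has_partial i f x (D i x)"
      and M: "\<And>x n. (\<Sum>i<n. (D i x)\<^sup>2) \<le> M"
      using bumps_partials[OF f r(1)] by blast
    have "(\<Sum>i. ennreal ((partial i f x)\<^sup>2)) \<le> ennreal M" for x
      using M[where x = x] unfolding partial_eqI(1)[OF D]
      by (intro suminf_le_const summableI) (simp add: ennreal_leI)
    then have "(SUP x\<in>V. ennreal \<bar>f x\<bar> + (\<Sum>i. ennreal ((partial i f x)\<^sup>2))) \<le> ennreal B + ennreal M"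
      using B by (intro SUP_least add_mono) (auto simp: ennreal_leI)
    then show ?thesis by (rule order.strict_trans1) (simp add: ennreal_add_eq_top less_top[symmetric])
  qed
  moreover have "closure {x \<in> V. f x \<noteq> 0} \<Subset>\<^sub>o V"
  proof -
    have "{x \<in> V. f x \<noteq> 0} \<subseteq> cball c r"
      using bumps_zero[OF f _ r(1)] by (force simp: dist_norm norm_minus_commute not_le)
    then have sub: "closure {x \<in> V. f x \<noteq> 0} \<subseteq> cball c r"
      by (rule closure_minimal) simp
    show ?thesis
      unfolding inside_def
    proof (intro exI conjI)
      show "r' - r > 0" using r by simp
      show "norm c + r + 1 > 0" using r by (simp add: add_nonneg_pos)
      show "(\<Union>x\<in>closure {x \<in> V. f x \<noteq> 0}. ball x (r' - r)) \<subseteq> V"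
      proof safe
        fix x y
        assume "x \<in> closure {x \<in> V. f x \<noteq> 0}" and y: "y \<in> ball x (r' - r)"
        then have "dist c x \<le> r" using sub by auto
        then show "y \<in> V" using y dist_triangle[of c y x] r(3) by (auto simp: subset_iff)
      qed
      show "closure {x \<in> V. f x \<noteq> 0} \<subseteq> ball 0 (norm c + r + 1)"
      proof
        fix x assume "x \<in> closure {x \<in> V. f x \<noteq> 0}"
        then have "dist c x \<le> r" using sub by auto
        then show "x \<in> ball 0 (norm c + r + 1)"
          using dist_triangle[of 0 x c] by (simp add: dist_commute)
      qed
    qed
  qed
  ultimately show ?thesis unfolding C_F_0_def by blast
qed

section \<open>Functionals vanishing on products of coordinate functions\<close>

text \<open>A pi-system generating the Borel sets whose indicators are finite products of functions
  of one coordinate, each a limit of smooth \<open>steep\<close> functions. The empty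
  \<open>J\<close> gives the whole space.\<close>

definition orthants :: "l2 set set" where
  "orthants = {{x. \<forall>j\<in>J. \<alpha> j < coord x j} | J \<alpha>. finite J}"

lemma Int_stable_orthants: "Int_stable orthants"
proof (rule Int_stableI)
  fix A B assume "A \<in> orthants" "B \<in> orthants"
  then obtain J \<alpha> K \<beta> where *: "finite J" "finite K"
    "A = {x. \<forall>j\<in>J. \<alpha> j < coord x j}" "B = {x. \<forall>j\<in>K. \<beta> j < coord x j}"
    unfolding orthants_def by blast
  define \<gamma> where "\<gamma> = (\<lambda>j. if j \<in> J then if j \<in> K then max (\<alpha> j) (\<beta> j) else \<alpha> j else \<beta> j)"
  have "A \<inter> B = {x. \<forall>j\<in>J \<union> K. \<gamma> j < coord x j}"
    unfolding * \<gamma>_def by (auto split: if_splits)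
  then show "A \<inter> B \<in> orthants" using *(1,2) unfolding orthants_def by blast
qed

lemma borel_eq_sigma_orthants: "sets borel = sigma_sets UNIV orthants"
proof
  let ?S = "sigma UNIV orthants"
  have "(\<lambda>x. x) \<in> borel_measurable ?S"
  proof (rule measurable_l2I)
    fix i
    have "{x. t < coord x i} \<in> orthants" for t
      unfolding orthants_def by (rule CollectI, rule exI[of _ "{i}"], rule exI[of _ "\<lambda>_. t"]) simp
    then show "(\<lambda>x. coord x i) \<in> borel_measurable ?S"
      by (subst borel_measurable_iff_greater) auto
  qed
  from measurable_sets[OF this] show "sets borel \<subseteq> sigma_sets UNIV orthants" by auto
  have "{x. \<forall>j\<in>J. \<alpha> j < coord x j} \<in> sets borel" if "finite J" for J \<alpha>
    using that by simp
  then have "orthants \<subseteq> sets borel" unfolding orthants_def by blast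
  then show "sigma_sets UNIV orthants \<subseteq> sets borel"
    using sets.sigma_sets_subset[of orthants borel] by simp
qed

lemma integrable_mult_bounded:
  fixes f g :: "'a \<Rightarrow> real"
  assumes f: "integrable M f" and g: "g \<in> borel_measurable M" "\<And>x. \<bar>g x\<bar> \<le> B"
  shows "integrable M (\<lambda>x. f x * g x)"
proof (rule Bochner_Integration.integrable_bound[OF integrable_mult_left[OF integrable_norm[OF f], of B]])
  show "(\<lambda>x. f x * g x) \<in> borel_measurable M"
    using borel_measurable_integrable[OF f] g(1) by measurable
  show "AE x in M. norm (f x * g x) \<le> norm (norm (f x) * B)"
    by (rule AE_I2) (simp add: abs_mult mult_left_mono order_trans[OF g(2)])
qed

text \<open>The signed measure with density G, pushed forward by \<pi>, vanishes on orthants, hence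
  on all Borel sets by the pi-lambda theorem. The map \<pi> forgets the coordinates outside
  \<open>I\<close>; it will be \<open>drop_coord i\<close> or the identity.\<close>

lemma integral_mult_bounded_function_eq_0:
  fixes G \<eta> :: "l2 \<Rightarrow> real"
  assumes sM [measurable_cong]: "sets M = sets borel" and G: "integrable M G"
    and \<pi> [measurable]: "\<pi> \<in> borel_measurable borel"
    and coord_\<pi>: "\<And>x j. coord (\<pi> x) j = (if j \<in> I then coord x j else 0)"
    and zero: "\<And>J \<alpha>. finite J \<Longrightarrow> J \<subseteq> I \<Longrightarrow>
      (\<integral>x. G x * (\<Prod>j\<in>J. indicator {\<alpha> j<..} (coord x j)) \<partial>M) = 0"
    and \<eta> [measurable]: "\<eta> \<in> borel_measurable borel" and bdd: "\<And>x. \<bar>\<eta> x\<bar> \<le> B"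
  shows "(\<integral>x. G x * \<eta> (\<pi> x) \<partial>M) = 0"
proof -
  have [measurable]: "G \<in> borel_measurable borel"
    using borel_measurable_integrable[OF G] unfolding measurable_cong_sets[OF sM refl] .
  have int: "integrable M (\<lambda>x. g x * u (\<pi> x))"
    if "integrable M g" "u \<in> borel_measurable borel" "\<And>y. \<bar>u y\<bar> \<le> b" for g u :: "l2 \<Rightarrow> real" and b
    by (rule integrable_mult_bounded[of _ _ _ b]) (use that in measurable)
  have ind: "(\<integral>x. G x * indicator A (\<pi> x) \<partial>M) = 0" if "A \<in> sets borel" for A
    using Int_stable_orthants subset_UNIV[of "orthants", folded Pow_UNIV]
      that[unfolded borel_eq_sigma_orthants]
  proof (induction rule: sigma_sets_induct_disjoint)
    case (basic A)
    then obtain J \<alpha> where J: "finite J" "A = {x. \<forall>j\<in>J. \<alpha> j < coord x j}"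
      unfolding orthants_def by blast
    \<comment> \<open>Coordinates of \<open>\<pi> x\<close> outside \<open>I\<close> are 0, so a
      constraint on such a coordinate is void if its bound is negative and unsatisfiable
      otherwise.\<close>
    show ?case
    proof (cases "\<forall>j\<in>J - I. \<alpha> j < 0")
      case True
      have "indicator A (\<pi> x) = (\<Prod>j\<in>J \<inter> I. indicator {\<alpha> j<..} (coord x j) :: real)" for x
      proof (cases "\<pi> x \<in> A")
        case True
        then show ?thesis using J by (auto simp: coord_\<pi> indicator_def intro!: prod.neutral[symmetric] split: if_splits)
      next
        case False
        then obtain j where "j \<in> J" "\<not> \<alpha> j < coord (\<pi> x) j" using J by auto
        then have "j \<in> J \<inter> I" "\<not> \<alpha> j < coord x j" using True by (auto simp: coord_\<pi> split: if_splits)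
        then have "(\<Prod>j\<in>J \<inter> I. indicator {\<alpha> j<..} (coord x j) :: real) = 0"
          using J(1) by (intro prod_zero bexI[of _ j]) (auto simp: indicator_def)
        then show ?thesis using False by simp
      qed
      then show ?thesis using zero[of "J \<inter> I" \<alpha>] J(1) by simp
    next
      case False
      then have "indicator A (\<pi> x) = (0 :: real)" for x
        using J by (auto simp: indicator_def coord_\<pi>)
      then show ?thesis by simp
    qed
  next
    case (compl A)
    then have [measurable]: "A \<in> sets borel" by (simp add: borel_eq_sigma_orthants)
    have "(\<integral>x. G x * indicator (UNIV - A) (\<pi> x) \<partial>M) = (\<integral>x. G x - G x * indicator A (\<pi> x) \<partial>M)"
      by (rule Bochner_Integration.integral_cong) (auto simp: indicator_def)
    also have "\<dots> = (\<integral>x. G x \<partial>M) - (\<integral>x. G x * indicator A (\<pi> x) \<partial>M)"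
      by (rule Bochner_Integration.integral_diff[OF G int[OF G, of _ 1]]) (auto simp: indicator_def)
    also have "\<dots> = 0" using compl zero[of "{}"] by simp
    finally show ?case .
  next
    case (union A)
    then have A [measurable]: "A i \<in> sets borel" for i by (auto simp: borel_eq_sigma_orthants)
    have disj: "A i \<inter> A j = {}" if "i \<noteq> j" for i j
      using union(1) that by (auto simp: disjoint_family_on_def)
    have s: "(\<lambda>i. indicator (A i) y :: real) sums indicator (\<Union>i. A i) y" for y
      by (rule indicator_sums) (rule disj)
    have "(\<lambda>n. \<integral>x. G x * (\<Sum>i<n. indicator (A i) (\<pi> x)) \<partial>M) \<longlonglongrightarrow>
        (\<integral>x. G x * indicator (\<Union>i. A i) (\<pi> x) \<partial>M)"
    proof (rule integral_dominated_convergence[where w = "\<lambda>x. norm (G x)"])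
      show "AE x in M. (\<lambda>n. G x * (\<Sum>i<n. indicator (A i) (\<pi> x))) \<longlonglongrightarrow> G x * indicator (\<Union>i. A i) (\<pi> x)"
        using s unfolding sums_def by (auto intro!: tendsto_mult_left)
      have "norm (\<Sum>i<n. indicator (A i) y :: real) \<le> 1" for n y
      proof -
        have "(\<Sum>i<n. indicator (A i) y :: real) \<le> indicator (\<Union>i. A i) y"
          unfolding sums_unique[OF s] by (rule sum_le_suminf) (auto intro: sums_summable[OF s])
        also have "\<dots> \<le> 1" by (simp add: indicator_def)
        finally show ?thesis by (simp add: sum_nonneg)
      qed
      then show "AE x in M. norm (G x * (\<Sum>i<n. indicator (A i) (\<pi> x))) \<le> norm (G x)" for n
        by (simp add: abs_mult mult_left_le)
      have [measurable]: "(\<lambda>x. indicator S (\<pi> x) :: real) \<in> borel_measurable borel"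
        if "S \<in> sets borel" for S
        using measurable_compose[OF \<pi> borel_measurable_indicator[OF that]] .
      have U: "(\<Union>i. A i) \<in> sets borel" using A by blast
      have "(\<lambda>x. G x * indicator (\<Union>i. A i) (\<pi> x)) \<in> borel_measurable borel"
        using U by measurable
      then show "(\<lambda>x. G x * indicator (\<Union>i. A i) (\<pi> x)) \<in> borel_measurable M" by measurable
      have "(\<lambda>x. G x * (\<Sum>i<n. indicator (A i) (\<pi> x))) \<in> borel_measurable borel" for n
        by measurable
      then show "(\<lambda>x. G x * (\<Sum>i<n. indicator (A i) (\<pi> x))) \<in> borel_measurable M" for n
        by measurable
    qed (use G in simp)
    moreover have "(\<integral>x. G x * (\<Sum>i<n. indicator (A i) (\<pi> x)) \<partial>M) = 0" for n
    proof -
      have "(\<integral>x. G x * (\<Sum>i<n. indicator (A i) (\<pi> x)) \<partial>M) =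
          (\<Sum>i<n. \<integral>x. G x * indicator (A i) (\<pi> x) \<partial>M)"
        unfolding sum_distrib_left
        by (rule Bochner_Integration.integral_sum) (auto intro!: int[OF G, of _ 1] simp: indicator_def)
      then show ?thesis using union(3) by simp
    qed
    ultimately show ?case by (simp add: LIMSEQ_const_iff)
  qed auto
  \<comment> \<open>From indicators to bounded \<eta>: the densities given by the positive and the
    negative part of G have images under \<pi> that agree on all Borel sets, so they are the same
    measure and give \<eta> the same integral.\<close>
  let ?\<mu> = "\<lambda>g. distr (density M (\<lambda>x. ennreal (g x))) borel \<pi>"
  define p where "p = (\<lambda>x. max 0 (G x))"
  define m where "m = (\<lambda>x. max 0 (- G x))"
  have pm: "integrable M p" "integrable M m" "\<And>x. 0 \<le> p x" "\<And>x. 0 \<le> m x" "\<And>x. G x = p x - m x"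
    using G unfolding p_def m_def by (auto intro: Bochner_Integration.integrable_max simp: max.commute[of 0])
  have [measurable]: "p \<in> borel_measurable borel" "m \<in> borel_measurable borel"
    unfolding p_def m_def by measurable
  have em: "emeasure (?\<mu> g) A = ennreal (\<integral>x. g x * indicator A (\<pi> x) \<partial>M)"
    if A [measurable]: "A \<in> sets borel" and g: "integrable M g" "\<And>x. 0 \<le> g x"
      and [measurable]: "g \<in> borel_measurable borel" for A g
  proof -
    have "emeasure (?\<mu> g) A = (\<integral>\<^sup>+x. ennreal (g x) * indicator (\<pi> -` A \<inter> space M) x \<partial>M)"
      by (subst emeasure_distr) (auto simp: emeasure_density)
    also have "\<dots> = (\<integral>\<^sup>+x. ennreal (g x * indicator A (\<pi> x)) \<partial>M)"
      by (rule nn_integral_cong) (auto simp: indicator_def)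
    also have "\<dots> = ennreal (\<integral>x. g x * indicator A (\<pi> x) \<partial>M)"
      by (rule nn_integral_eq_integral) (auto intro!: int[OF g(1), of _ 1] simp: indicator_def g(2))
    finally show ?thesis .
  qed
  have "?\<mu> p = ?\<mu> m"
  proof (rule measure_eqI)
    fix A assume "A \<in> sets (?\<mu> p)"
    then have A [measurable]: "A \<in> sets borel" by simp
    have "(\<integral>x. p x * indicator A (\<pi> x) \<partial>M) - (\<integral>x. m x * indicator A (\<pi> x) \<partial>M) =
        (\<integral>x. G x * indicator A (\<pi> x) \<partial>M)"
      by (subst Bochner_Integration.integral_diff[symmetric])
         (auto intro!: int[OF pm(1), of _ 1] int[OF pm(2), of _ 1] Bochner_Integration.integral_cong
            simp: pm(5) indicator_def)
    then have "(\<integral>x. p x * indicator A (\<pi> x) \<partial>M) = (\<integral>x. m x * indicator A (\<pi> x) \<partial>M)"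
      using ind[OF A] by simp
    then show "emeasure (?\<mu> p) A = emeasure (?\<mu> m) A"
      by (simp add: em A pm(1-4))
  qed simp
  then have "(\<integral>x. \<eta> x \<partial>?\<mu> p) = (\<integral>x. \<eta> x \<partial>?\<mu> m)" by simp
  then have "(\<integral>x. p x * \<eta> (\<pi> x) \<partial>M) = (\<integral>x. m x * \<eta> (\<pi> x) \<partial>M)"
    by (simp add: integral_distr integral_density pm(3,4))
  moreover have "(\<integral>x. G x * \<eta> (\<pi> x) \<partial>M) = (\<integral>x. p x * \<eta> (\<pi> x) \<partial>M) - (\<integral>x. m x * \<eta> (\<pi> x) \<partial>M)"
    by (subst Bochner_Integration.integral_diff[symmetric])
       (auto intro!: int[OF pm(1), of _ B] int[OF pm(2), of _ B] Bochner_Integration.integral_cong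
          simp: pm(5) bdd algebra_simps)
  ultimately show ?thesis by simp
qed

section \<open>Square-integrable functions\<close>

lemma L2_onD:
  assumes V [measurable]: "V \<in> sets borel" and P: "prob_space (gauss_l2 a)" and f: "f \<in> L2_on a V"
  shows "(\<lambda>x. indicator V x * f x) \<in> borel_measurable borel"
    "integrable (gauss_l2 a) (\<lambda>x. (indicator V x * f x)\<^sup>2)"
    "integrable (gauss_l2 a) (\<lambda>x. indicator V x * f x)"
proof -
  interpret prob_space "gauss_l2 a" by fact
  have "f \<in> borel_on V" using f by (simp add: L2_on_def)
  then show m [measurable]: "(\<lambda>x. indicator V x * f x) \<in> borel_measurable borel"
    by (subst (asm) borel_measurable_restrict_space_iff) auto
  have "(\<lambda>x. indicator V x *\<^sub>R (f x)\<^sup>2) = (\<lambda>x. (indicator V x * f x)\<^sup>2)"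
    by (auto simp: indicator_def)
  then show i: "integrable (gauss_l2 a) (\<lambda>x. (indicator V x * f x)\<^sup>2)"
    using f by (simp add: L2_on_def set_integrable_def)
  show "integrable (gauss_l2 a) (\<lambda>x. indicator V x * f x)"
    by (rule square_integrable_imp_integrable[OF _ i]) measurable
qed

lemma measurable_L2: "u \<in> L2_on a W \<Longrightarrow> u \<in> borel_on W"
  by (simp add: L2_on_def)

lemma L2_onI:
  assumes W: "W \<in> sets borel" and u: "u \<in> borel_on W"
    and F: "integrable (gauss_l2 a) (\<lambda>x. indicator W x * F x)" "\<And>x. x \<in> W \<Longrightarrow> (u x)\<^sup>2 \<le> F x"
  shows "u \<in> L2_on a W"
proof -
  have "(\<lambda>x. (u x)\<^sup>2) \<in> borel_on W" using u by measurable
  then have "(\<lambda>x. indicator W x * (u x)\<^sup>2) \<in> borel_measurable (gauss_l2 a)"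
    using W by (subst (asm) borel_measurable_restrict_space_iff) auto
  moreover have "AE x in gauss_l2 a. norm (indicator W x * (u x)\<^sup>2) \<le> norm (indicator W x * F x)"
    by (intro AE_I2) (auto simp: indicator_def intro: order_trans[OF F(2) abs_ge_self])
  ultimately have "integrable (gauss_l2 a) (\<lambda>x. indicator W x * (u x)\<^sup>2)"
    by (rule Bochner_Integration.integrable_bound[OF F(1)])
  then show ?thesis using u by (simp add: L2_on_def set_integrable_def)
qed

lemma L2_add:
  assumes u: "u \<in> L2_on a W" "v \<in> L2_on a W" and W: "W \<in> sets borel"
  shows "(\<lambda>x. u x + v x) \<in> L2_on a W"
proof (rule L2_onI[OF W _ _ power2_add_le])
  note [measurable] = measurable_L2[OF u(1)] measurable_L2[OF u(2)]
  show "(\<lambda>x. u x + v x) \<in> borel_on W" by measurable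
  have "integrable (gauss_l2 a) (\<lambda>x. 2 * (indicator W x * (u x)\<^sup>2) + 2 * (indicator W x * (v x)\<^sup>2))"
    using u by (simp add: L2_on_def set_integrable_def)
  then show "integrable (gauss_l2 a) (\<lambda>x. indicator W x * (2 * (u x)\<^sup>2 + 2 * (v x)\<^sup>2))"
    by (simp add: distrib_left mult.left_commute)
qed

lemma L2_mult_bounded:
  assumes u: "u \<in> L2_on a W" and k: "k \<in> borel_on W" "bounded (k ` W)"
    and W: "W \<in> sets borel"
  shows "(\<lambda>x. u x * k x) \<in> L2_on a W"
proof -
  note [measurable] = measurable_L2[OF u] k(1)
  obtain K where K: "\<And>x. x \<in> W \<Longrightarrow> \<bar>k x\<bar> \<le> K" using k(2) by (auto simp: bounded_iff)
  show ?thesis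
  proof (rule L2_onI[OF W])
    show "(\<lambda>x. u x * k x) \<in> borel_on W" by measurable
    have "integrable (gauss_l2 a) (\<lambda>x. K\<^sup>2 * (indicator W x * (u x)\<^sup>2))"
      using u by (simp add: L2_on_def set_integrable_def)
    then show "integrable (gauss_l2 a) (\<lambda>x. indicator W x * (K\<^sup>2 * (u x)\<^sup>2))"
      by (simp add: mult.left_commute)
    show "(u x * k x)\<^sup>2 \<le> K\<^sup>2 * (u x)\<^sup>2" if "x \<in> W" for x
    proof -
      have "(k x)\<^sup>2 \<le> K\<^sup>2" using K[OF that] by (subst abs_le_square_iff[symmetric]) simp
      then show ?thesis by (simp add: power_mult_distrib mult.commute mult_right_mono)
    qed
  qed
qed

lemma L2_zero: "(\<lambda>_. 0) \<in> L2_on a W"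
  by (simp add: L2_on_def set_integrable_def)

section \<open>Weak derivatives tested against a larger class\<close>

definition drop_coord :: "nat \<Rightarrow> l2 \<Rightarrow> l2" where
  "drop_coord i x = x - coord x i *\<^sub>R basis i"

lemma coord_drop_coord: "coord (drop_coord i x) j = (if j = i then 0 else coord x j)"
  by (simp add: drop_coord_def coord_basis)

lemma drop_coord_shift: "drop_coord i (line x i t) = drop_coord i x"
  by (rule l2_eqI) (simp add: coord_drop_coord coord_basis)

lemma drop_coord_restore: "line (drop_coord i x) i (coord x i) = x"
  by (simp add: drop_coord_def)

lemma borel_measurable_drop_coord [measurable]: "drop_coord i \<in> borel_measurable borel"
  by (rule measurable_l2I) (simp add: coord_drop_coord)

lemma bumps_borel: "f \<in> bumps c r \<Longrightarrow> f \<in> borel_measurable borel"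
  by (intro borel_measurable_continuous_onI bumps_continuous)

lemma bumps_has_partial:
  assumes "f \<in> bumps c r" "0 \<le> r"
  shows "has_partial i f x (partial i f x)"
    "partial i f \<in> bumps c r"
proof -
  obtain D where D: "D i \<in> bumps c r"
    "\<And>x. has_partial i f x (D i x)"
    using bumps_partials[OF assms] by blast
  then have "partial i f = D i" by (auto intro: partial_eqI)
  with D show "has_partial i f x (partial i f x)"
    "partial i f \<in> bumps c r" by simp_all
qed

lemma bumps_adj_partial:
  assumes "f \<in> bumps c r" "0 \<le> r"
  shows "adj_partial a i f \<in> bumps c r"
proof -
  \<comment> \<open>The constant -1 is written as an affine function of a coordinate to match the
    closure rule for products.\<close>
  have "(\<lambda>x. (0 * coord x 0 + - 1) * partial i f x + (1 / (a i)\<^sup>2 * coord x i + 0) * f x) \<in> bumps c r"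
    by (intro bumps.add bumps.mult[where \<theta> = "\<lambda>t. 0 * t + - 1"]
        bumps.mult[where \<theta> = "\<lambda>t. 1 / (a i)\<^sup>2 * t + 0"] smooth_affine bumps_has_partial assms)
  then show ?thesis by (simp add: adj_partial_def[abs_def])
qed

lemma bumps_mult_prod:
  assumes "finite J" "\<And>j. j \<in> J \<Longrightarrow> smooth (\<theta> j)" "f \<in> bumps c r"
  shows "(\<lambda>x. (\<Prod>j\<in>J. \<theta> j (coord x j)) * f x) \<in> bumps c r"
  using assms
proof (induction J)
  case (insert j J)
  then have "(\<lambda>x. \<theta> j (coord x j) * ((\<Prod>j\<in>J. \<theta> j (coord x j)) * f x)) \<in> bumps c r"
    by (intro bumps.mult) auto
  then show ?case using insert by (simp add: mult.assoc)
qed simp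

lemma adj_partial_mult:
  assumes "has_partial i u x u'"
    and "has_partial i f x f'"
  shows "adj_partial a i (\<lambda>x. u x * f x) x = u x * adj_partial a i f x - u' * f x"
proof -
  have "partial i f x = f'" by (rule partial_eqI(1)[OF assms(2)])
  moreover have "partial i (\<lambda>x. u x * f x) x = u' * f x + f' * u x"
    using partial_eqI(1)[OF DERIV_mult[OF assms]] by simp
  ultimately show ?thesis by (simp add: adj_partial_def algebra_simps)
qed

text \<open>Both sides of the defining identity are gathered into one integrable function, so that
  the results on vanishing functionals can be applied to it with further factors.\<close>

lemma weak_partial_bumps:
  assumes V: "V \<in> sets borel" and P: "prob_space (gauss_l2 a)" and w: "has_weak_partial a V i f q"
    and \<beta>: "\<beta> \<in> bumps c r" "0 \<le> r" "r < r'" "ball c r' \<subseteq> V"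
  shows "integrable (gauss_l2 a) (\<lambda>x. indicator V x * q x * \<beta> x - indicator V x * f x * adj_partial a i \<beta> x)"
    and "(\<integral>x. indicator V x * q x * \<beta> x - indicator V x * f x * adj_partial a i \<beta> x \<partial>gauss_l2 a) = 0"
proof -
  have fq: "f \<in> L2_on a V" "q \<in> L2_on a V" using w by (auto simp: has_weak_partial_def)
  have int: "integrable (gauss_l2 a) (\<lambda>x. indicator V x * g x * \<phi> x)"
    if "g \<in> L2_on a V" and \<phi>: "\<phi> \<in> bumps c r" for g \<phi>
  proof -
    obtain B where "\<And>x. \<bar>\<phi> x\<bar> \<le> B" using bumps_bounded[OF \<phi> \<beta>(2)] by blast
    then show ?thesis
      using bumps_borel[OF \<phi>] by (intro integrable_mult_bounded L2_onD(3)[OF V P]) (use that in auto)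
  qed
  have i: "integrable (gauss_l2 a) (\<lambda>x. indicator V x * q x * \<beta> x)"
    "integrable (gauss_l2 a) (\<lambda>x. indicator V x * f x * adj_partial a i \<beta> x)"
    by (intro int fq bumps_adj_partial \<beta>)+
  then show "integrable (gauss_l2 a) (\<lambda>x. indicator V x * q x * \<beta> x - indicator V x * f x * adj_partial a i \<beta> x)"
    by simp
  have "\<beta> \<in> C_F_0 V" by (rule bumps_C_F_0[OF \<beta>])
  then have "(LINT x:V|gauss_l2 a. q x * \<beta> x) = (LINT x:V|gauss_l2 a. f x * adj_partial a i \<beta> x)"
    using w unfolding has_weak_partial_def by blast
  then show "(\<integral>x. indicator V x * q x * \<beta> x - indicator V x * f x * adj_partial a i \<beta> x \<partial>gauss_l2 a) = 0"
    unfolding Bochner_Integration.integral_diff[OF i] by (simp add: set_lebesgue_integral_def mult.assoc)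
qed

section \<open>Borel factors in the remaining coordinates\<close>

lemma prod_ramp_tendsto:
  "(\<lambda>n. \<Prod>j\<in>J. steep n (coord x j - \<alpha> j)) \<longlonglongrightarrow> (\<Prod>j\<in>J. indicator {\<alpha> j<..} (coord x j))"
proof (rule tendsto_prod)
  fix j
  have "indicator {0<..} (coord x j - \<alpha> j) = (indicator {\<alpha> j<..} (coord x j) :: real)"
    by (auto simp: indicator_def)
  then show "(\<lambda>n. steep n (coord x j - \<alpha> j)) \<longlonglongrightarrow> indicator {\<alpha> j<..} (coord x j)"
    using ramp_scaled_tendsto[of "coord x j - \<alpha> j"] by simp
qed

lemma abs_prod_ramp_le_1: "\<bar>\<Prod>j\<in>J. ramp (u j)\<bar> \<le> 1"
  by (simp add: abs_prod prod_le_1)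

lemma integral_mult_prod_indicator_eq_0:
  notes [simp del] = of_nat_Suc
  fixes G :: "l2 \<Rightarrow> real"
  assumes sM: "sets M = sets borel" and G: "integrable M G" and J: "finite J"
    and zero: "\<And>n. (\<integral>x. G x * (\<Prod>j\<in>J. steep n (coord x j - \<alpha> j)) \<partial>M) = 0"
  shows "(\<integral>x. G x * (\<Prod>j\<in>J. indicator {\<alpha> j<..} (coord x j)) \<partial>M) = 0"
proof -
  have [measurable]: "G \<in> borel_measurable borel"
    using borel_measurable_integrable[OF G] unfolding measurable_cong_sets[OF sM refl] .
  have "(\<lambda>n. \<integral>x. G x * (\<Prod>j\<in>J. steep n (coord x j - \<alpha> j)) \<partial>M) \<longlonglongrightarrow>
      (\<integral>x. G x * (\<Prod>j\<in>J. indicator {\<alpha> j<..} (coord x j)) \<partial>M)"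
  proof (rule integral_dominated_convergence[where w = "\<lambda>x. norm (G x)"])
    show "AE x in M. (\<lambda>n. G x * (\<Prod>j\<in>J. steep n (coord x j - \<alpha> j))) \<longlonglongrightarrow>
        G x * (\<Prod>j\<in>J. indicator {\<alpha> j<..} (coord x j))"
      by (intro AE_I2 tendsto_mult_left prod_ramp_tendsto)
    show "AE x in M. norm (G x * (\<Prod>j\<in>J. steep n (coord x j - \<alpha> j))) \<le> norm (G x)" for n
      using mult_left_le[OF abs_prod_ramp_le_1 abs_ge_zero] by (intro AE_I2) (simp only: real_norm_def abs_mult)
    show "(\<lambda>x. G x * (\<Prod>j\<in>J. indicator {\<alpha> j<..} (coord x j))) \<in> borel_measurable M"
      unfolding measurable_cong_sets[OF sM refl] by measurable
    show "(\<lambda>x. G x * (\<Prod>j\<in>J. steep n (coord x j - \<alpha> j))) \<in> borel_measurable M" for n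
      unfolding measurable_cong_sets[OF sM refl] by measurable
  qed (use G in simp)
  then show ?thesis by (simp add: zero LIMSEQ_const_iff)
qed

text \<open>A factor not depending on the i-th coordinate commutes with
  \<open>adj_partial a i\<close>. A product of \<open>steep\<close> functions of other coordinates
  times \<beta> is again a bump, hence a test function; limits of these and
  \<open>integral_mult_bounded_function_eq_0\<close> reach every bounded Borel factor.\<close>

lemma weak_partial_bumps_mult:
  notes [simp del] = of_nat_Suc
  assumes V: "V \<in> sets borel" and P: "prob_space (gauss_l2 a)" and w: "has_weak_partial a V i f q"
    and \<beta>: "\<beta> \<in> bumps c r" "0 \<le> r" "r < r'" "ball c r' \<subseteq> V"
    and \<eta>: "\<eta> \<in> borel_measurable borel" "\<And>x. \<bar>\<eta> x\<bar> \<le> B"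
  shows "(\<integral>x. (indicator V x * q x * \<beta> x - indicator V x * f x * adj_partial a i \<beta> x) *
    \<eta> (drop_coord i x) \<partial>gauss_l2 a) = 0"
proof (rule integral_mult_bounded_function_eq_0[where I = "- {i}" and B = B])
  let ?G = "\<lambda>x. indicator V x * q x * \<beta> x - indicator V x * f x * adj_partial a i \<beta> x"
  show G: "integrable (gauss_l2 a) ?G" by (rule weak_partial_bumps(1)[OF V P w \<beta>])
  fix J :: "nat set" and \<alpha> :: "nat \<Rightarrow> real" assume J: "finite J" "J \<subseteq> - {i}"
  show "(\<integral>x. ?G x * (\<Prod>j\<in>J. indicator {\<alpha> j<..} (coord x j)) \<partial>gauss_l2 a) = 0"
  proof (rule integral_mult_prod_indicator_eq_0[OF sets_gauss_l2 G J(1)])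
    fix n
    let ?\<theta> = "\<lambda>x. \<Prod>j\<in>J. steep n (coord x j - \<alpha> j)"
    have "smooth (\<lambda>t. steep n (t - \<alpha> j))" for j
      using smooth_comp_affine[OF smooth_ramp, of "real (Suc n)" "- (real (Suc n) * \<alpha> j)"]
      by (simp add: algebra_simps)
    then have "(\<lambda>x. ?\<theta> x * \<beta> x) \<in> bumps c r"
      by (intro bumps_mult_prod[where \<theta> = "\<lambda>j t. steep n (t - \<alpha> j)"] J(1) \<beta>)
    from weak_partial_bumps(2)[OF V P w this \<beta>(2-4)]
    have "(\<integral>x. indicator V x * q x * (?\<theta> x * \<beta> x) -
        indicator V x * f x * adj_partial a i (\<lambda>x. ?\<theta> x * \<beta> x) x \<partial>gauss_l2 a) = 0" .
    moreover have "adj_partial a i (\<lambda>x. ?\<theta> x * \<beta> x) x = ?\<theta> x * adj_partial a i \<beta> x" for x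
    proof -
      have "?\<theta> (line x i t) = ?\<theta> x" for t
        using J(2) by (intro prod.cong) (auto simp: coord_basis)
      then have "has_partial i ?\<theta> x 0" by simp
      from adj_partial_mult[OF this bumps_has_partial(1)[OF \<beta>(1,2)]] show ?thesis by simp
    qed
    ultimately show "(\<integral>x. ?G x * ?\<theta> x \<partial>gauss_l2 a) = 0" by (simp add: algebra_simps)
  qed
qed (use \<eta> in \<open>auto simp: coord_drop_coord\<close>)

text \<open>The transport of \<^const>\<open>C_F_0\<close> under the flattening map may leave that class: nothing
  bounds the sum of the squares of all partial derivatives of \<open>g\<close>. This class asks for regularity in
  the \<open>i\<close>-th direction only and is stable.\<close>

definition line_C1 :: "nat \<Rightarrow> (l2 \<Rightarrow> real) \<Rightarrow> (l2 \<Rightarrow> real) \<Rightarrow> bool" where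
  "line_C1 i \<phi> \<phi>' \<longleftrightarrow> \<phi> \<in> borel_measurable borel \<and> \<phi>' \<in> borel_measurable borel \<and>
    (\<exists>B. \<forall>x. \<bar>\<phi> x\<bar> \<le> B \<and> \<bar>\<phi>' x\<bar> \<le> B) \<and>
    (\<exists>R. \<forall>x. \<phi> x \<noteq> 0 \<or> \<phi>' x \<noteq> 0 \<longrightarrow> \<bar>coord x i\<bar> \<le> R) \<and>
    (\<forall>x. has_partial i \<phi> x (\<phi>' x)) \<and>
    (\<forall>x. isCont (\<lambda>t. \<phi>' (line x i t)) 0)"

lemma line_C1_deriv:
  assumes "line_C1 i \<phi> \<phi>'"
  shows "((\<lambda>t. \<phi> (line x i t)) has_real_derivative \<phi>' (line x i t)) (at t)"
    "isCont (\<lambda>t. \<phi>' (line x i t)) t"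
proof -
  have *: "\<forall>x. has_partial i \<phi> x (\<phi>' x)"
    and **: "\<forall>x. isCont (\<lambda>t. \<phi>' (line x i t)) 0"
    using assms unfolding line_C1_def by - (elim conjE; assumption)+
  show "((\<lambda>t. \<phi> (line x i t)) has_real_derivative \<phi>' (line x i t)) (at t)"
    by (rule has_partial_shift) (rule *[rule_format])
  have "isCont (\<lambda>s. \<phi>' (line x i t + s *\<^sub>R basis i)) 0"
    by (rule **[rule_format])
  then have "isCont (\<lambda>s. \<phi>' (x + (t + s) *\<^sub>R basis i)) 0"
    by (simp only: scaleR_add_left add.assoc)
  then have "((\<lambda>s. \<phi>' (x + (t + s) *\<^sub>R basis i)) \<longlongrightarrow> \<phi>' (line x i t)) (at 0)"
    by (simp add: isCont_def)
  then show "isCont (\<lambda>t. \<phi>' (line x i t)) t"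
    unfolding isCont_def by (subst LIM_offset_zero_iff) auto
qed

text \<open>Since \<open>\<phi> x\<close> is the integral over \<open>s\<close> of \<open>\<phi>' (line (drop_coord i x) i s)\<close> against the
  Heaviside function of \<open>coord x i - s\<close>, it is a limit of superpositions of bump functions
  multiplied by functions not depending on the \<open>i\<close>-th coordinate.\<close>

lemma ramp_superposition_tendsto:
  notes [simp del] = of_nat_Suc
  assumes \<phi>: "line_C1 i \<phi> \<phi>'" and R: "\<And>x. \<phi> x \<noteq> 0 \<or> \<phi>' x \<noteq> 0 \<Longrightarrow> \<bar>coord x i\<bar> \<le> R"
    and B: "\<And>x. \<bar>\<phi>' x\<bar> \<le> B"
  shows "(\<lambda>n. \<integral>s. steep n (coord x i - s) * \<phi>' (line (drop_coord i x) i s) \<partial>lborel)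
    \<longlonglongrightarrow> \<phi> x"
    and "\<bar>\<integral>s. steep n (coord x i - s) * \<phi>' (line (drop_coord i x) i s) \<partial>lborel\<bar>
      \<le> B * (2 * \<bar>R\<bar>)"
proof -
  let ?l = "\<lambda>s. \<phi>' (line (drop_coord i x) i s)"
  have cont: "isCont ?l s" for s by (rule line_C1_deriv(2)[OF \<phi>])
  then have [measurable]: "?l \<in> borel_measurable borel"
    by (intro borel_measurable_continuous_onI continuous_at_imp_continuous_on) auto
  have l0: "?l s = 0" if "\<not> \<bar>s\<bar> \<le> \<bar>R\<bar>" for s
    using R[of "line (drop_coord i x) i s"] that by (force simp: coord_drop_coord coord_basis)
  have bound: "\<bar>ramp u * ?l s\<bar> \<le> B * indicator {-\<bar>R\<bar>..\<bar>R\<bar>} s" for u s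
  proof (cases "\<bar>s\<bar> \<le> \<bar>R\<bar>")
    case True
    have "\<bar>ramp u * ?l s\<bar> \<le> 1 * B"
      unfolding abs_mult using B by (intro mult_mono) auto
    then show ?thesis using True by (auto simp: indicator_def abs_le_iff)
  qed (auto simp: l0 indicator_def)
  have bi: "integrable lborel (\<lambda>s. B * indicator {-\<bar>R\<bar>..\<bar>R\<bar>} s :: real)"
    by (intro integrable_mult_right integrable_real_indicator) (auto simp: emeasure_lborel_Icc_eq)
  have int: "integrable lborel (\<lambda>s. steep n (coord x i - s) * ?l s)" for n
    by (rule Bochner_Integration.integrable_bound[OF bi]) (auto intro!: AE_I2 order_trans[OF bound])
  have "\<bar>\<integral>s. steep n (coord x i - s) * ?l s \<partial>lborel\<bar> \<le>
      (\<integral>s. B * indicator {-\<bar>R\<bar>..\<bar>R\<bar>} s \<partial>lborel)"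
    using bound
    by (intro integral_abs_bound_integral int bi)
  also have "\<dots> = B * (2 * \<bar>R\<bar>)" by simp
  finally show "\<bar>\<integral>s. steep n (coord x i - s) * ?l s \<partial>lborel\<bar> \<le> B * (2 * \<bar>R\<bar>)" .
  have "(\<lambda>n. \<integral>s. steep n (coord x i - s) * ?l s \<partial>lborel) \<longlonglongrightarrow>
      (\<integral>s. indicator {0<..} (coord x i - s) * ?l s \<partial>lborel)"
    by (rule integral_dominated_convergence[OF _ _ bi])
       (auto intro!: AE_I2 order_trans[OF bound] tendsto_mult_right ramp_scaled_tendsto)
  \<comment> \<open>The limit is the integral of the derivative along the line up to
    \<open>coord x i\<close>; the lower end \<open>?L\<close> lies one unit below the support, where
    \<phi> is 0.\<close>
  also have "(\<integral>s. indicator {0<..} (coord x i - s) * ?l s \<partial>lborel) = \<phi> x"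
  proof (cases "coord x i \<ge> - \<bar>R\<bar> - 1")
    case True
    let ?L = "- \<bar>R\<bar> - 1"
    have "(\<integral>s. indicator {0<..} (coord x i - s) * ?l s \<partial>lborel) =
        (\<integral>s. ?l s * indicator {?L..coord x i} s \<partial>lborel)"
    proof (rule integral_cong_AE)
      \<comment> \<open>The open half-line misses the end point \<open>s = coord x i\<close>, which
        is a null set.\<close>
      show "AE s in lborel. indicator {0<..} (coord x i - s) * ?l s = ?l s * indicator {?L..coord x i} s"
        using AE_lborel_singleton[of "coord x i"]
      proof eventually_elim
        case (elim s)
        then show ?case using l0[of s] by (auto simp: indicator_def)
      qed
    qed measurable
    also have "\<dots> = \<phi> (line (drop_coord i x) i (coord x i)) - \<phi> (line (drop_coord i x) i ?L)"
      by (rule integral_FTC_Icc_real[where F = "\<lambda>s. \<phi> (line (drop_coord i x) i s)"])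
         (use True line_C1_deriv(1)[OF \<phi>] cont in auto)
    also have "\<phi> (line (drop_coord i x) i ?L) = 0"
      using R[of "line (drop_coord i x) i ?L"] by (force simp: coord_drop_coord coord_basis)
    finally show ?thesis by (simp add: drop_coord_restore)
  next
    case False
    then have "indicator {0<..} (coord x i - s) * ?l s = 0" for s
      using l0[of s] by (auto simp: indicator_def)
    moreover have "\<phi> x = 0" using R[of x] False by force
    ultimately show ?thesis by (simp only: Bochner_Integration.integral_zero)
  qed
  finally show "(\<lambda>n. \<integral>s. steep n (coord x i - s) * ?l s \<partial>lborel) \<longlonglongrightarrow> \<phi> x" .
qed

text \<open>Convolution along the line with an approximate identity. The substitution
  \<open>s = coord x i - u / Suc n\<close> moves \<open>n\<close> from the kernel into the argument
  of \<phi>', where continuity along the line gives the limit, dominated by a multiple of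
  \<open>ramp'\<close>.\<close>

lemma ramp'_superposition_tendsto:
  notes [simp del] = of_nat_Suc
  assumes \<phi>: "line_C1 i \<phi> \<phi>'" and B: "\<And>x. \<bar>\<phi>' x\<bar> \<le> B"
  shows "(\<lambda>n. \<integral>s. steep' n (coord x i - s) *
      \<phi>' (line (drop_coord i x) i s) \<partial>lborel) \<longlonglongrightarrow> \<phi>' x"
    and "\<bar>\<integral>s. steep' n (coord x i - s) *
      \<phi>' (line (drop_coord i x) i s) \<partial>lborel\<bar> \<le> B"
proof -
  let ?l = "\<lambda>u. \<phi>' (line x i u)"
  have cont: "isCont ?l s" for s by (rule line_C1_deriv(2)[OF \<phi>])
  have [measurable]: "\<phi>' \<in> borel_measurable borel" using \<phi> by (simp add: line_C1_def)
  have eq: "(\<integral>s. steep' n (coord x i - s) *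
      \<phi>' (line (drop_coord i x) i s) \<partial>lborel) = (\<integral>u. ramp' u * ?l (- u / real (Suc n)) \<partial>lborel)" for n
  proof -
    let ?N = "real (Suc n)"
    have d: "drop_coord i x + (coord x i + - (1 / ?N) * u) *\<^sub>R basis i = x + (- u / ?N) *\<^sub>R basis i" for u
      by (simp add: drop_coord_def algebra_simps)
    have "(\<integral>s. (?N * ramp' (?N * (coord x i - s))) * \<phi>' (line (drop_coord i x) i s) \<partial>lborel) =
      \<bar>- (1 / ?N)\<bar> *\<^sub>R (\<integral>u. (?N * ramp' (?N * (coord x i - (coord x i + - (1 / ?N) * u)))) *
        \<phi>' (drop_coord i x + (coord x i + - (1 / ?N) * u) *\<^sub>R basis i) \<partial>lborel)"
      by (rule lborel_integral_real_affine) simp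
    also have "\<dots> = (1 / ?N) * (\<integral>u. ?N * (ramp' u * ?l (- u / ?N)) \<partial>lborel)"
      unfolding d by (simp add: mult.assoc)
    also have "\<dots> = (\<integral>u. ramp' u * ?l (- u / ?N) \<partial>lborel)" by simp
    finally show ?thesis .
  qed
  have bi: "integrable lborel (\<lambda>u. ramp' u * B)" using ramp'_integral(1) by simp
  have bound: "\<bar>ramp' u * ?l v\<bar> \<le> ramp' u * B" for u v
    using B by (simp add: abs_mult mult_left_mono)
  have int: "integrable lborel (\<lambda>u. ramp' u * ?l (- u / real (Suc n)))" for n
  proof (rule Bochner_Integration.integrable_bound[OF bi])
    show "(\<lambda>u. ramp' u * ?l (- u / real (Suc n))) \<in> borel_measurable lborel" by measurable
    show "AE u in lborel. norm (ramp' u * ?l (- u / real (Suc n))) \<le> norm (ramp' u * B)"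
      using order_trans[OF bound abs_ge_self] by (intro AE_I2) (simp only: real_norm_def)
  qed
  have "\<bar>\<integral>u. ramp' u * ?l (- u / real (Suc n)) \<partial>lborel\<bar> \<le> (\<integral>u. ramp' u * B \<partial>lborel)"
    using bound
    by (intro integral_abs_bound_integral int bi)
  also have "\<dots> = B" using ramp'_integral by simp
  finally show "\<bar>\<integral>s. steep' n (coord x i - s) *
      \<phi>' (line (drop_coord i x) i s) \<partial>lborel\<bar> \<le> B" unfolding eq .
  have "(\<lambda>n. \<integral>u. ramp' u * ?l (- u / real (Suc n)) \<partial>lborel) \<longlonglongrightarrow> (\<integral>u. ramp' u * ?l 0 \<partial>lborel)"
  proof (rule integral_dominated_convergence[OF _ _ bi])
    have "(\<lambda>n. ramp' u * ?l (- u / real (Suc n))) \<longlonglongrightarrow> ramp' u * ?l 0" for u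
    proof (intro tendsto_mult_left isCont_tendsto_compose[OF cont])
      have "(\<lambda>n. - u * inverse (real (Suc n))) \<longlonglongrightarrow> - u * 0"
        by (intro tendsto_mult_left LIMSEQ_inverse_real_of_nat)
      then show "(\<lambda>n. - u / real (Suc n)) \<longlonglongrightarrow> 0" by (simp add: divide_inverse)
    qed
    then show "AE u in lborel. (\<lambda>n. ramp' u * ?l (- u / real (Suc n))) \<longlonglongrightarrow> ramp' u * ?l 0" by simp
    show "AE u in lborel. norm (ramp' u * ?l (- u / real (Suc n))) \<le> ramp' u * B" for n
      by (intro AE_I2) (simp only: real_norm_def bound)
  qed measurable
  then show "(\<lambda>n. \<integral>s. steep' n (coord x i - s) *
      \<phi>' (line (drop_coord i x) i s) \<partial>lborel) \<longlonglongrightarrow> \<phi>' x"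
    unfolding eq using ramp'_integral by simp
qed

section \<open>Bumps times functions that are regular along lines in one direction\<close>

lemma integrable_pair_mult:
  fixes h :: "'a \<Rightarrow> real" and k :: "'b \<Rightarrow> real"
  assumes "sigma_finite_measure M" "sigma_finite_measure N"
    and h: "integrable M h" and k: "integrable N k"
  shows "integrable (M \<Otimes>\<^sub>M N) (\<lambda>(x, s). h x * k s)"
proof -
  interpret M: sigma_finite_measure M by fact
  interpret N: sigma_finite_measure N by fact
  interpret pair_sigma_finite M N ..
  have [measurable]: "h \<in> borel_measurable M" "k \<in> borel_measurable N" using h k by auto
  show ?thesis
  proof (rule Fubini_integrable)
    show "integrable M (\<lambda>x. \<integral>y. norm (case (x, y) of (x, s) \<Rightarrow> h x * k s) \<partial>N)"
      using h by (simp add: abs_mult)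
  qed (use k in auto)
qed

text \<open>The integrand is that of the defining identity for the product of \<beta> and \<phi>,
  expanded by the product rule. It is linear in the pair (\<phi>, \<phi>'), so it vanishes for
  superpositions by Fubini and then in the limit.\<close>

lemma weak_partial_bumps_line:
  notes [simp del] = of_nat_Suc
  assumes V [measurable]: "V \<in> sets borel" and P: "prob_space (gauss_l2 a)"
    and w: "has_weak_partial a V i f q"
    and \<beta>: "\<beta> \<in> bumps c r" "0 \<le> r" "r < r'" "ball c r' \<subseteq> V"
    and \<phi>: "line_C1 i \<phi> \<phi>'"
  shows "(\<integral>x. (indicator V x * q x * \<beta> x - indicator V x * f x * adj_partial a i \<beta> x) * \<phi> x +
      indicator V x * f x * \<beta> x * \<phi>' x \<partial>gauss_l2 a) = 0"
proof -
  let ?P = "gauss_l2 a"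
  interpret P: prob_space ?P by fact
  interpret pair_sigma_finite ?P lborel ..
  define G where "G = (\<lambda>x. indicator V x * q x * \<beta> x - indicator V x * f x * adj_partial a i \<beta> x)"
  define F where "F = (\<lambda>x. indicator V x * f x * \<beta> x)"
  have G: "integrable ?P G" unfolding G_def by (rule weak_partial_bumps(1)[OF V P w \<beta>])
  have fL: "f \<in> L2_on a V" using w by (simp add: has_weak_partial_def)
  obtain B\<beta> where B\<beta>: "\<And>x. \<bar>\<beta> x\<bar> \<le> B\<beta>" using bumps_bounded[OF \<beta>(1,2)] by blast
  have F: "integrable ?P F"
    unfolding F_def using bumps_borel[OF \<beta>(1)] B\<beta>
    by (intro integrable_mult_bounded L2_onD(3)[OF V P fL]) auto
  have [measurable]: "G \<in> borel_measurable borel" "F \<in> borel_measurable borel"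
    using borel_measurable_integrable[OF G] borel_measurable_integrable[OF F]
    by (simp_all add: measurable_cong_sets[OF sets_gauss_l2 refl])
  have [measurable]: "\<phi> \<in> borel_measurable borel" "\<phi>' \<in> borel_measurable borel"
    using \<phi> by (simp_all add: line_C1_def)
  obtain B where B: "\<And>x. \<bar>\<phi>' x\<bar> \<le> B" using \<phi> unfolding line_C1_def by blast
  obtain R where R: "\<And>x. \<phi> x \<noteq> 0 \<or> \<phi>' x \<noteq> 0 \<Longrightarrow> \<bar>coord x i\<bar> \<le> R"
    using \<phi> unfolding line_C1_def by blast
  \<comment> \<open>For fixed \<open>s\<close> this is the integrand belonging to the bump
    \<open>steep n (coord x i - s) * \<beta> x\<close>, times the value of \<phi>' at parameter
    \<open>s\<close> on the line through \<open>x\<close>. That value does not depend on the i-th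
    coordinate of \<open>x\<close>.\<close>
  define K where "K = (\<lambda>n x s. (G x * steep n (coord x i - s) +
    F x * steep' n (coord x i - s)) * \<phi>' (line (drop_coord i x) i s))"
  have K0: "(\<integral>x. K n x s \<partial>?P) = 0" for n s
  proof -
    let ?N = "real (Suc n)"
    let ?u = "\<lambda>x. ramp (?N * (coord x i - s))"
    have "smooth (\<lambda>t. ramp (?N * (t - s)))"
      using smooth_comp_affine[OF smooth_ramp, of ?N "- (?N * s)"] by (simp add: algebra_simps)
    then have "(\<lambda>x. ?u x * \<beta> x) \<in> bumps c r" by (rule bumps.mult[OF \<beta>(1)])
    moreover have "(\<lambda>y. \<phi>' (line y i s)) \<in> borel_measurable borel" by measurable
    ultimately have I0: "(\<integral>x. (indicator V x * q x * (?u x * \<beta> x) -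
        indicator V x * f x * adj_partial a i (\<lambda>x. ?u x * \<beta> x) x) *
        \<phi>' (line (drop_coord i x) i s) \<partial>?P) = 0"
      by (rule weak_partial_bumps_mult[OF V P w _ \<beta>(2-4)]) (rule B)
    have adj: "adj_partial a i (\<lambda>x. ?u x * \<beta> x) x =
        ?u x * adj_partial a i \<beta> x - (?N * ramp' (?N * (coord x i - s))) * \<beta> x" for x
    proof (rule adj_partial_mult)
      have "((\<lambda>t. ?N * (coord (line x i t) i - s)) has_real_derivative ?N) (at 0)"
        by (auto intro!: derivative_eq_intros simp: coord_basis)
      from DERIV_chain2[where f = ramp, OF ramp_has_derivative this]
      show "has_partial i ?u x (?N * ramp' (?N * (coord x i - s)))"
        by (simp add: mult.commute)
    qed (rule bumps_has_partial(1)[OF \<beta>(1,2)])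
    have "K n x s = (indicator V x * q x * (?u x * \<beta> x) -
        indicator V x * f x * adj_partial a i (\<lambda>x. ?u x * \<beta> x) x) *
        \<phi>' (line (drop_coord i x) i s)" for x
      unfolding adj K_def G_def F_def by (simp add: algebra_simps)
    then show ?thesis by (simp only: I0)
  qed
  \<comment> \<open>This bound grows with \<open>n\<close> and serves Fubini only. The passage to
    the limit uses bounds on the inner integrals that are uniform in \<open>n\<close>.\<close>
  have bound: "\<bar>K n x s\<bar> \<le> (\<bar>G x\<bar> + 2 * real (Suc n) * \<bar>F x\<bar>) * B * indicator {-\<bar>R\<bar>..\<bar>R\<bar>} s" for n x s
  proof (cases "\<bar>s\<bar> \<le> \<bar>R\<bar>")
    case True
    let ?N = "real (Suc n)"
    let ?t = "?N * (coord x i - s)"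
    have "\<bar>G x * ramp ?t + F x * (?N * ramp' ?t)\<bar> \<le> \<bar>G x\<bar> * 1 + \<bar>F x\<bar> * (?N * 2)"
      by (rule order_trans[OF abs_triangle_ineq], unfold abs_mult)
         (intro add_mono mult_left_mono, auto simp: ramp'_le_2)
    then have "\<bar>K n x s\<bar> \<le> (\<bar>G x\<bar> + 2 * ?N * \<bar>F x\<bar>) * B"
      unfolding K_def abs_mult[of "_ + _"] using B
      by (intro mult_mono) (auto simp: algebra_simps)
    then show ?thesis using True by (auto simp: indicator_def abs_le_iff)
  next
    case False
    then have "\<phi>' (line (drop_coord i x) i s) = 0"
      using R[of "line (drop_coord i x) i s"] by (force simp: coord_drop_coord coord_basis)
    then show ?thesis using False by (auto simp: K_def indicator_def)
  qed
  have [measurable]: "(\<lambda>(x, s). K n x s) \<in> borel_measurable (?P \<Otimes>\<^sub>M lborel)" for n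
  proof -
    have [measurable]: "(\<lambda>z. drop_coord i (fst z) + snd z *\<^sub>R basis i) \<in> borel_measurable (?P \<Otimes>\<^sub>M lborel)"
      by (rule measurable_l2I) (simp add: coord_drop_coord)
    show ?thesis unfolding K_def case_prod_beta by measurable
  qed
  have sf: "sigma_finite_measure ?P" "sigma_finite_measure (lborel :: real measure)" by unfold_locales
  have intK: "integrable (?P \<Otimes>\<^sub>M lborel) (\<lambda>(x, s). K n x s)" for n
  proof (rule Bochner_Integration.integrable_bound)
    show "integrable (?P \<Otimes>\<^sub>M lborel) (\<lambda>(x, s). (\<bar>G x\<bar> + 2 * real (Suc n) * \<bar>F x\<bar>) *
        (B * indicator {-\<bar>R\<bar>..\<bar>R\<bar>} s))"
      using G F
      by (intro integrable_pair_mult[OF sf] integrable_mult_right integrable_real_indicator Bochner_Integration.integrable_add integrable_abs)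
         (auto simp: emeasure_lborel_Icc_eq)
    show "AE z in ?P \<Otimes>\<^sub>M lborel. norm (case z of (x, s) \<Rightarrow> K n x s) \<le>
        norm (case z of (x, s) \<Rightarrow> (\<bar>G x\<bar> + 2 * real (Suc n) * \<bar>F x\<bar>) * (B * indicator {-\<bar>R\<bar>..\<bar>R\<bar>} s))"
      using order_trans[OF bound abs_ge_self]
      by (intro AE_I2) (simp only: case_prod_beta real_norm_def mult.assoc)
  qed measurable
  define \<Phi> where "\<Phi> = (\<lambda>n x. \<integral>s. steep n (coord x i - s) * \<phi>' (line (drop_coord i x) i s) \<partial>lborel)"
  define \<Psi> where "\<Psi> = (\<lambda>n x. \<integral>s. steep' n (coord x i - s) *
      \<phi>' (line (drop_coord i x) i s) \<partial>lborel)"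
  have KI: "(\<integral>s. K n x s \<partial>lborel) = G x * \<Phi> n x + F x * \<Psi> n x" for n x
  proof -
    have bi: "integrable lborel (\<lambda>s. c * indicator {-\<bar>R\<bar>..\<bar>R\<bar>} s :: real)" for c
      by (intro integrable_mult_right integrable_real_indicator) (auto simp: emeasure_lborel_Icc_eq)
    have [measurable]: "(\<lambda>s. line (drop_coord i x) i s) \<in> borel_measurable borel"
      by (rule measurable_l2I) simp
    have z: "\<phi>' (line (drop_coord i x) i s) = 0" if "s \<notin> {-\<bar>R\<bar>..\<bar>R\<bar>}" for s
      using R[of "line (drop_coord i x) i s"] that by (force simp: coord_drop_coord coord_basis)
    have int: "integrable lborel (\<lambda>s. u s * \<phi>' (line (drop_coord i x) i s))"
      if [measurable]: "u \<in> borel_measurable borel" and u: "\<And>s. \<bar>u s\<bar> \<le> C" for u :: "real \<Rightarrow> real" and C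
    proof (rule Bochner_Integration.integrable_bound[OF bi[of "C * B"]])
      have "\<bar>u s * \<phi>' (line (drop_coord i x) i s)\<bar> \<le> C * B * indicator {-\<bar>R\<bar>..\<bar>R\<bar>} s" for s
      proof (cases "s \<in> {-\<bar>R\<bar>..\<bar>R\<bar>}")
        case True
        have "0 \<le> C" using u[of 0] by linarith
        then show ?thesis using True unfolding abs_mult by (simp add: mult_mono u B)
      qed (simp add: z)
      from order_trans[OF this abs_ge_self]
      show "AE s in lborel. norm (u s * \<phi>' (line (drop_coord i x) i s)) \<le>
          norm (C * B * indicator {-\<bar>R\<bar>..\<bar>R\<bar>} s)"
        by (intro AE_I2) (simp only: real_norm_def)
    qed measurable
    have 1: "integrable lborel (\<lambda>s. G x * (steep n (coord x i - s) * \<phi>' (line (drop_coord i x) i s)))"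
      by (intro integrable_mult_right int[of _ 1]) auto
    have 2: "integrable lborel (\<lambda>s. F x * (steep' n (coord x i - s) *
        \<phi>' (line (drop_coord i x) i s)))"
      by (intro integrable_mult_right int[of _ "real (Suc n) * 2"]) (auto simp: abs_mult ramp'_le_2)
    show ?thesis
      using Bochner_Integration.integral_add[OF 1 2]
      by (simp only: K_def \<Phi>_def \<Psi>_def Bochner_Integration.integral_mult_right_zero
          distrib_right mult.assoc)
  qed
  have KI0: "(\<integral>x. G x * \<Phi> n x + F x * \<Psi> n x \<partial>?P) = 0" for n
  proof -
    have "(\<integral>s. (\<integral>x. K n x s \<partial>?P) \<partial>lborel) = (\<integral>x. (\<integral>s. K n x s \<partial>lborel) \<partial>?P)"
      by (rule Fubini_integral[OF intK])
    then show ?thesis by (simp add: K0 KI)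
  qed
  have "(\<lambda>n. \<integral>x. G x * \<Phi> n x + F x * \<Psi> n x \<partial>?P) \<longlonglongrightarrow> (\<integral>x. G x * \<phi> x + F x * \<phi>' x \<partial>?P)"
  proof (rule integral_dominated_convergence[where w = "\<lambda>x. \<bar>G x\<bar> * (B * (2 * \<bar>R\<bar>)) + \<bar>F x\<bar> * B"])
    show "(\<lambda>x. G x * \<phi> x + F x * \<phi>' x) \<in> borel_measurable ?P" by measurable
    show "(\<lambda>x. G x * \<Phi> n x + F x * \<Psi> n x) \<in> borel_measurable ?P" for n
      unfolding KI[symmetric] by measurable
    show "integrable ?P (\<lambda>x. \<bar>G x\<bar> * (B * (2 * \<bar>R\<bar>)) + \<bar>F x\<bar> * B)" using G F by simp
    show "AE x in ?P. (\<lambda>n. G x * \<Phi> n x + F x * \<Psi> n x) \<longlonglongrightarrow> G x * \<phi> x + F x * \<phi>' x"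
      unfolding \<Phi>_def \<Psi>_def
      by (intro AE_I2 tendsto_add tendsto_mult_left ramp_superposition_tendsto(1)[OF \<phi> R B]
          ramp'_superposition_tendsto(1)[OF \<phi> B])
    have "\<bar>\<Phi> n x\<bar> \<le> B * (2 * \<bar>R\<bar>)" for n x
      unfolding \<Phi>_def by (rule ramp_superposition_tendsto(2)[OF \<phi> R B])
    moreover have "\<bar>\<Psi> n x\<bar> \<le> B" for n x
      unfolding \<Psi>_def by (rule ramp'_superposition_tendsto(2)[OF \<phi> B])
    ultimately have "\<bar>G x * \<Phi> n x + F x * \<Psi> n x\<bar> \<le> \<bar>G x\<bar> * (B * (2 * \<bar>R\<bar>)) + \<bar>F x\<bar> * B" for n x
      by (intro order_trans[OF abs_triangle_ineq]) (simp add: abs_mult add_mono mult_left_mono)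
    then show "AE x in ?P. norm (G x * \<Phi> n x + F x * \<Psi> n x) \<le> \<bar>G x\<bar> * (B * (2 * \<bar>R\<bar>)) + \<bar>F x\<bar> * B" for n
      by (intro AE_I2) (simp only: real_norm_def)
  qed
  then have "(\<integral>x. G x * \<phi> x + F x * \<phi>' x \<partial>?P) = 0" by (simp add: KI0 LIMSEQ_const_iff)
  then show ?thesis by (simp add: G_def F_def)
qed

section \<open>From balls to an arbitrary open set\<close>

lemma open_ball_cover:
  fixes V :: "l2 set"
  assumes "open V" "V \<noteq> {}"
  obtains c r where "\<And>k :: nat. 0 < r k" "\<And>k. ball (c k) (2 * r k) \<subseteq> V" "V = (\<Union>k. ball (c k) (r k))"
proof -
  \<comment> \<open>The doubled radius leaves the margin that \<open>bumps_C_F_0\<close> requires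
    around the support of a bump.\<close>
  define G where "G = {ball c r | c r. 0 < r \<and> ball c (2 * r) \<subseteq> V}"
  have "\<And>C. C \<in> G \<Longrightarrow> open C" by (auto simp: G_def)
  then obtain G' where G': "G' \<subseteq> G" "countable G'" "\<Union>G' = \<Union>G"
    using Lindelof[of G] by blast
  have UG: "\<Union>G = V"
  proof
    show "\<Union>G \<subseteq> V" by (fastforce simp: G_def subset_iff)
    show "V \<subseteq> \<Union>G"
    proof
      fix x assume "x \<in> V"
      then obtain e where "e > 0" "ball x e \<subseteq> V"
        using \<open>open V\<close> by (meson open_contains_ball)
      then show "x \<in> \<Union>G"
        by (intro UnionI[of "ball x (e / 2)"]) (auto simp: G_def intro!: exI[of _ x] exI[of _ "e / 2"])
    qed
  qed
  then have ne: "G' \<noteq> {}" using G'(3) assms(2) by auto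
  have "\<exists>c r. from_nat_into G' k = ball c r \<and> 0 < r \<and> ball c (2 * r) \<subseteq> V" for k
    using from_nat_into[OF ne, of k] G'(1) unfolding G_def by blast
  then obtain c r where cr: "\<And>k. from_nat_into G' k = ball (c k) (r k)" "\<And>k. 0 < r k"
      "\<And>k. ball (c k) (2 * r k) \<subseteq> V" by metis
  have "V = (\<Union>k. from_nat_into G' k)"
    using UG G' range_from_nat_into[OF ne G'(2)] by auto
  then show ?thesis using cr that[of r c] by simp
qed

lemma line_C1_measurable:
  assumes "line_C1 i \<phi> \<phi>'"
  shows "\<phi> \<in> borel_measurable borel" "\<phi>' \<in> borel_measurable borel"
  using assms by (simp_all add: line_C1_def)

lemma line_C1I:
  assumes "\<phi> \<in> borel_measurable borel" "\<phi>' \<in> borel_measurable borel"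
    and "\<And>x. \<bar>\<phi> x\<bar> \<le> B" "\<And>x. \<bar>\<phi>' x\<bar> \<le> B"
    and "\<And>x. \<phi> x \<noteq> 0 \<or> \<phi>' x \<noteq> 0 \<Longrightarrow> \<bar>coord x i\<bar> \<le> R"
    and "\<And>x. has_partial i \<phi> x (\<phi>' x)"
    and "\<And>x. isCont (\<lambda>t. \<phi>' (line x i t)) 0"
  shows "line_C1 i \<phi> \<phi>'"
proof -
  have "\<exists>B. \<forall>x. \<bar>\<phi> x\<bar> \<le> B \<and> \<bar>\<phi>' x\<bar> \<le> B"
    and "\<exists>R. \<forall>x. \<phi> x \<noteq> 0 \<or> \<phi>' x \<noteq> 0 \<longrightarrow> \<bar>coord x i\<bar> \<le> R"
    using assms(3-5) by blast+
  then show ?thesis unfolding line_C1_def using assms(1,2,6,7) by (simp only: simp_thms)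
qed

lemma line_C1_zero_nhd:
  assumes \<phi>: "line_C1 i \<phi> \<phi>'" and z: "\<forall>\<^sub>F t in nhds 0. \<phi> (line x i t) = 0"
  shows "\<forall>\<^sub>F t in nhds 0. \<phi> (line x i t) = 0 \<and> \<phi>' (line x i t) = 0"
proof -
  have "\<forall>\<^sub>F t in nhds 0. \<forall>\<^sub>F s in nhds t. \<phi> (line x i s) = 0"
    using z by (simp add: eventually_eventually)
  then show ?thesis
  proof eventually_elim
    case (elim t)
    have "((\<lambda>_. 0 :: real) has_real_derivative \<phi>' (line x i t)) (at t)"
      using line_C1_deriv(1)[OF \<phi>, of x t] elim
      by (subst DERIV_cong_ev[symmetric]) (auto elim: eventually_mono)
    moreover have "((\<lambda>_. 0 :: real) has_real_derivative 0) (at t)" by simp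
    ultimately have "\<phi>' (line x i t) = 0" by (rule DERIV_unique)
    moreover have "\<phi> (line x i t) = 0" using elim by (rule eventually_nhds_x_imp_x)
    ultimately show ?case by simp
  qed
qed

text \<open>Where \<open>S\<close> is small, \<open>\<phi>\<close> vanishes along the line nearby, so the value 0 of the quotients where
  \<open>S x = 0\<close> does no harm.\<close>

lemma line_C1_divide:
  assumes \<phi>: "line_C1 i \<phi> \<phi>'" and S: "S \<in> borel_measurable borel" "S' \<in> borel_measurable borel"
    and S_bdd: "\<And>x. \<bar>S x\<bar> \<le> C" "\<And>x. \<bar>S' x\<bar> \<le> C"
    and S_deriv: "\<And>x. has_partial i S x (S' x)"
    and S'_cont: "\<And>x. isCont (\<lambda>t. S' (line x i t)) 0"
    and A: "A \<in> sets borel" "\<And>x t. line x i t \<in> A \<longleftrightarrow> x \<in> A"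
    and \<epsilon>: "\<epsilon> > 0" "\<And>x. x \<in> A \<Longrightarrow> \<phi> x \<noteq> 0 \<Longrightarrow> \<epsilon> \<le> S x"
  shows "line_C1 i (\<lambda>x. indicator A x * (\<phi> x / S x))
      (\<lambda>x. indicator A x * ((\<phi>' x * S x - \<phi> x * S' x) / (S x)\<^sup>2))" (is "line_C1 i ?\<psi> ?\<psi>'")
    and "x \<in> A \<Longrightarrow> S x < \<epsilon> \<Longrightarrow> \<phi> x = 0 \<and> \<phi>' x = 0"
proof -
  note [measurable] = S A(1) line_C1_measurable[OF \<phi>]
  obtain B where B: "\<And>x. \<bar>\<phi> x\<bar> \<le> B" "\<And>x. \<bar>\<phi>' x\<bar> \<le> B" using \<phi> unfolding line_C1_def by blast
  obtain R where R: "\<And>x. \<phi> x \<noteq> 0 \<or> \<phi>' x \<noteq> 0 \<Longrightarrow> \<bar>coord x i\<bar> \<le> R"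
    using \<phi> unfolding line_C1_def by blast
  \<comment> \<open>\<open>S\<close> is continuous along the line and the line stays in
    \<open>A\<close>, so \<open>S\<close> is below \<epsilon> near \<open>x\<close>, where the lower
    bound on \<open>S\<close> forces \<phi> to vanish.\<close>
  have nhd: "\<forall>\<^sub>F t in nhds 0. \<phi> (line x i t) = 0 \<and> \<phi>' (line x i t) = 0"
    if x: "x \<in> A" "S x < \<epsilon>" for x
  proof (rule line_C1_zero_nhd[OF \<phi>])
    have "isCont (\<lambda>t. S (line x i t)) 0" using S_deriv by (rule DERIV_isCont)
    then have "((\<lambda>t. S (line x i t)) \<longlongrightarrow> S x) (nhds 0)"
      using tendsto_at_iff_tendsto_nhds[of "\<lambda>t. S (line x i t)" 0] by (simp add: isCont_def)
    then have "\<forall>\<^sub>F t in nhds 0. S (line x i t) < \<epsilon>" using x(2) by (rule order_tendstoD)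
    then show "\<forall>\<^sub>F t in nhds 0. \<phi> (line x i t) = 0"
      by eventually_elim (metis A(2) \<epsilon>(2) x(1) not_le)
  qed
  have zero: "\<phi> x = 0 \<and> \<phi>' x = 0" if "x \<in> A" "S x < \<epsilon>" for x
    using eventually_nhds_x_imp_x[OF nhd[OF that]] by simp
  then show "x \<in> A \<Longrightarrow> S x < \<epsilon> \<Longrightarrow> \<phi> x = 0 \<and> \<phi>' x = 0" .
  have "B \<ge> 0" using B(1)[of undefined] by linarith
  have "C \<ge> 0" using S_bdd(1)[of undefined] by linarith
  have bdd: "\<bar>?\<psi> x\<bar> \<le> B / \<epsilon> + (B * C + B * C) / \<epsilon>\<^sup>2 \<and> \<bar>?\<psi>' x\<bar> \<le> B / \<epsilon> + (B * C + B * C) / \<epsilon>\<^sup>2" for x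
  proof (cases "x \<in> A \<and> \<epsilon> \<le> S x")
    case True
    have 1: "\<bar>\<phi> x / S x\<bar> \<le> B / \<epsilon>"
      unfolding abs_divide using B(1)[of x] True \<epsilon>(1) \<open>B \<ge> 0\<close> by (intro frac_le) auto
    have "\<bar>\<phi>' x * S x - \<phi> x * S' x\<bar> \<le> B * C + B * C"
      by (rule order_trans[OF abs_triangle_ineq4], unfold abs_mult)
         (intro add_mono mult_mono B S_bdd \<open>B \<ge> 0\<close>, auto)
    then have 2: "\<bar>(\<phi>' x * S x - \<phi> x * S' x) / (S x)\<^sup>2\<bar> \<le> (B * C + B * C) / \<epsilon>\<^sup>2"
      unfolding abs_divide using True \<epsilon>(1) \<open>B \<ge> 0\<close> \<open>C \<ge> 0\<close> by (intro frac_le) (auto intro: power_mono)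
    show ?thesis using True 1 2 \<epsilon>(1) \<open>B \<ge> 0\<close> \<open>C \<ge> 0\<close> by (auto intro: add_increasing add_increasing2)
  next
    case False
    then have "?\<psi> x = 0" "?\<psi>' x = 0" using zero[of x] by (auto simp: indicator_def)
    moreover have "0 \<le> B / \<epsilon> + (B * C + B * C) / \<epsilon>\<^sup>2" using \<epsilon>(1) \<open>B \<ge> 0\<close> \<open>C \<ge> 0\<close> by simp
    ultimately show ?thesis by (simp only: abs_zero simp_thms)
  qed
  have "has_partial i ?\<psi> x (?\<psi>' x) \<and>
      isCont (\<lambda>t. ?\<psi>' (line x i t)) 0" for x
  proof (cases "x \<in> A \<and> \<epsilon> \<le> S x")
    case True
    then have ne: "S (line x i 0) \<noteq> 0" using \<epsilon>(1) by auto
    have \<phi>d: "has_partial i \<phi> x (\<phi>' x)"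
      "isCont (\<lambda>t. \<phi>' (line x i t)) 0"
      using line_C1_deriv[OF \<phi>, where x = x and t = 0] by simp_all
    have "((\<lambda>t. \<phi> (line x i t) / S (line x i t)) has_real_derivative
        (\<phi>' x * S x - \<phi> x * S' x) / (S x)\<^sup>2) (at 0)"
      using DERIV_divide[OF \<phi>d(1) S_deriv[of x] ne] by (simp add: power2_eq_square)
    moreover have "isCont (\<lambda>t. (\<phi>' (line x i t) * S (line x i t) -
        \<phi> (line x i t) * S' (line x i t)) / (S (line x i t))\<^sup>2) 0"
      by (rule isCont_divide[OF isCont_diff[OF isCont_mult[OF \<phi>d(2) DERIV_isCont[OF S_deriv[of x]]]
            isCont_mult[OF DERIV_isCont[OF \<phi>d(1)] S'_cont[of x]]]
          isCont_power[OF DERIV_isCont[OF S_deriv[of x]]]]) (use ne in simp)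
    ultimately show ?thesis using True by (simp add: A(2))
  next
    case False
    have "\<forall>\<^sub>F t in nhds 0. ?\<psi> (line x i t) = 0 \<and> ?\<psi>' (line x i t) = 0"
    proof (cases "x \<in> A")
      case True
      then have "S x < \<epsilon>" using False by auto
      from nhd[OF True this] show ?thesis by (rule eventually_mono) simp
    qed (simp add: A(2))
    then have ev: "\<forall>\<^sub>F t in nhds 0. ?\<psi> (line x i t) = 0" "\<forall>\<^sub>F t in nhds 0. ?\<psi>' (line x i t) = 0"
      by (auto elim: eventually_mono)
    have z: "?\<psi>' x = 0" using eventually_nhds_x_imp_x[OF ev(2)] by simp
    have "has_partial i ?\<psi> x (?\<psi>' x)"
      unfolding z by (subst DERIV_cong_ev[OF refl ev(1) refl]) simp
    moreover have "isCont (\<lambda>t. ?\<psi>' (line x i t)) 0"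
      by (subst isCont_cong[OF ev(2)]) simp
    ultimately show ?thesis ..
  qed
  moreover have "\<bar>coord x i\<bar> \<le> R" if "?\<psi> x \<noteq> 0 \<or> ?\<psi>' x \<noteq> 0" for x
    by (rule R) (use that in auto)
  moreover have "?\<psi> \<in> borel_measurable borel" "?\<psi>' \<in> borel_measurable borel" by measurable
  ultimately show "line_C1 i ?\<psi> ?\<psi>'"
    by (intro line_C1I[OF _ _ conjunct1[OF bdd] conjunct2[OF bdd]]) simp_all
qed

lemma integrable_line_C1:
  assumes V: "V \<in> sets borel" and P: "prob_space (gauss_l2 a)" and f: "f \<in> L2_on a V"
    and \<phi>: "line_C1 i \<phi> \<phi>'"
  shows "integrable (gauss_l2 a) (\<lambda>x. indicator V x * f x * \<phi> x)"
    and "integrable (gauss_l2 a) (\<lambda>x. indicator V x * f x * (- \<phi>' x + coord x i / (a i)\<^sup>2 * \<phi> x))"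
proof -
  note [measurable] = line_C1_measurable[OF \<phi>]
  obtain B where B: "\<And>x. \<bar>\<phi> x\<bar> \<le> B" "\<And>x. \<bar>\<phi>' x\<bar> \<le> B" using \<phi> unfolding line_C1_def by blast
  obtain R where R: "\<And>x. \<phi> x \<noteq> 0 \<or> \<phi>' x \<noteq> 0 \<Longrightarrow> \<bar>coord x i\<bar> \<le> R"
    using \<phi> unfolding line_C1_def by blast
  have "B \<ge> 0" using B(1)[of undefined] by linarith
  show "integrable (gauss_l2 a) (\<lambda>x. indicator V x * f x * \<phi> x)"
    by (rule integrable_mult_bounded[OF L2_onD(3)[OF V P f] _ B(1)]) measurable
  show "integrable (gauss_l2 a) (\<lambda>x. indicator V x * f x * (- \<phi>' x + coord x i / (a i)\<^sup>2 * \<phi> x))"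
  proof (rule integrable_mult_bounded[OF L2_onD(3)[OF V P f]])
    show "\<bar>- \<phi>' x + coord x i / (a i)\<^sup>2 * \<phi> x\<bar> \<le> B + \<bar>R\<bar> / (a i)\<^sup>2 * B" for x
    proof -
      have "\<bar>coord x i / (a i)\<^sup>2 * \<phi> x\<bar> \<le> \<bar>R\<bar> / (a i)\<^sup>2 * B"
      proof (cases "\<phi> x = 0")
        case False
        then show ?thesis using R[of x] B(1)[of x] \<open>B \<ge> 0\<close>
          unfolding abs_mult abs_divide by (intro mult_mono) (auto intro!: divide_right_mono)
      qed (use \<open>B \<ge> 0\<close> in auto)
      then show ?thesis using B(2)[of x] by linarith
    qed
  qed measurable
qed

text \<open>A partition of unity with finitely many terms: \<phi> is the sum over
  \<open>k < K\<close> of \<open>\<beta> k\<close> times \<open>\<phi> / S K\<close>, wherever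
  \<open>S K\<close> is bounded below on the set where \<phi> is not 0. No \<open>K\<close> need
  serve all lines, so the identity is first proved with the indicator of the set \<open>A K\<close>
  of lines for which \<open>K\<close> serves; every line lies in \<open>A K\<close> for large
  \<open>K\<close>.\<close>

lemma weak_partial_line_C1:
  assumes oV: "open V" and P: "prob_space (gauss_l2 a)" and w: "has_weak_partial a V i f q"
    and \<phi>: "line_C1 i \<phi> \<phi>'" and \<rho>: "\<rho> > 0" "\<And>x. \<phi> x \<noteq> 0 \<Longrightarrow> ball x \<rho> \<subseteq> V"
  shows "(LINT x:V|gauss_l2 a. q x * \<phi> x) =
    (LINT x:V|gauss_l2 a. f x * (- \<phi>' x + coord x i / (a i)\<^sup>2 * \<phi> x))"
proof (cases "V = {}")
  case False
  let ?P = "gauss_l2 a"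
  interpret P: prob_space ?P by fact
  have V [measurable]: "V \<in> sets borel" using oV by simp
  have fq: "f \<in> L2_on a V" "q \<in> L2_on a V" using w by (auto simp: has_weak_partial_def)
  note [measurable] = line_C1_measurable[OF \<phi>] L2_onD(1)[OF V P fq(1)] L2_onD(1)[OF V P fq(2)]
  obtain R where R: "\<And>x. \<phi> x \<noteq> 0 \<or> \<phi>' x \<noteq> 0 \<Longrightarrow> \<bar>coord x i\<bar> \<le> R"
    using \<phi> unfolding line_C1_def by blast
  obtain c r where cr: "\<And>k :: nat. 0 < r k" "\<And>k. ball (c k) (2 * r k) \<subseteq> V" "V = (\<Union>k. ball (c k) (r k))"
    using open_ball_cover[OF oV False] by metis
  define \<beta> where "\<beta> = (\<lambda>k. radial (c k) (r k))"
  have r0: "0 \<le> r k" "r k < 2 * r k" for k using cr(1)[of k] by auto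
  have \<beta>: "\<beta> k \<in> bumps (c k) (r k)" and \<beta>_nn: "0 \<le> \<beta> k x"
    and \<beta>_pos: "x \<in> ball (c k) (r k) \<Longrightarrow> 0 < \<beta> k x" for k x
    unfolding \<beta>_def by (auto intro: radial_bumps radial_nonneg radial_pos)
  note [measurable] = bumps_borel[OF \<beta>] bumps_borel[OF bumps_has_partial(2)[OF \<beta> r0(1)]]
  define S where "S = (\<lambda>K x. \<Sum>k<K. \<beta> k x)"
  define S' where "S' = (\<lambda>K x. \<Sum>k<K. partial i (\<beta> k) x)"
  have [measurable]: "S K \<in> borel_measurable borel" "S' K \<in> borel_measurable borel" for K
    unfolding S_def S'_def by measurable
  have S_cont: "continuous_on UNIV (S K)" "continuous_on UNIV (S' K)" for K
    unfolding S_def S'_def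
    by (intro continuous_on_sum bumps_continuous[OF \<beta>] bumps_continuous[OF bumps_has_partial(2)[OF \<beta> r0(1)]])+
  have shift_cont: "continuous_on UNIV (\<lambda>t. line x i t)" for x by (intro continuous_intros)
  have lS_cont: "continuous_on UNIV (\<lambda>t. S K (line x i t))" for K x
    by (rule continuous_on_compose2[OF S_cont(1) shift_cont]) auto
  have S'_cont: "isCont (\<lambda>t. S' K (line x i t)) 0" for K x
    using continuous_on_compose2[OF S_cont(2) shift_cont, of x] by (simp add: continuous_on_eq_continuous_at)
  have S_deriv: "((\<lambda>t. S K (line x i t)) has_real_derivative S' K x) (at 0)" for K x
    unfolding S_def S'_def by (intro DERIV_sum bumps_has_partial(1)[OF \<beta> r0(1)])
  have S_bdd: "\<exists>C. \<forall>x. \<bar>S K x\<bar> \<le> C \<and> \<bar>S' K x\<bar> \<le> C" for K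
  proof -
    obtain C C' where C: "\<And>k x. \<bar>\<beta> k x\<bar> \<le> C k" "\<And>k x. \<bar>partial i (\<beta> k) x\<bar> \<le> C' k"
      using bumps_bounded[OF \<beta> r0(1)] bumps_bounded[OF bumps_has_partial(2)[OF \<beta> r0(1)] r0(1)] by metis
    have "\<bar>S K x\<bar> \<le> (\<Sum>k<K. C k)" "\<bar>S' K x\<bar> \<le> (\<Sum>k<K. C' k)" for x
      unfolding S_def S'_def by (intro order_trans[OF sum_abs] sum_mono C)+
    then show ?thesis by (meson max.coboundedI1 max.coboundedI2)
  qed
  have S_mono: "S K x \<le> S L x" if "K \<le> L" for K L x
    unfolding S_def using that by (intro sum_mono2) (auto simp: \<beta>_nn)
  define \<epsilon> where "\<epsilon> = (\<lambda>K. 1 / real (Suc K))"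
  have \<epsilon>: "\<epsilon> K > 0" for K by (simp add: \<epsilon>_def)
  have \<epsilon>_mono: "\<epsilon> L \<le> \<epsilon> K" if "K \<le> L" for K L using that by (simp add: \<epsilon>_def frac_le)
  let ?l = "\<lambda>x t. line (drop_coord i x) i t"
  \<comment> \<open>Rational parameters make \<open>A K\<close> a countable intersection of Borel
    sets; continuity along the line recovers the remaining parameters in \<open>A_bound\<close>. The
    use of \<open>drop_coord\<close> makes the set invariant under shifts in direction
    \<open>i\<close>.\<close>
  define A where "A = (\<lambda>K. {x. \<forall>t\<in>\<rat>. \<phi> (?l x t) \<noteq> 0 \<longrightarrow> \<epsilon> K \<le> S K (?l x t)})"
  have A [measurable]: "A K \<in> sets borel" for K
  proof -
    have [measurable]: "(\<lambda>x. ?l x t) \<in> borel_measurable borel" for t by measurable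
    have "A K = (\<Inter>t\<in>\<rat>. {x. \<phi> (?l x t) \<noteq> 0 \<longrightarrow> \<epsilon> K \<le> S K (?l x t)})" unfolding A_def by auto
    also have "\<dots> \<in> sets borel" by (rule sets.countable_INT'') (use countable_rat in auto)
    finally show ?thesis .
  qed
  have A_shift: "line x i t \<in> A K \<longleftrightarrow> x \<in> A K" for x t K
    by (simp add: A_def drop_coord_shift)
  have l\<phi>_cont: "continuous_on UNIV (\<lambda>t. \<phi> (line x i t))" for x
    using line_C1_deriv(1)[OF \<phi>] by (intro continuous_at_imp_continuous_on) (blast intro: DERIV_isCont)
  have A_bound: "\<epsilon> K \<le> S K x" if x: "x \<in> A K" "\<phi> x \<noteq> 0" for K x
  proof (rule ccontr)
    assume "\<not> \<epsilon> K \<le> S K x"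
    let ?U = "{t. \<phi> (?l x t) \<noteq> 0} \<inter> {t. S K (?l x t) < \<epsilon> K}"
    have "open ?U"
      by (intro open_Int open_Collect_less open_Collect_neq l\<phi>_cont lS_cont continuous_intros)
    moreover have "coord x i \<in> ?U" using x(2) \<open>\<not> \<epsilon> K \<le> S K x\<close> by (simp add: drop_coord_restore)
    ultimately obtain d where "d > 0" "ball (coord x i) d \<subseteq> ?U" by (meson open_contains_ball)
    moreover obtain t where "t \<in> \<rat>" "coord x i < t" "t < coord x i + d"
      using Rats_dense_in_real[of "coord x i" "coord x i + d"] \<open>d > 0\<close> by auto
    ultimately have "t \<in> ?U" by (auto simp: dist_real_def subset_iff)
    then show False using x(1) \<open>t \<in> \<rat>\<close> by (auto simp: A_def)
  qed
  have A_ev: "\<forall>\<^sub>F K in sequentially. x \<in> A K" for x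
  proof -
    define C where "C = closure {t. \<phi> (?l x t) \<noteq> 0}"
    have "{t. \<phi> (?l x t) \<noteq> 0} \<subseteq> {-\<bar>R\<bar>..\<bar>R\<bar>}"
    proof
      fix t assume "t \<in> {t. \<phi> (?l x t) \<noteq> 0}"
      then have "\<bar>coord (?l x t) i\<bar> \<le> R" by (intro R) auto
      then show "t \<in> {-\<bar>R\<bar>..\<bar>R\<bar>}" by (auto simp: coord_drop_coord coord_basis)
    qed
    then have "compact C"
      unfolding C_def compact_closure using bounded_closed_interval bounded_subset by blast
    let ?W = "\<lambda>K. {t. \<epsilon> K < S K (?l x t)}"
    \<comment> \<open>A parameter in the closure is at distance less than \<rho> from one where
      \<phi> is not 0, so its point still lies in \<open>V\<close> and in one of the balls. This is
      where the uniform distance to the complement enters.\<close>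
    have cov: "C \<subseteq> (\<Union>K\<in>UNIV. ?W K)"
    proof
      fix t assume "t \<in> C"
      then obtain t' where t': "\<phi> (?l x t') \<noteq> 0" "dist t' t < \<rho>"
        unfolding C_def closure_approachable using \<rho>(1) by blast
      have "?l x t' - ?l x t = (t' - t) *\<^sub>R basis i" by (simp add: scaleR_diff_left)
      then have "dist (?l x t') (?l x t) < \<rho>" using t'(2) by (simp add: dist_norm)
      then have "?l x t \<in> V" using \<rho>(2)[OF t'(1)] by auto
      then obtain k where k: "?l x t \<in> ball (c k) (r k)" using cr(3) by auto
      have s: "\<beta> k (?l x t) \<le> S (Suc k) (?l x t)"
        unfolding S_def by (simp add: \<beta>_nn sum_nonneg)
      obtain n where n: "\<epsilon> n < \<beta> k (?l x t)"
        using reals_Archimedean[OF \<beta>_pos[OF k]] by (auto simp: \<epsilon>_def inverse_eq_divide)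
      \<comment> \<open>\<open>S K\<close> sums over \<open>k < K\<close>, so \<open>Suc k\<close>
        is the first index that includes \<open>\<beta> k\<close>; the maximum with \<open>n\<close>
        also makes the threshold small enough.\<close>
      have "\<epsilon> (max n (Suc k)) < S (max n (Suc k)) (?l x t)"
        using \<epsilon>_mono[of n "max n (Suc k)"] S_mono[of "Suc k" "max n (Suc k)" "?l x t"] n s by linarith
      then show "t \<in> (\<Union>K\<in>UNIV. ?W K)" by blast
    qed
    have op: "open (?W K)" for K
      by (intro open_Collect_less lS_cont continuous_intros)
    obtain F where F: "finite F" "C \<subseteq> (\<Union>K\<in>F. ?W K)"
      by (rule compactE_image[OF \<open>compact C\<close> op cov])
    have "x \<in> A L" if "L \<ge> Max (insert 0 F)" for L
      unfolding A_def
    proof (intro CollectI ballI impI)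
      fix t assume "\<phi> (?l x t) \<noteq> 0"
      then have "t \<in> C" unfolding C_def by (intro subsetD[OF closure_subset] CollectI)
      then obtain K where K: "K \<in> F" "\<epsilon> K < S K (?l x t)" using F(2) by auto
      then have "K \<le> L" using that F(1) by auto
      then show "\<epsilon> L \<le> S L (?l x t)" using K(2) \<epsilon>_mono[of K L] S_mono[of K L "?l x t"] by linarith
    qed
    then show ?thesis unfolding eventually_sequentially by blast
  qed
  define W where "W = (\<lambda>x. indicator V x * q x * \<phi> x -
      indicator V x * f x * (- \<phi>' x + coord x i / (a i)\<^sup>2 * \<phi> x))"
  have W0: "(\<integral>x. indicator (A K) x * W x \<partial>?P) = 0" for K
  proof -
    obtain C where C: "\<And>x. \<bar>S K x\<bar> \<le> C" "\<And>x. \<bar>S' K x\<bar> \<le> C" using S_bdd by blast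
    define \<psi> where "\<psi> = (\<lambda>x. indicator (A K) x * (\<phi> x / S K x))"
    define \<psi>' where "\<psi>' = (\<lambda>x. indicator (A K) x * ((\<phi>' x * S K x - \<phi> x * S' K x) / (S K x)\<^sup>2))"
    have \<psi>: "line_C1 i \<psi> \<psi>'"
      unfolding \<psi>_def \<psi>'_def
      by (rule line_C1_divide(1)[where S = "S K" and S' = "S' K", OF \<phi> _ _ C S_deriv S'_cont A A_shift \<epsilon> A_bound]) measurable
    have zero: "\<phi> x = 0 \<and> \<phi>' x = 0" if "x \<in> A K" "S K x < \<epsilon> K" for x
      by (rule line_C1_divide(2)[where S = "S K" and S' = "S' K", OF \<phi> _ _ C S_deriv S'_cont A A_shift \<epsilon> A_bound that]) measurable
    obtain B' where B': "\<And>x. \<bar>\<psi> x\<bar> \<le> B'" "\<And>x. \<bar>\<psi>' x\<bar> \<le> B'" using \<psi> unfolding line_C1_def by blast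
    \<comment> \<open>The integrand for the product of \<open>\<beta> k\<close> and \<psi>. Summed
      over \<open>k < K\<close> it becomes the one for \<open>S K\<close> times \<psi>, which is
      \<phi> on \<open>A K\<close> and 0 elsewhere.\<close>
    define T where "T = (\<lambda>k x. (indicator V x * q x * \<beta> k x - indicator V x * f x * adj_partial a i (\<beta> k) x) * \<psi> x +
      indicator V x * f x * \<beta> k x * \<psi>' x)"
    have T0: "(\<integral>x. T k x \<partial>?P) = 0" for k
      unfolding T_def by (rule weak_partial_bumps_line[OF V P w \<beta> r0(1,2) cr(2) \<psi>])
    have Tint: "integrable ?P (T k)" for k
    proof -
      obtain Bb where Bb: "\<And>x. \<bar>\<beta> k x\<bar> \<le> Bb" using bumps_bounded[OF \<beta> r0(1)] by blast
      have f\<beta>: "integrable ?P (\<lambda>x. indicator V x * f x * \<beta> k x)"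
        by (rule integrable_mult_bounded[OF L2_onD(3)[OF V P fq(1)] _ Bb]) measurable
      have "\<psi> \<in> borel_measurable ?P" "\<psi>' \<in> borel_measurable ?P"
        using line_C1_measurable[OF \<psi>] by simp_all
      then show ?thesis
        unfolding T_def
        using integrable_mult_bounded[OF weak_partial_bumps(1)[OF V P w \<beta> r0(1,2) cr(2)] _ B'(1)]
          integrable_mult_bounded[OF f\<beta> _ B'(2)] by simp
    qed
    have "(\<Sum>k<K. T k x) = indicator (A K) x * W x" for x
    proof -
      have "(\<Sum>k<K. adj_partial a i (\<beta> k) x) = - S' K x + coord x i / (a i)\<^sup>2 * S K x"
        unfolding adj_partial_def S_def S'_def by (simp add: sum_subtractf sum_distrib_left)
      then have "(\<Sum>k<K. T k x) = (indicator V x * q x * S K x - indicator V x * f x *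
          (- S' K x + coord x i / (a i)\<^sup>2 * S K x)) * \<psi> x + indicator V x * f x * S K x * \<psi>' x"
        unfolding T_def S_def
        by (simp add: sum.distrib sum_subtractf sum_distrib_left[symmetric] sum_distrib_right[symmetric])
      also have "\<dots> = indicator (A K) x * W x"
      proof (cases "S K x < \<epsilon> K")
        case True
        then show ?thesis using zero[of x] by (cases "x \<in> A K") (auto simp: \<psi>_def \<psi>'_def W_def)
      next
        case False
        then have "S K x \<noteq> 0" using \<epsilon>[of K] by linarith
        then show ?thesis
          unfolding \<psi>_def \<psi>'_def W_def
          by (cases "x \<in> A K"; cases "x \<in> V") (auto simp: field_simps power2_eq_square)
      qed
      finally show ?thesis .
    qed
    then have "(\<integral>x. indicator (A K) x * W x \<partial>?P) = (\<integral>x. (\<Sum>k<K. T k x) \<partial>?P)" by simp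
    also have "\<dots> = 0" by (subst Bochner_Integration.integral_sum) (auto simp: Tint T0)
    finally show ?thesis .
  qed
  have [measurable]: "W \<in> borel_measurable borel" unfolding W_def by measurable
  have i1: "integrable ?P (\<lambda>x. indicator V x * q x * \<phi> x)"
    by (rule integrable_line_C1(1)[OF V P fq(2) \<phi>])
  have i2: "integrable ?P (\<lambda>x. indicator V x * f x * (- \<phi>' x + coord x i / (a i)\<^sup>2 * \<phi> x))"
    by (rule integrable_line_C1(2)[OF V P fq(1) \<phi>])
  have Wint: "integrable ?P W" unfolding W_def using i1 i2 by simp
  have "(\<lambda>K. \<integral>x. indicator (A K) x * W x \<partial>?P) \<longlonglongrightarrow> (\<integral>x. W x \<partial>?P)"
  proof (rule integral_dominated_convergence[where w = "\<lambda>x. \<bar>W x\<bar>"])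
    have "(\<lambda>K. indicator (A K) x * W x) \<longlonglongrightarrow> W x" for x
      by (rule tendsto_eventually, rule eventually_mono[OF A_ev[of x]]) simp
    then show "AE x in ?P. (\<lambda>K. indicator (A K) x * W x) \<longlonglongrightarrow> W x" by simp
    show "AE x in ?P. norm (indicator (A K) x * W x) \<le> \<bar>W x\<bar>" for K
      by (intro AE_I2) (simp add: indicator_def)
  qed (use Wint in auto)
  then have "(\<integral>x. W x \<partial>?P) = 0" by (simp add: W0 LIMSEQ_const_iff)
  then show ?thesis
    unfolding W_def Bochner_Integration.integral_diff[OF i1 i2]
    by (simp add: set_lebesgue_integral_def mult.assoc)
qed (simp add: set_lebesgue_integral_def)

text \<open>On each ball of a countable cover, \<open>(p - q) \<beta>\<close> annihilates all
  products of \<open>steep\<close> functions of the coordinates, hence all bounded Borel functions.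
  Its own sign among them gives integral 0 of the absolute value, and \<beta> is positive on the
  ball.\<close>

lemma weak_partial_unique:
  notes [simp del] = of_nat_Suc
  assumes oV: "open V" and P: "prob_space (gauss_l2 a)"
    and w: "has_weak_partial a V i f p" "has_weak_partial a V i f q"
  shows "AE x in gauss_l2 a. x \<in> V \<longrightarrow> p x = q x"
proof (cases "V = {}")
  case False
  let ?P = "gauss_l2 a"
  have V [measurable]: "V \<in> sets borel" using oV by simp
  have pq: "p \<in> L2_on a V" "q \<in> L2_on a V" using w by (auto simp: has_weak_partial_def)
  note [measurable] = L2_onD(1)[OF V P pq(1)] L2_onD(1)[OF V P pq(2)]
  obtain c r where cr: "\<And>k :: nat. 0 < r k" "\<And>k. ball (c k) (2 * r k) \<subseteq> V" "V = (\<Union>k. ball (c k) (r k))"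
    using open_ball_cover[OF oV False] by metis
  have "AE x in ?P. x \<in> ball (c k) (r k) \<longrightarrow> p x = q x" for k
  proof -
    define \<beta> where "\<beta> = radial (c k) (r k)"
    have r0: "0 \<le> r k" "r k < 2 * r k" using cr(1)[of k] by auto
    have \<beta>: "\<beta> \<in> bumps (c k) (r k)" and \<beta>_pos: "x \<in> ball (c k) (r k) \<Longrightarrow> 0 < \<beta> x" for x
      unfolding \<beta>_def by (auto intro: radial_bumps radial_pos)
    note [measurable] = bumps_borel[OF \<beta>]
    define G where "G = (\<lambda>x. indicator V x * p x * \<beta> x - indicator V x * q x * \<beta> x)"
    have int: "integrable ?P (\<lambda>x. indicator V x * g x * \<gamma> x)"
      if g: "g \<in> L2_on a V" and \<gamma>: "\<gamma> \<in> bumps (c k) (r k)" for g \<gamma>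
    proof -
      obtain Bb where "\<And>x. \<bar>\<gamma> x\<bar> \<le> Bb" using bumps_bounded[OF \<gamma> r0(1)] by blast
      then show ?thesis
        by (rule integrable_mult_bounded[OF L2_onD(3)[OF V P g], rotated]) (use bumps_borel[OF \<gamma>] in simp)
    qed
    have G: "integrable ?P G" unfolding G_def by (intro Bochner_Integration.integrable_diff int pq \<beta>)
    have [measurable]: "G \<in> borel_measurable borel" unfolding G_def by measurable
    have "(\<integral>x. G x * sgn (G x) \<partial>?P) = 0"
    proof (rule integral_mult_bounded_function_eq_0[OF sets_gauss_l2 G, of "\<lambda>x. x" UNIV _ 1])
      fix J :: "nat set" and \<alpha> :: "nat \<Rightarrow> real" assume J: "finite J"
      show "(\<integral>x. G x * (\<Prod>j\<in>J. indicator {\<alpha> j<..} (coord x j)) \<partial>?P) = 0"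
      proof (rule integral_mult_prod_indicator_eq_0[OF sets_gauss_l2 G J])
        fix n
        let ?\<theta> = "\<lambda>x. \<Prod>j\<in>J. steep n (coord x j - \<alpha> j)"
        have "smooth (\<lambda>t. steep n (t - \<alpha> j))" for j
          using smooth_comp_affine[OF smooth_ramp, of "real (Suc n)" "- (real (Suc n) * \<alpha> j)"]
          by (simp add: algebra_simps)
        then have b: "(\<lambda>x. ?\<theta> x * \<beta> x) \<in> bumps (c k) (r k)"
          by (intro bumps_mult_prod[where \<theta> = "\<lambda>j t. steep n (t - \<alpha> j)"] J \<beta>)
        then have "(\<lambda>x. ?\<theta> x * \<beta> x) \<in> C_F_0 V" by (rule bumps_C_F_0[OF _ r0 cr(2)])
        then have "(LINT x:V|?P. p x * (?\<theta> x * \<beta> x)) = (LINT x:V|?P. q x * (?\<theta> x * \<beta> x))"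
          using w unfolding has_weak_partial_def by simp
        then have "(\<integral>x. indicator V x * p x * (?\<theta> x * \<beta> x) - indicator V x * q x * (?\<theta> x * \<beta> x) \<partial>?P) = 0"
          by (subst Bochner_Integration.integral_diff[OF int[OF pq(1) b] int[OF pq(2) b]])
             (simp add: set_lebesgue_integral_def mult.assoc)
        then show "(\<integral>x. G x * ?\<theta> x \<partial>?P) = 0" unfolding G_def by (simp add: algebra_simps)
      qed
    qed (auto simp: abs_sgn_eq)
    then have "(\<integral>x. \<bar>G x\<bar> \<partial>?P) = 0" by (simp add: abs_sgn[symmetric])
    then have "AE x in ?P. \<bar>G x\<bar> = 0"
      using integral_nonneg_eq_0_iff_AE[of ?P "\<lambda>x. \<bar>G x\<bar>"] G by simp
    then show ?thesis
    proof eventually_elim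
      case (elim x)
      show ?case
      proof
        assume x: "x \<in> ball (c k) (r k)"
        then have "x \<in> V" using cr(3) by blast
        then show "p x = q x" using elim \<beta>_pos[OF x] by (simp add: G_def left_diff_distrib[symmetric])
      qed
    qed
  qed
  then have "AE x in ?P. \<forall>k. x \<in> ball (c k) (r k) \<longrightarrow> p x = q x"
    unfolding AE_all_countable by blast
  then show ?thesis
  proof eventually_elim
    case (elim x)
    then show ?case by (subst cr(3)) blast
  qed
qed simp

text \<open>By uniqueness almost everywhere the choice hidden in \<open>weak_partial\<close> is
  immaterial, and the norm may be computed with any weak derivative at hand.\<close>

lemma set_integral_weak_partial:
  assumes W: "open W" and P: "prob_space (gauss_l2 a)" and q: "has_weak_partial a W i f q"
  shows "(LINT x:W|gauss_l2 a. (weak_partial a W i f x)\<^sup>2) = (LINT x:W|gauss_l2 a. (q x)\<^sup>2)"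
proof -
  have w: "has_weak_partial a W i f (weak_partial a W i f)"
    unfolding weak_partial_def by (rule someI[of _ q]) (rule q)
  have "AE x in gauss_l2 a. x \<in> W \<longrightarrow> weak_partial a W i f x = q x"
    by (rule weak_partial_unique[OF W P w q])
  moreover have m: "(\<lambda>x. indicator W x *\<^sub>R (u x)\<^sup>2) \<in> borel_measurable (gauss_l2 a)" if "u \<in> L2_on a W" for u
    using that by (auto simp: L2_on_def set_integrable_def)
  ultimately show ?thesis
    using w q unfolding set_lebesgue_integral_def has_weak_partial_def
    by (intro integral_cong_AE m) (auto elim!: eventually_mono simp: indicator_def)
qed

section \<open>Change of variables in the first coordinate\<close>

lemma set_first_set_first [simp]: "set_first (set_first x t) s = set_first x s"
  and set_first_coord [simp]: "set_first x (coord x 0) = x"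
  and set_first_add_basis: "set_first x t + s *\<^sub>R basis 0 = set_first x (t + s)"
  by (rule l2_eqI; simp add: coord_set_first coord_basis)+

lemma borel_measurable_set_first [measurable (raw)]:
  assumes [measurable]: "f \<in> borel_measurable M" "u \<in> borel_measurable M"
  shows "(\<lambda>x. set_first (f x) (u x)) \<in> borel_measurable M"
proof (rule measurable_l2I)
  fix i
  have [measurable]: "(\<lambda>x. coord (f x) i) \<in> borel_measurable M" by measurable
  show "(\<lambda>x. coord (set_first (f x) (u x)) i) \<in> borel_measurable M"
    by (cases "i = 0") (simp_all add: coord_set_first)
qed

text \<open>The square-summable sequences have full product measure, so restricting to them leaves
  the product formula intact.\<close>

lemma emeasure_gauss_l2_orthant:
  assumes a: "\<And>i. a i > 0" "summable a" and J: "finite J"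
  shows "emeasure (gauss_l2 a) {x. \<forall>j\<in>J. \<alpha> j < coord x j} =
    (\<Prod>j\<in>J. emeasure (density lborel (\<lambda>x. ennreal (normal_density 0 (a j) x))) {\<alpha> j<..})"
proof -
  define N where "N = (\<lambda>i. density lborel (\<lambda>x. ennreal (normal_density 0 (a i) x)))"
  interpret N: prob_space "N i" for i
    unfolding N_def by (rule prob_space_normal_density[OF a(1)])
  interpret product_prob_space N UNIV by unfold_locales
  have P: "gauss_prod a = PiM UNIV N" by (simp add: gauss_prod_def N_def)
  let ?B = "{y. \<forall>j\<in>J. y j \<in> {\<alpha> j<..}}"
  have B: "emeasure (gauss_prod a) ?B = (\<Prod>j\<in>J. emeasure (N j) {\<alpha> j<..})"
    using emeasure_PiM_Collect[of J "\<lambda>j. {\<alpha> j<..}"] J by (simp add: P space_PiM N_def)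
  have Bs: "?B \<in> sets (gauss_prod a)"
  proof -
    have "?B = {y \<in> space (gauss_prod a). \<forall>j\<in>J. y j \<in> {\<alpha> j<..}}" by simp
    also have "\<dots> \<in> sets (gauss_prod a)"
      using J by measurable
    finally show ?thesis .
  qed
  have 1: "emeasure (gauss_prod a) (range coord) = 1"
    using prob_space.emeasure_space_1[OF prob_space_gauss_l2[OF a]] emeasure_gauss_l2[of UNIV a] by simp
  have pP: "prob_space (gauss_prod a)"
    unfolding P by (rule prob_space_PiM) unfold_locales
  have "AE y in gauss_prod a. y \<in> range coord"
    using prob_space.AE_iff_emeasure_eq_1[OF pP, of "\<lambda>y. y \<in> range coord"] range_coord_sets[of a] 1
    by simp
  have "{x. \<forall>j\<in>J. \<alpha> j < coord x j} \<in> sets borel" using J by simp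
  then have "emeasure (gauss_l2 a) {x. \<forall>j\<in>J. \<alpha> j < coord x j} =
      emeasure (gauss_prod a) (coord ` {x. \<forall>j\<in>J. \<alpha> j < coord x j})"
    by (rule emeasure_gauss_l2)
  also have "coord ` {x. \<forall>j\<in>J. \<alpha> j < coord x j} = ?B \<inter> range coord" by auto
  also have "emeasure (gauss_prod a) (?B \<inter> range coord) = emeasure (gauss_prod a) ?B"
    using \<open>AE y in gauss_prod a. y \<in> range coord\<close> Bs range_coord_sets[of a]
    by (intro emeasure_eq_AE) (auto elim: eventually_mono)
  finally show ?thesis unfolding B N_def .
qed

text \<open>Replacing the first coordinate by an independent one of the same law preserves the
  measure, as a comparison on orthants shows. This separates the first coordinate without writing
  \<open>l2\<close> as a product space.\<close>

lemma nn_integral_gauss_l2_first: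
  assumes a: "\<And>i. a i > 0" "summable a" and F [measurable]: "F \<in> borel_measurable borel"
  shows "(\<integral>\<^sup>+x. F x \<partial>gauss_l2 a) =
    (\<integral>\<^sup>+x. (\<integral>\<^sup>+t. ennreal (normal_density 0 (a 0) t) * F (set_first x t) \<partial>lborel) \<partial>gauss_l2 a)"
proof -
  let ?P = "gauss_l2 a"
  define N where "N = (\<lambda>i. density lborel (\<lambda>x. ennreal (normal_density 0 (a i) x)))"
  have prob: "prob_space (N i)" for i unfolding N_def by (rule prob_space_normal_density[OF a(1)])
  interpret N: prob_space "N 0" by (rule prob)
  interpret P: prob_space ?P by (rule prob_space_gauss_l2[OF a])
  interpret NP: pair_prob_space ?P "N 0" ..
  let ?D = "distr (?P \<Otimes>\<^sub>M N 0) borel (\<lambda>(x, t). set_first x t)"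
  have [measurable_cong]: "sets (N 0) = sets borel" by (simp add: N_def)
  have sf: "(\<lambda>(x, t). set_first x t) \<in> borel_measurable (?P \<Otimes>\<^sub>M N 0)" by measurable
  have eq: "?D = ?P"
  proof (rule measure_eqI_generator_eq[OF Int_stable_orthants])
    fix X assume "X \<in> orthants"
    then obtain J \<alpha> where J: "finite J" "X = {x. \<forall>j\<in>J. \<alpha> j < coord x j}"
      unfolding orthants_def by blast
    then have X: "X \<in> sets borel" by simp
    let ?X1 = "{x. \<forall>j\<in>J - {0}. \<alpha> j < coord x j}"
    let ?X0 = "if 0 \<in> J then {\<alpha> 0<..} else UNIV"
    have X1: "?X1 \<in> sets borel" using J(1) by simp
    have "(\<lambda>(x, t). set_first x t) -` X \<inter> space (?P \<Otimes>\<^sub>M N 0) = ?X1 \<times> ?X0"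
      unfolding J(2) by (auto simp: coord_set_first space_pair_measure N_def split: if_splits)
    then have "emeasure (?D) X =
        emeasure ?P ?X1 * emeasure (N 0) ?X0"
      using X X1 by (subst emeasure_distr[OF sf]) (simp_all add: N.emeasure_pair_measure_Times)
    also have "\<dots> = (\<Prod>j\<in>J. emeasure (N j) {\<alpha> j<..})"
    proof -
      have 1: "emeasure ?P ?X1 = (\<Prod>j\<in>J - {0}. emeasure (N j) {\<alpha> j<..})"
        unfolding N_def by (rule emeasure_gauss_l2_orthant[OF a]) (use J(1) in simp)
      show ?thesis
      proof (cases "0 \<in> J")
        case True
        then show ?thesis unfolding 1 by (simp add: prod.remove[OF J(1) True] mult.commute)
      next
        case False
        then have "J - {0} = J" by auto
        moreover have "emeasure (N 0) UNIV = 1" using N.emeasure_space_1 by (simp add: N_def)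
        ultimately show ?thesis unfolding 1 using False by simp
      qed
    qed
    also have "\<dots> = emeasure ?P X"
      unfolding J(2) N_def by (rule emeasure_gauss_l2_orthant[OF a J(1), symmetric])
    finally show "emeasure (?D) X = emeasure ?P X" .
  next
    have "UNIV \<in> orthants" unfolding orthants_def by (rule CollectI, rule exI[of _ "{}"]) simp
    then show "range (\<lambda>_ :: nat. UNIV) \<subseteq> orthants" by simp
    show "emeasure (?D) UNIV \<noteq> \<infinity>" for i :: nat
      using NP.emeasure_space_1 by (simp add: emeasure_distr[OF sf])
  qed (auto simp: borel_eq_sigma_orthants)
  have "(\<integral>\<^sup>+x. F x \<partial>?P) = (\<integral>\<^sup>+z. F (case z of (x, t) \<Rightarrow> set_first x t) \<partial>(?P \<Otimes>\<^sub>M N 0))"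
    by (subst eq[symmetric], rule nn_integral_distr[OF sf]) simp
  also have "\<dots> = (\<integral>\<^sup>+x. (\<integral>\<^sup>+t. F (set_first x t) \<partial>N 0) \<partial>?P)"
    by (subst N.nn_integral_fst[symmetric]) (auto simp: case_prod_beta)
  also have "\<dots> = (\<integral>\<^sup>+x. (\<integral>\<^sup>+t. ennreal (normal_density 0 (a 0) t) * F (set_first x t) \<partial>lborel) \<partial>?P)"
    unfolding N_def by (intro nn_integral_cong nn_integral_density) auto
  finally show ?thesis .
qed

text \<open>\<open>S\<close> will be the slice of an open set by a line. Within the locale below
  nothing says that it is an interval, so the substitution is made for an injective map on a Borel
  set.\<close>

lemma nn_integral_substitution_inj:
  fixes F \<gamma> :: "real \<Rightarrow> real"
  assumes S: "S \<in> sets borel" "\<gamma> ` S \<in> sets borel"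
    and \<gamma>: "\<And>t. t \<in> S \<Longrightarrow> (\<gamma> has_real_derivative \<gamma>' t) (at t)" "\<And>t. t \<in> S \<Longrightarrow> 0 \<le> \<gamma>' t" "inj_on \<gamma> S"
    and F: "integrable lborel F" "\<And>t. 0 \<le> F t"
  shows "(\<integral>\<^sup>+s. indicator (\<gamma> ` S) s * ennreal (F s) \<partial>lborel) =
    (\<integral>\<^sup>+t. indicator S t * ennreal (\<gamma>' t * F (\<gamma> t)) \<partial>lborel)"
proof -
  have F1: "F absolutely_integrable_on (\<gamma> ` S)"
    unfolding absolutely_integrable_on_def set_integrable_def
  proof (subst integrable_completion)
    show "(\<lambda>x. indicator (\<gamma> ` S) x *\<^sub>R F x) \<in> lborel \<rightarrow>\<^sub>M borel" using S(2) F(1) by simp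
    show "integrable lborel (\<lambda>x. indicator (\<gamma> ` S) x *\<^sub>R F x)"
      using S(2) F(1) by (intro integrable_mult_indicator) auto
  qed
  let ?b = "integral (\<gamma> ` S) F"
  have "(\<lambda>x. \<bar>\<gamma>' x\<bar> * F (\<gamma> x)) absolutely_integrable_on S \<and>
      integral S (\<lambda>x. \<bar>\<gamma>' x\<bar> * F (\<gamma> x)) = ?b"
    by (rule has_absolute_integral_change_of_variables_1'[THEN iffD2])
       (use S \<gamma> F1 in \<open>auto intro: has_field_derivative_at_within\<close>)
  then have 1: "((\<lambda>x. \<bar>\<gamma>' x\<bar> * F (\<gamma> x)) has_integral ?b) S"
    by (metis absolutely_integrable_on_def set_lebesgue_integral_eq_integral(1) integrable_integral)
  have 2: "(F has_integral ?b) (\<gamma> ` S)"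
    using F1 by (metis set_lebesgue_integral_eq_integral(1) integrable_integral absolutely_integrable_on_def)
  have "(\<integral>\<^sup>+s. indicator (\<gamma> ` S) s * ennreal (F s) \<partial>lborel) =
      (\<integral>\<^sup>+s. ennreal (indicator (\<gamma> ` S) s * F s) \<partial>lborel)"
    by (intro nn_integral_cong) (simp add: indicator_def)
  also have "\<dots> = ennreal ?b" by (rule nn_integral_has_integral_lebesgue[OF F(2) 2])
  also have "\<dots> = (\<integral>\<^sup>+t. ennreal (indicator S t * (\<bar>\<gamma>' t\<bar> * F (\<gamma> t))) \<partial>lborel)"
    by (rule nn_integral_has_integral_lebesgue[OF _ 1, symmetric]) (simp add: F(2))
  also have "\<dots> = (\<integral>\<^sup>+t. indicator S t * ennreal (\<gamma>' t * F (\<gamma> t)) \<partial>lborel)"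
    by (intro nn_integral_cong) (simp add: indicator_def \<gamma>(2))
  finally show ?thesis .
qed

section \<open>The setting shared by the flattening map and its inverse\<close>

lemma measurable_restrict_coord [measurable]: "(\<lambda>x. coord x i) \<in> borel_on W"
  by (intro measurable_restrict_space1) measurable

text \<open>The assumptions are those of the transport from \<open>V\<close> to \<open>V'\<close>,
  phrased so that they can be met again with (V, g) and (V', h) exchanged. The constant \<sigma> is
  kept apart from \<delta> because the sum over the partial derivatives has a different bound in the
  two directions.\<close>

locale flattening =
  fixes a :: "nat \<Rightarrow> real" and V V' :: "l2 set" and g h :: "l2 \<Rightarrow> real" and \<delta> \<sigma> :: real
  assumes a_pos: "\<And>i. a i > 0" and a_summable: "summable a"
    and open_V: "open V" and open_V': "open V'"
    and g: "g \<in> C_F_inf V" and h: "h \<in> C_F_inf V'"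
    and psi_in: "\<And>x. x \<in> V \<Longrightarrow> set_first x (g x) \<in> V'"
    and h_psi: "\<And>x. x \<in> V \<Longrightarrow> h (set_first x (g x)) = coord x 0"
    and tau_in: "\<And>y. y \<in> V' \<Longrightarrow> set_first y (h y) \<in> V"
    and g_tau: "\<And>y. y \<in> V' \<Longrightarrow> g (set_first y (h y)) = coord y 0"
    and \<delta>_pos: "\<delta> > 0"
    and first_bound: "\<And>x. x \<in> V \<Longrightarrow> \<bar>coord x 0\<bar> \<le> \<delta>" and g_bound: "\<And>x. x \<in> V \<Longrightarrow> \<bar>g x\<bar> \<le> \<delta>"
    and Dg_pos: "\<And>x. x \<in> V \<Longrightarrow> 0 < partial 0 g x" and Dg_le: "\<And>x. x \<in> V \<Longrightarrow> partial 0 g x \<le> \<delta>"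
    and Dh_sum: "\<And>y n. y \<in> V' \<Longrightarrow> (\<Sum>i<n. (a i)\<^sup>2 * (partial i h y)\<^sup>2) \<le> \<sigma>"
    and \<sigma>_nonneg: "0 \<le> \<sigma>"
    and tau_inside: "\<And>E. E \<Subset>\<^sub>o V' \<Longrightarrow> (\<lambda>y. set_first y (h y)) ` E \<Subset>\<^sub>o V"
begin

abbreviation P :: "l2 measure" where "P \<equiv> gauss_l2 a"

sublocale P: prob_space P
  by (rule prob_space_gauss_l2[OF a_pos a_summable])

definition psi :: "l2 \<Rightarrow> l2" where "psi x = set_first x (g x)"

definition tau :: "l2 \<Rightarrow> l2" where "tau y = set_first y (h y)"

lemma tau_psi: "x \<in> V \<Longrightarrow> tau (psi x) = x"
  and psi_tau: "y \<in> V' \<Longrightarrow> psi (tau y) = y"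
  using h_psi g_tau by (auto simp: psi_def tau_def)

lemma psi_V': "x \<in> V \<Longrightarrow> psi x \<in> V'" and tau_V: "y \<in> V' \<Longrightarrow> tau y \<in> V"
  using psi_in tau_in by (auto simp: psi_def tau_def)

lemma borel_V [measurable]: "V \<in> sets borel" and borel_V' [measurable]: "V' \<in> sets borel"
  using open_V open_V' by simp_all

text \<open>\<open>wgt\<close> is the Gaussian density at \<open>g x\<close> divided by the one at the first coordinate of \<open>x\<close>;
  \<open>jac\<close> is the density with respect to \<open>P\<close> of the pull-back of \<open>P\<close> under \<open>psi\<close>.\<close>

definition wgt :: "l2 \<Rightarrow> real" where
  "wgt x = exp (((coord x 0)\<^sup>2 - (g x)\<^sup>2) / (2 * (a 0)\<^sup>2))"

definition jac :: "l2 \<Rightarrow> real" where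
  "jac x = wgt x * partial 0 g x"

lemma measurable_psi [measurable]: "psi \<in> borel_on V"
  and measurable_wgt [measurable]: "wgt \<in> borel_on V"
  and measurable_jac [measurable]: "jac \<in> borel_on V"
proof -
  note [measurable] = C_F_infD(1)[OF g] C_F_infD(2)[OF g, of 0]
  have [measurable]: "(\<lambda>x. x) \<in> borel_on V"
    by (intro measurable_restrict_space1) simp
  show "psi \<in> borel_on V" unfolding psi_def[abs_def] by measurable
  show w [measurable]: "wgt \<in> borel_on V" unfolding wgt_def[abs_def] by measurable
  show "jac \<in> borel_on V" unfolding jac_def[abs_def] by measurable
qed

lemma measurable_tau [measurable]: "tau \<in> borel_on V'"
proof -
  note [measurable] = C_F_infD(1)[OF h]
  have [measurable]: "(\<lambda>x. x) \<in> borel_on V'"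
    by (intro measurable_restrict_space1) simp
  show ?thesis unfolding tau_def[abs_def] by measurable
qed

lemma jac_pos: "x \<in> V \<Longrightarrow> 0 < jac x"
  by (simp add: jac_def wgt_def Dg_pos)

lemma normal_density_wgt:
  "normal_density 0 (a 0) (g x) = normal_density 0 (a 0) (coord x 0) * wgt x"
  unfolding normal_density_def wgt_def
  by (simp add: exp_add[symmetric] diff_divide_distrib)

text \<open>On a line in the first direction \<open>psi\<close> is the one-dimensional map
  \<open>t \<mapsto> g (set_first x t)\<close>. After separating the first coordinate, the claim is
  the one-dimensional substitution on each line.\<close>

lemma emeasure_change_of_variables:
  assumes A [measurable]: "A \<in> sets borel"
  shows "emeasure P (V' \<inter> A) = (\<integral>\<^sup>+x. indicator V x * (indicator A (psi x) * ennreal (jac x)) \<partial>P)"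
proof -
  let ?n = "normal_density 0 (a 0)"
  define H where "H = (\<lambda>x. indicator V x * (indicator A (psi x) * ennreal (jac x)))"
  have H: "H \<in> borel_measurable borel"
  proof -
    have "(\<lambda>x. indicator A (psi x) * ennreal (jac x)) \<in> borel_on V"
      by measurable
    then show ?thesis
      unfolding H_def by (subst (asm) borel_measurable_restrict_space_iff_ennreal) (auto simp: mult.commute)
  qed
  have inner: "(\<integral>\<^sup>+s. ennreal (?n s) * indicator (V' \<inter> A) (set_first x s) \<partial>lborel) =
      (\<integral>\<^sup>+t. ennreal (?n t) * H (set_first x t) \<partial>lborel)" for x
  proof -
    define S where "S = {t. set_first x t \<in> V}"
    define \<gamma> where "\<gamma> = (\<lambda>t. g (set_first x t))"
    define \<gamma>' where "\<gamma>' = (\<lambda>t. partial 0 g (set_first x t))"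
    define F where "F = (\<lambda>s. ?n s * indicator A (set_first x s))"
    have op: "open {t. set_first x t \<in> W}" if "open W" for W
    proof -
      have "continuous_on UNIV (\<lambda>t. set_first x 0 + t *\<^sub>R basis 0)" by (intro continuous_intros)
      then have "continuous_on UNIV (\<lambda>t. set_first x t)" by (simp add: set_first_add_basis)
      from open_vimage[OF that this] show ?thesis by (simp add: vimage_def)
    qed
    have psi_x: "psi (set_first x t) = set_first x (\<gamma> t)" for t by (simp add: psi_def \<gamma>_def)
    \<comment> \<open>Slices correspond exactly because \<open>tau\<close> moves a point along the
      same line as \<open>psi\<close>.\<close>
    have im: "\<gamma> ` S = {s. set_first x s \<in> V'}"
    proof (intro set_eqI iffI)
      fix s assume "s \<in> \<gamma> ` S"
      then show "s \<in> {s. set_first x s \<in> V'}" by (auto simp: S_def psi_x[symmetric] intro: psi_V')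
    next
      fix s assume s: "s \<in> {s. set_first x s \<in> V'}"
      then have "s = \<gamma> (h (set_first x s))" "h (set_first x s) \<in> S"
        using g_tau[of "set_first x s"] tau_in[of "set_first x s"]
        by (auto simp: \<gamma>_def S_def coord_set_first)
      then show "s \<in> \<gamma> ` S" by blast
    qed
    have "inj_on \<gamma> S"
    proof (rule inj_on_inverseI)
      show "h (set_first x (\<gamma> t)) = t" if "t \<in> S" for t
        using h_psi[of "set_first x t"] that by (simp add: S_def \<gamma>_def coord_set_first)
    qed
    moreover have "(\<gamma> has_real_derivative \<gamma>' t) (at t)" if "t \<in> S" for t
    proof -
      have "((\<lambda>s. g (set_first x t + s *\<^sub>R basis 0)) has_real_derivative \<gamma>' t) (at 0)"
        unfolding \<gamma>'_def using that by (intro has_partial_atD C_F_infD(3)[OF g]) (simp add: S_def)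
      then have "((\<lambda>s. \<gamma> (s + t)) has_real_derivative \<gamma>' t) (at 0)"
        by (simp add: set_first_add_basis \<gamma>_def add.commute)
      then show ?thesis using DERIV_shift[of \<gamma> "\<gamma>' t" 0 t] by simp
    qed
    moreover have "0 \<le> \<gamma>' t" if "t \<in> S" for t
      using Dg_pos[of "set_first x t"] that by (simp add: \<gamma>'_def S_def)
    moreover have "integrable lborel F"
      unfolding F_def
    proof (rule integrable_mult_bounded[where B = 1])
      show "integrable lborel ?n" using a_pos[of 0] by (simp add: integrable_normal_density)
      show "(\<lambda>s. indicator A (set_first x s) :: real) \<in> borel_measurable lborel" by measurable
    qed (simp add: indicator_def)
    moreover have "0 \<le> F s" for s by (simp add: F_def)
    ultimately have "(\<integral>\<^sup>+s. indicator (\<gamma> ` S) s * ennreal (F s) \<partial>lborel) =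
        (\<integral>\<^sup>+t. indicator S t * ennreal (\<gamma>' t * F (\<gamma> t)) \<partial>lborel)"
      using op[OF open_V] op[OF open_V']
      by (intro nn_integral_substitution_inj) (auto simp: im S_def[symmetric])
    moreover have "indicator (\<gamma> ` S) s * ennreal (F s) =
        ennreal (?n s) * indicator (V' \<inter> A) (set_first x s)" for s
      unfolding im F_def by (auto simp: indicator_def)
    moreover have "indicator S t * ennreal (\<gamma>' t * F (\<gamma> t)) = ennreal (?n t) * H (set_first x t)" for t
    proof (cases "t \<in> S")
      case True
      then have "set_first x t \<in> V" by (simp add: S_def)
      moreover have "?n (\<gamma> t) = ?n t * wgt (set_first x t)"
        using normal_density_wgt[of "set_first x t"] by (simp add: \<gamma>_def coord_set_first)
      ultimately show ?thesis
        using True Dg_pos[of "set_first x t"]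
        by (auto simp: H_def F_def psi_x \<gamma>'_def jac_def indicator_def ennreal_mult[symmetric] wgt_def
            algebra_simps)
    next
      case False
      then show ?thesis by (auto simp: H_def S_def)
    qed
    ultimately show ?thesis by simp
  qed
  have "emeasure P (V' \<inter> A) = (\<integral>\<^sup>+x. indicator (V' \<inter> A) x \<partial>P)" by simp
  also have "\<dots> = (\<integral>\<^sup>+x. (\<integral>\<^sup>+s. ennreal (?n s) * indicator (V' \<inter> A) (set_first x s) \<partial>lborel) \<partial>P)"
    by (rule nn_integral_gauss_l2_first[OF a_pos a_summable]) simp
  also have "\<dots> = (\<integral>\<^sup>+x. (\<integral>\<^sup>+t. ennreal (?n t) * H (set_first x t) \<partial>lborel) \<partial>P)"
    by (simp only: inner)
  also have "\<dots> = (\<integral>\<^sup>+x. H x \<partial>P)"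
    by (rule nn_integral_gauss_l2_first[OF a_pos a_summable H, symmetric])
  finally show ?thesis by (simp add: H_def)
qed

lemma change_of_variables:
  assumes G: "(\<lambda>y. indicator V' y * G y) \<in> borel_measurable borel"
  shows "integrable P (\<lambda>y. indicator V' y * G y) \<longleftrightarrow> integrable P (\<lambda>x. indicator V x * (jac x * G (psi x)))"
    and "(\<integral>y. indicator V' y * G y \<partial>P) = (\<integral>x. indicator V x * (jac x * G (psi x)) \<partial>P)"
proof -
  let ?D' = "density P (\<lambda>y. ennreal (indicator V' y))"
  let ?D = "density P (\<lambda>x. ennreal (indicator V x * jac x))"
  let ?G = "\<lambda>y. indicator V' y * G y"
  \<comment> \<open>A Borel extension of \<open>psi\<close> to the whole space; its value off
    \<open>V\<close> is hidden by the density, which is 0 there.\<close>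
  define psi0 where "psi0 = (\<lambda>x. if x \<in> V then psi x else 0)"
  have psi0 [measurable]: "psi0 \<in> borel_measurable borel"
    unfolding psi0_def by (subst measurable_restrict_space_iff[symmetric]) auto
  have J [measurable]: "(\<lambda>x. indicator V x * jac x) \<in> borel_measurable borel"
    using measurable_jac by (subst (asm) borel_measurable_restrict_space_iff) auto
  have J0: "0 \<le> indicator V x * jac x" for x using jac_pos[of x] by (auto simp: indicator_def)
  have eq: "?D' =
      distr ?D borel psi0"
  proof (rule measure_eqI)
    fix A assume "A \<in> sets (?D')"
    then have A [measurable]: "A \<in> sets borel" by simp
    have "emeasure (?D') A =
        (\<integral>\<^sup>+y. ennreal (indicator V' y) * indicator A y \<partial>P)"
      by (rule emeasure_density) measurable
    also have "\<dots> = (\<integral>\<^sup>+y. indicator (V' \<inter> A) y \<partial>P)"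
      by (intro nn_integral_cong) (auto simp: indicator_def)
    also have "\<dots> = (\<integral>\<^sup>+x. indicator V x * (indicator A (psi x) * ennreal (jac x)) \<partial>P)"
      using emeasure_change_of_variables[OF A] by simp
    also have "\<dots> = (\<integral>\<^sup>+x. ennreal (indicator V x * jac x) * indicator (psi0 -` A) x \<partial>P)"
      by (intro nn_integral_cong) (auto simp: indicator_def psi0_def)
    also have "\<dots> = emeasure (distr ?D borel psi0) A"
      using measurable_sets[OF psi0 A] by (subst emeasure_distr) (simp_all add: emeasure_density)
    finally show "emeasure (?D') A =
        emeasure (distr ?D borel psi0) A" .
  qed simp
  have r: "indicator V x * jac x * ?G (psi0 x) = indicator V x * (jac x * G (psi x))" for x
    using psi_V'[of x] by (simp add: indicator_def psi0_def)
  have l: "indicator V' y * ?G y = ?G y" for y by (simp add: indicator_def)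
  note [measurable] = G
  have "integrable P ?G \<longleftrightarrow> integrable (?D') ?G"
    by (subst integrable_density) (auto simp: l)
  also have "\<dots> \<longleftrightarrow> integrable P (\<lambda>x. indicator V x * (jac x * G (psi x)))"
    unfolding eq r[symmetric] by (simp add: integrable_distr_eq integrable_density J0)
  finally show "integrable P ?G \<longleftrightarrow> integrable P (\<lambda>x. indicator V x * (jac x * G (psi x)))" .
  have "(\<integral>y. ?G y \<partial>P) = (\<integral>y. ?G y \<partial>?D')"
    by (subst integral_density) (auto simp: l)
  also have "\<dots> = (\<integral>x. indicator V x * (jac x * G (psi x)) \<partial>P)"
    unfolding eq r[symmetric] by (simp add: integral_distr integral_density J0)
  finally show "(\<integral>y. ?G y \<partial>P) = (\<integral>x. indicator V x * (jac x * G (psi x)) \<partial>P)" .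
qed

end

section \<open>Finite-dimensional calculus for functions with continuous partial derivatives\<close>

lemma F_continuous_on_plane:
  assumes F: "F_continuous_on W f" and W: "open W" and x: "x \<in> W"
  shows "isCont (\<lambda>(s, t). f (line x j s + t *\<^sub>R basis i)) (0, 0)"
proof -
  define n where "n = Suc (max i j)"
  \<comment> \<open>The plane is embedded in \<open>Euclidean_space n\<close> with \<open>n\<close>
    beyond both indices. For \<open>i = j\<close> the two contributions add up in the same
    coordinate, so that case needs no separate treatment.\<close>
  define \<kappa> :: "real \<times> real \<Rightarrow> nat \<Rightarrow> real" where
    "\<kappa> = (\<lambda>p k. fst p * of_bool (k = j) + snd p * of_bool (k = i))"
  define pt where "pt = (\<lambda>p :: real \<times> real. x + fst p *\<^sub>R basis j + snd p *\<^sub>R basis i)"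
  define S where "S = pt -` W"
  have pt: "x + (\<Sum>k<n. \<kappa> p k *\<^sub>R basis k) = pt p" for p
  proof (rule l2_eqI)
    fix m
    have "(\<Sum>k<n. \<kappa> p k * coord (basis k) m) = (\<Sum>k<n. if k = m then \<kappa> p k else 0)"
      by (intro sum.cong) (auto simp: coord_basis)
    also have "\<dots> = \<kappa> p m" by (auto simp: n_def \<kappa>_def)
    finally show "coord (x + (\<Sum>k<n. \<kappa> p k *\<^sub>R basis k)) m = coord (pt p) m"
      by (simp add: pt_def \<kappa>_def coord_basis)
  qed
  have "continuous_on UNIV pt" unfolding pt_def by (intro continuous_intros)
  then have S: "open S" unfolding S_def by (rule open_vimage[OF W])
  have \<kappa>: "continuous_map (top_of_set S)
      (subtopology (Euclidean_space n) {s. x + (\<Sum>k<n. s k *\<^sub>R basis k) \<in> W}) \<kappa>"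
  proof -
    have "continuous_on S \<kappa>"
      unfolding \<kappa>_def by (intro continuous_on_coordinatewise_then_product continuous_intros)
    then have "continuous_map (top_of_set S) (powertop_real UNIV) \<kappa>"
      by (simp add: euclidean_product_topology)
    moreover have "\<kappa> p m = 0" if "m \<ge> n" for p m using that by (auto simp: \<kappa>_def n_def)
    ultimately show ?thesis
      unfolding Euclidean_space_def continuous_map_in_subtopology
      by (auto simp: pt S_def)
  qed
  have "continuous_map (top_of_set S) euclideanreal
      ((\<lambda>s. f (x + (\<Sum>k<n. s k *\<^sub>R basis k))) \<circ> \<kappa>)"
    using F x unfolding F_continuous_on_def by (intro continuous_map_compose[OF \<kappa>]) blast
  then have "continuous_on S (\<lambda>p. f (pt p))"
    by (simp add: comp_def pt)
  moreover have "(0, 0) \<in> S" using x by (simp add: S_def pt_def)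
  ultimately have "isCont (\<lambda>p. f (pt p)) (0, 0)"
    using continuous_on_eq_continuous_at[OF S] by blast
  then show ?thesis by (simp add: pt_def case_prod_unfold)
qed

lemma F_continuous_on_line:
  assumes "F_continuous_on W f" "open W" "x \<in> W"
  shows "isCont (\<lambda>t. f (line x i t)) 0"
proof -
  have c: "isCont (\<lambda>t. (0 :: real, t)) (0 :: real)" by (intro continuous_intros)
  have "isCont (\<lambda>(s, t). f (line x i s + t *\<^sub>R basis i)) ((\<lambda>t. (0, t)) (0 :: real))"
    using F_continuous_on_plane[OF assms] by simp
  from isCont_o2[OF c this] show ?thesis by simp
qed

lemma eventually_line_in:
  fixes W :: "l2 set"
  assumes "open W" "x \<in> W"
  shows "\<forall>\<^sub>F t in nhds 0. line x i t \<in> W"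
proof -
  have "isCont (\<lambda>t. line x i t) 0" by (intro continuous_intros)
  then have "((\<lambda>t. line x i t) \<longlongrightarrow> x) (nhds 0)"
    using tendsto_at_iff_tendsto_nhds[of "\<lambda>t. line x i t" 0] by (simp add: isCont_def)
  then show ?thesis using assms by (rule topological_tendstoD)
qed

lemma open_plane_box:
  assumes "open W" "x \<in> W"
  obtains d where "d > 0"
    "\<And>s t. \<bar>s\<bar> < d \<Longrightarrow> \<bar>t\<bar> < d \<Longrightarrow> x + s *\<^sub>R basis j + t *\<^sub>R basis i \<in> W"
proof -
  obtain e where e: "e > 0" "ball x e \<subseteq> W" using assms by (meson open_contains_ball)
  have "line x j s + t *\<^sub>R basis i \<in> W" if "\<bar>s\<bar> < e / 2" "\<bar>t\<bar> < e / 2" for s t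
  proof -
    have "norm (s *\<^sub>R basis j + t *\<^sub>R basis i) \<le> \<bar>s\<bar> + \<bar>t\<bar>"
      by (rule order_trans[OF norm_triangle_ineq]) simp
    also have "\<dots> < e" using that by simp
    finally have "dist x (x + (s *\<^sub>R basis j + t *\<^sub>R basis i)) < e"
      unfolding dist_norm norm_minus_commute[of x] by simp
    then show ?thesis using e(2) by (auto simp: add.assoc)
  qed
  then show ?thesis using e(1) that[of "e / 2"] by simp
qed

lemma has_partial_at_shift:
  assumes "has_partial_at i f (line x i t)"
  shows "((\<lambda>s. f (line x i s)) has_real_derivative partial i f (line x i t)) (at t)"
  by (rule has_partial_shift[OF has_partial_atD[OF assms]])

lemma second_difference_MVT:
  fixes F Fs Fst :: "real \<Rightarrow> real \<Rightarrow> real"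
  assumes c: "0 < c" "c < d"
    and s: "\<And>s t. \<bar>s\<bar> < d \<Longrightarrow> \<bar>t\<bar> < d \<Longrightarrow> ((\<lambda>s. F s t) has_real_derivative Fs s t) (at s)"
    and st: "\<And>s t. \<bar>s\<bar> < d \<Longrightarrow> \<bar>t\<bar> < d \<Longrightarrow> ((\<lambda>t. Fs s t) has_real_derivative Fst s t) (at t)"
  obtains \<sigma> \<tau> where "0 < \<sigma>" "\<sigma> < c" "0 < \<tau>" "\<tau> < c"
    "F c c - F c 0 - F 0 c + F 0 0 = c * (c * Fst \<sigma> \<tau>)"
proof -
  have "\<exists>z>0. z < c \<and> (F c c - F c 0) - (F 0 c - F 0 0) = (c - 0) * (Fs z c - Fs z 0)"
    using c by (intro MVT2[where f = "\<lambda>s. F s c - F s 0"] DERIV_diff s) auto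
  then obtain \<sigma> where \<sigma>: "0 < \<sigma>" "\<sigma> < c" "(F c c - F c 0) - (F 0 c - F 0 0) = c * (Fs \<sigma> c - Fs \<sigma> 0)"
    by auto
  have "\<exists>z>0. z < c \<and> Fs \<sigma> c - Fs \<sigma> 0 = (c - 0) * Fst \<sigma> z"
    using c \<sigma> by (intro MVT2 st) auto
  then obtain \<tau> where "0 < \<tau>" "\<tau> < c" "Fs \<sigma> c - Fs \<sigma> 0 = c * Fst \<sigma> \<tau>" by auto
  then show ?thesis using \<sigma> that[of \<sigma> \<tau>] by simp
qed

text \<open>Schwarz's theorem. The second difference over a small square is symmetric in the two
  variables; the mean value theorem, applied in either order, expresses it by each of the two mixed
  derivatives at nearby points.\<close>

lemma mixed_derivatives_equal:
  fixes F Fs Ft Fst Fts :: "real \<Rightarrow> real \<Rightarrow> real"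
  assumes d: "d > 0"
    and s: "\<And>s t. \<bar>s\<bar> < d \<Longrightarrow> \<bar>t\<bar> < d \<Longrightarrow> ((\<lambda>s. F s t) has_real_derivative Fs s t) (at s)"
    and t: "\<And>s t. \<bar>s\<bar> < d \<Longrightarrow> \<bar>t\<bar> < d \<Longrightarrow> ((\<lambda>t. F s t) has_real_derivative Ft s t) (at t)"
    and st: "\<And>s t. \<bar>s\<bar> < d \<Longrightarrow> \<bar>t\<bar> < d \<Longrightarrow> ((\<lambda>t. Fs s t) has_real_derivative Fst s t) (at t)"
    and ts: "\<And>s t. \<bar>s\<bar> < d \<Longrightarrow> \<bar>t\<bar> < d \<Longrightarrow> ((\<lambda>s. Ft s t) has_real_derivative Fts s t) (at s)"
    and cst: "isCont (\<lambda>(s, t). Fst s t) (0, 0)" and cts: "isCont (\<lambda>(s, t). Fts s t) (0, 0)"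
  shows "Fst 0 0 = Fts 0 0"
proof (rule ccontr)
  assume ne: "Fst 0 0 \<noteq> Fts 0 0"
  define e where "e = \<bar>Fst 0 0 - Fts 0 0\<bar> / 2"
  have e: "e > 0" using ne by (simp add: e_def)
  obtain d1 where d1: "d1 > 0" "\<And>p. dist p (0, 0) < d1 \<Longrightarrow> dist (case p of (s, t) \<Rightarrow> Fst s t) (Fst 0 0) < e"
    using cst e unfolding continuous_at_eps_delta by force
  obtain d2 where d2: "d2 > 0" "\<And>p. dist p (0, 0) < d2 \<Longrightarrow> dist (case p of (s, t) \<Rightarrow> Fts s t) (Fts 0 0) < e"
    using cts e unfolding continuous_at_eps_delta by force
  define c where "c = min d (min d1 d2) / 2"
  have c: "c > 0" "c < d" "2 * c \<le> d1" "2 * c \<le> d2" using d d1 d2 by (auto simp: c_def)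
  have near: "dist (\<sigma>, \<tau>) (0 :: real, 0 :: real) < 2 * c" if "0 < \<sigma>" "\<sigma> < c" "0 < \<tau>" "\<tau> < c" for \<sigma> \<tau>
  proof -
    have "dist (\<sigma>, \<tau>) (0 :: real, 0 :: real) \<le> \<bar>\<sigma>\<bar> + \<bar>\<tau>\<bar>"
      using sqrt_sum_squares_le_sum_abs[of \<sigma> \<tau>] by (simp add: dist_Pair_Pair)
    then show ?thesis using that by simp
  qed
  let ?D = "F c c - F c 0 - F 0 c + F 0 0"
  obtain \<sigma> \<tau> where 1: "0 < \<sigma>" "\<sigma> < c" "0 < \<tau>" "\<tau> < c" "?D = c * (c * Fst \<sigma> \<tau>)"
    by (rule second_difference_MVT[OF c(1,2) s st])
  obtain \<tau>' \<sigma>' where 2: "0 < \<tau>'" "\<tau>' < c" "0 < \<sigma>'" "\<sigma>' < c"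
      "F c c - F 0 c - F c 0 + F 0 0 = c * (c * Fts \<sigma>' \<tau>')"
    by (rule second_difference_MVT[where F = "\<lambda>t s. F s t" and Fs = "\<lambda>t s. Ft s t"
          and Fst = "\<lambda>t s. Fts s t", OF c(1,2) t ts])
  have "c * (c * Fst \<sigma> \<tau>) = c * (c * Fts \<sigma>' \<tau>')" using 1(5) 2(5) by linarith
  then have "Fst \<sigma> \<tau> = Fts \<sigma>' \<tau>'" using c(1) by simp
  moreover have "\<bar>Fst \<sigma> \<tau> - Fst 0 0\<bar> < e"
    using d1(2)[of "(\<sigma>, \<tau>)"] near[OF 1(1-4)] c(3) by (simp add: dist_real_def)
  moreover have "\<bar>Fts \<sigma>' \<tau>' - Fts 0 0\<bar> < e"
    using d2(2)[of "(\<sigma>', \<tau>')"] near[OF 2(3,4,1,2)] c(4) by (simp add: dist_real_def)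
  moreover have "\<bar>Fst 0 0 - Fts 0 0\<bar> \<le> \<bar>Fst \<sigma> \<tau> - Fst 0 0\<bar> + \<bar>Fst \<sigma> \<tau> - Fts 0 0\<bar>"
    by arith
  ultimately show False unfolding e_def by simp
qed

lemma C_F_inf_mixed_partials:
  assumes f: "f \<in> C_F_inf W" and W: "open W" and x: "x \<in> W"
  shows "partial i (partial j f) x = partial j (partial i f) x"
proof -
  obtain d where d: "d > 0"
    "\<And>s t. \<bar>s\<bar> < d \<Longrightarrow> \<bar>t\<bar> < d \<Longrightarrow> x + s *\<^sub>R basis j + t *\<^sub>R basis i \<in> W"
    using open_plane_box[OF W x, of j i] by metis
  let ?p = "\<lambda>s t. line x j s + t *\<^sub>R basis i"
  have swap: "?p s t = line x i t + s *\<^sub>R basis j" for s t by (simp add: add_ac)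
  have "partial i (partial j f) (?p 0 0) = partial j (partial i f) (?p 0 0)"
  proof (rule mixed_derivatives_equal[OF d(1), where F = "\<lambda>s t. f (?p s t)"
        and Fs = "\<lambda>s t. partial j f (?p s t)" and Ft = "\<lambda>s t. partial i f (?p s t)"
        and Fst = "\<lambda>s t. partial i (partial j f) (?p s t)"
        and Fts = "\<lambda>s t. partial j (partial i f) (?p s t)"])
    fix s t :: real assume st: "\<bar>s\<bar> < d" "\<bar>t\<bar> < d"
    have p: "?p s t \<in> W" by (rule d(2)[OF st])
    show "((\<lambda>s. f (?p s t)) has_real_derivative partial j f (?p s t)) (at s)"
      using C_F_infD(3)[OF f p] unfolding swap by (rule has_partial_at_shift)
    show "((\<lambda>t. f (?p s t)) has_real_derivative partial i f (?p s t)) (at t)"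
      using C_F_infD(3)[OF f p] by (rule has_partial_at_shift)
    show "((\<lambda>t. partial j f (?p s t)) has_real_derivative partial i (partial j f) (?p s t)) (at t)"
      using C_F_infD(4)[OF f p] by (rule has_partial_at_shift)
    show "((\<lambda>s. partial i f (?p s t)) has_real_derivative partial j (partial i f) (?p s t)) (at s)"
      using C_F_infD(4)[OF f p] unfolding swap by (rule has_partial_at_shift)
  next
    show "isCont (\<lambda>(s, t). partial i (partial j f) (?p s t)) (0, 0)"
      "isCont (\<lambda>(s, t). partial j (partial i f) (?p s t)) (0, 0)"
      by (rule F_continuous_on_plane[OF C_F_infD(9)[OF f] W x])+
  qed
  then show ?thesis by simp
qed

text \<open>Members of \<open>C_F_inf\<close> need not be Frechet differentiable, but this curve
  stays in a plane. There the partial derivative in direction \<open>i\<close> exists and the one in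
  direction \<open>j\<close> is jointly continuous, which yields total differentiability at the base
  point.\<close>

lemma C_F_inf_curve_derivative:
  assumes f: "f \<in> C_F_inf W" and W: "open W" and y: "y \<in> W"
    and \<gamma>: "(\<gamma> has_real_derivative \<gamma>') (at 0)" "\<gamma> 0 = 0"
  shows "((\<lambda>t. f (line y i t + \<gamma> t *\<^sub>R basis j)) has_real_derivative
    partial i f y + partial j f y * \<gamma>') (at 0)"
proof -
  obtain d where d: "d > 0"
    "\<And>s t. \<bar>s\<bar> < d \<Longrightarrow> \<bar>t\<bar> < d \<Longrightarrow> y + s *\<^sub>R basis i + t *\<^sub>R basis j \<in> W"
    using open_plane_box[OF W y, of i j] by metis
  let ?p = "\<lambda>s t. line y i s + t *\<^sub>R basis j"
  let ?I = "{-d<..<d}"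
  have "((\<lambda>(s, t). f (?p s t)) has_derivative
      (\<lambda>(s, t). partial i f y * s + blinfun_mult_right (partial j f (?p 0 0)) t)) (at (0, 0) within ?I \<times> ?I)"
  proof (rule has_derivative_partialsI[where f = "\<lambda>s t. f (?p s t)"
        and fy = "\<lambda>s t. blinfun_mult_right (partial j f (?p s t))"])
    have "has_partial i f y (partial i f y)"
      by (rule has_partial_atD[OF C_F_infD(3)[OF f y]])
    then show "((\<lambda>s. f (?p s 0)) has_derivative (\<lambda>s. partial i f y * s)) (at 0 within ?I)"
      by (simp add: has_field_derivative_def has_derivative_at_withinI)
    show "((\<lambda>t. f (?p s t)) has_derivative blinfun_apply (blinfun_mult_right (partial j f (?p s t)))) (at t within ?I)"
      if "s \<in> ?I" "t \<in> ?I" for s t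
    proof -
      have "?p s t \<in> W" using that by (intro d(2)) auto
      from has_partial_at_shift[OF C_F_infD(3)[OF f this]]
      show ?thesis by (simp add: has_field_derivative_def has_derivative_at_withinI)
    qed
    have "isCont (\<lambda>(s, t). partial j f (?p s t)) (0, 0)"
      by (rule F_continuous_on_plane[OF C_F_infD(8)[OF f] W y])
    then have "isCont (\<lambda>p. blinfun_mult_right (case p of (s, t) \<Rightarrow> partial j f (?p s t))) (0, 0)"
      by (intro bounded_linear.isCont[OF bounded_linear_blinfun_mult_right])
    then show "continuous (at (0, 0) within ?I \<times> ?I) (\<lambda>(s, t). blinfun_mult_right (partial j f (?p s t)))"
      by (simp add: case_prod_unfold continuous_at_imp_continuous_at_within)
  qed (use d(1) in auto)
  moreover have "at (0, 0) within ?I \<times> ?I = at (0 :: real, 0 :: real)"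
    using d(1) by (intro at_within_open) (auto intro: open_Times)
  ultimately have D: "((\<lambda>(s, t). f (?p s t)) has_derivative
      (\<lambda>(s, t). partial i f y * s + partial j f y * t)) (at (0, 0))" by simp
  have "((\<lambda>t. (t, \<gamma> t)) has_derivative (\<lambda>h. (h, \<gamma>' * h))) (at 0)"
    using \<gamma>(1) by (intro has_derivative_Pair) (auto simp: has_field_derivative_def)
  moreover have "((\<lambda>(s, t). f (?p s t)) has_derivative
      (\<lambda>(s, t). partial i f y * s + partial j f y * t)) (at (0, \<gamma> 0))"
    using D by (simp add: \<gamma>(2))
  ultimately have "((\<lambda>t. case (t, \<gamma> t) of (s, t) \<Rightarrow> f (?p s t)) has_derivative
      (\<lambda>h. case (h, \<gamma>' * h) of (s, t) \<Rightarrow> partial i f y * s + partial j f y * t)) (at 0)"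
    by (rule has_derivative_compose)
  then have "((\<lambda>t. f (?p t (\<gamma> t))) has_derivative (\<lambda>h. partial i f y * h + partial j f y * (\<gamma>' * h))) (at 0)"
    by simp
  moreover have "(\<lambda>h. partial i f y * h + partial j f y * (\<gamma>' * h)) = (*) (partial i f y + partial j f y * \<gamma>')"
    by (simp add: fun_eq_iff algebra_simps)
  ultimately show ?thesis unfolding has_field_derivative_def by simp
qed

context flattening
begin

text \<open>A step \<open>t\<close> along e_i moves \<open>psi\<close> by the increment of
  \<open>g\<close> in the first direction and by \<open>t\<close> in direction \<open>i\<close>. For
  \<open>i = 0\<close> the latter is lost, since \<open>psi\<close> overwrites the first coordinate;
  hence the case distinction.\<close>

lemma has_partial_comp_psi:
  assumes f: "f \<in> C_F_inf V'" and x: "x \<in> V"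
  shows "((\<lambda>t. f (psi (line x i t))) has_real_derivative
    (if i = 0 then 0 else partial i f (psi x)) + partial 0 f (psi x) * partial i g x) (at 0)"
proof -
  let ?\<gamma> = "\<lambda>t. g (line x i t) - g x"
  have gd: "has_partial i g x (partial i g x)"
    by (rule has_partial_atD[OF C_F_infD(3)[OF g x]])
  have \<gamma>: "(?\<gamma> has_real_derivative partial i g x) (at 0)"
    using gd by (auto intro!: derivative_eq_intros)
  show ?thesis
  proof (cases "i = 0")
    case True
    have eq: "psi (line x i t) = psi x + ?\<gamma> t *\<^sub>R basis 0" for t
      by (rule l2_eqI) (auto simp: psi_def coord_set_first coord_basis True)
    have "((\<lambda>s. f (psi x + s *\<^sub>R basis 0)) has_real_derivative partial 0 f (psi x)) (at (?\<gamma> 0))"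
      using has_partial_atD[OF C_F_infD(3)[OF f psi_V'[OF x]], of 0] by simp
    from DERIV_chain2[OF this \<gamma>] show ?thesis unfolding eq by (simp add: True)
  next
    case False
    have eq: "psi (line x i t) = psi x + t *\<^sub>R basis i + ?\<gamma> t *\<^sub>R basis 0" for t
      by (rule l2_eqI) (auto simp: psi_def coord_set_first coord_basis False)
    show ?thesis
      using C_F_inf_curve_derivative[OF f open_V' psi_V'[OF x] \<gamma>, of i] by (simp add: eq False)
  qed
qed

text \<open>Differentiate \<open>h (psi x) = coord x 0\<close>, which holds near \<open>x\<close>
  along the line because \<open>V\<close> is open.\<close>

lemma partial_h_psi:
  assumes x: "x \<in> V"
  shows "partial 0 h (psi x) * partial 0 g x = 1"
    and "i \<noteq> 0 \<Longrightarrow> partial i h (psi x) = - partial 0 h (psi x) * partial i g x"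
proof -
  have "((\<lambda>t. h (psi (line x i t))) has_real_derivative (if i = 0 then 1 else 0)) (at 0)" for i
  proof -
    have "((\<lambda>t. coord (line x i t) 0) has_real_derivative (if i = 0 then 1 else 0)) (at 0)"
      by (auto intro!: derivative_eq_intros simp: coord_basis)
    moreover have "\<forall>\<^sub>F t in nhds 0. coord (line x i t) 0 = h (psi (line x i t))"
      using eventually_line_in[OF open_V x, of i] by eventually_elim (metis h_psi psi_def)
    ultimately show ?thesis by (subst DERIV_cong_ev[OF refl _ refl, symmetric])
  qed
  note * = DERIV_unique[OF has_partial_comp_psi[OF h x] this]
  show "partial 0 h (psi x) * partial 0 g x = 1" using *[of 0] by simp
  show "partial i h (psi x) = - partial 0 h (psi x) * partial i g x" if "i \<noteq> 0"
    using *[of i] that by simp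
qed

end

section \<open>The weak chain rule\<close>

text \<open>The distance \<rho> keeps \<phi> equal to 0 near every point outside \<open>V\<close>,
  and \<phi>' vanishes wherever \<phi> vanishes on an open set. So the extension by zero keeps its
  regularity along lines.\<close>

lemma line_C1_extend:
  assumes V: "open V"
    and m: "\<phi> \<in> borel_on V" "\<phi>' \<in> borel_on V"
    and d: "\<And>x. x \<in> V \<Longrightarrow> has_partial i \<phi> x (\<phi>' x)"
    and c: "\<And>x. x \<in> V \<Longrightarrow> isCont (\<lambda>t. \<phi>' (line x i t)) 0"
    and b: "bounded (\<phi> ` V)" "bounded (\<phi>' ` V)"
    and \<rho>: "\<rho> > 0" "\<And>x. x \<in> V \<Longrightarrow> \<phi> x \<noteq> 0 \<Longrightarrow> ball x \<rho> \<subseteq> V"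
    and R: "\<And>x. x \<in> V \<Longrightarrow> \<phi> x \<noteq> 0 \<Longrightarrow> norm x \<le> R"
  shows "line_C1 i (\<lambda>x. indicator V x * \<phi> x) (\<lambda>x. indicator V x * \<phi>' x)"
proof -
  have Vb [measurable]: "V \<in> sets borel" using V by simp
  obtain B B' where B: "\<And>x. x \<in> V \<Longrightarrow> \<bar>\<phi> x\<bar> \<le> B" "\<And>x. x \<in> V \<Longrightarrow> \<bar>\<phi>' x\<bar> \<le> B'"
    using b by (auto simp: bounded_iff)
  have zero: "\<phi>' x = 0" if x: "x \<in> W" and W: "open W" "W \<subseteq> V" "\<And>y. y \<in> W \<Longrightarrow> \<phi> y = 0" for x W
  proof (rule DERIV_unique)
    show "has_partial i \<phi> x (\<phi>' x)" using d x W(2) by blast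
    have "\<forall>\<^sub>F t in nhds 0. \<phi> (line x i t) = 0"
      using eventually_line_in[OF W(1) x, of i] by eventually_elim (rule W(3))
    then show "has_partial i \<phi> x 0"
      by (subst DERIV_cong_ev[OF refl _ refl]) auto
  qed
  show ?thesis
  proof (rule line_C1I[where B = "max \<bar>B\<bar> \<bar>B'\<bar>" and R = R])
    show "(\<lambda>x. indicator V x * \<phi> x) \<in> borel_measurable borel"
      "(\<lambda>x. indicator V x * \<phi>' x) \<in> borel_measurable borel"
      using m by (simp_all add: borel_measurable_restrict_space_iff)
    show "\<bar>indicator V x * \<phi> x\<bar> \<le> max \<bar>B\<bar> \<bar>B'\<bar>" "\<bar>indicator V x * \<phi>' x\<bar> \<le> max \<bar>B\<bar> \<bar>B'\<bar>" for x
      using B[of x] by (auto simp: indicator_def)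
    show "\<bar>coord x i\<bar> \<le> R" if "indicator V x * \<phi> x \<noteq> 0 \<or> indicator V x * \<phi>' x \<noteq> 0" for x
    proof (rule ccontr)
      assume "\<not> \<bar>coord x i\<bar> \<le> R"
      let ?W = "V \<inter> {x. R < \<bar>coord x i\<bar>}"
      have "open ?W" by (intro open_Int V open_Collect_less continuous_intros)
      moreover have "\<phi> y = 0" if "y \<in> ?W" for y
        using that R[of y] abs_coord_le_norm[of y i] by force
      moreover have "x \<in> ?W" using that \<open>\<not> \<bar>coord x i\<bar> \<le> R\<close> by (auto simp: indicator_def split: if_splits)
      ultimately show False using zero[of x ?W] that by auto
    qed
    fix x
    have "((\<lambda>t. indicator V (line x i t) * \<phi> (line x i t)) has_real_derivative
        indicator V x * \<phi>' x) (at 0) \<and>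
      isCont (\<lambda>t. indicator V (line x i t) * \<phi>' (line x i t)) 0"
    proof (cases "x \<in> V")
      case True
      note ev = eventually_line_in[OF V True, of i]
      have 1: "\<forall>\<^sub>F t in nhds 0. indicator V (line x i t) * \<phi> (line x i t) = \<phi> (line x i t)"
        and 2: "\<forall>\<^sub>F t in nhds 0. indicator V (line x i t) * \<phi>' (line x i t) = \<phi>' (line x i t)"
        by (rule eventually_mono[OF ev], simp)+
      show ?thesis
        using d[OF True] c[OF True] True
        by (simp add: DERIV_cong_ev[OF refl 1 refl] isCont_cong[OF 2])
    next
      case False
      let ?W = "V \<inter> ball x \<rho>"
      have \<phi>0: "\<phi> y = 0" if "y \<in> ?W" for y
      proof (rule ccontr)
        assume "\<phi> y \<noteq> 0"
        then have "ball y \<rho> \<subseteq> V" using \<rho>(2) that by blast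
        moreover have "x \<in> ball y \<rho>" using that by (simp add: dist_commute)
        ultimately show False using False by blast
      qed
      then have \<phi>'0: "\<phi>' y = 0" if "y \<in> ?W" for y
        by (intro zero[of y ?W]) (use that V in auto)
      have ev: "\<forall>\<^sub>F t in nhds 0. line x i t \<in> ball x \<rho>"
        by (rule eventually_line_in) (use \<rho>(1) in auto)
      have 1: "\<forall>\<^sub>F t in nhds 0. indicator V (line x i t) * \<phi> (line x i t) = 0"
        using ev
      proof eventually_elim
        case (elim t)
        then show ?case using \<phi>0[of "line x i t"] by (cases "line x i t \<in> V") simp_all
      qed
      have 2: "\<forall>\<^sub>F t in nhds 0. indicator V (line x i t) * \<phi>' (line x i t) = 0"
        using ev
      proof eventually_elim
        case (elim t)
        then show ?case using \<phi>'0[of "line x i t"] by (cases "line x i t \<in> V") simp_all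
      qed
      show ?thesis
        using False by (simp add: DERIV_cong_ev[OF refl 1 refl] isCont_cong[OF 2])
    qed
    then show "((\<lambda>t. indicator V (line x i t) * \<phi> (line x i t)) has_real_derivative
        indicator V x * \<phi>' x) (at 0)"
      "isCont (\<lambda>t. indicator V (line x i t) * \<phi>' (line x i t)) 0" by blast+
  qed
qed

lemma bounded_mult_comp:
  fixes f g :: "'a \<Rightarrow> real"
  assumes "bounded (f ` S)" "bounded (g ` S)"
  shows "bounded ((\<lambda>x. f x * g x) ` S)"
proof -
  obtain B C where BC: "\<And>x. x \<in> S \<Longrightarrow> \<bar>f x\<bar> \<le> B" "\<And>x. x \<in> S \<Longrightarrow> \<bar>g x\<bar> \<le> C"
    using assms by (auto simp: bounded_iff)
  have "\<bar>f x * g x\<bar> \<le> B * C" if "x \<in> S" for x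
    unfolding abs_mult using BC[OF that] by (intro mult_mono) auto
  then show ?thesis by (auto simp: bounded_iff)
qed

text \<open>\<open>C_F_inf\<close> bounds derivatives only; the bound on the function itself comes
  from the supremum in the test class.\<close>

lemma C_F_0_bounded:
  assumes "\<phi> \<in> C_F_0 W"
  shows "bounded (\<phi> ` W)"
proof -
  let ?s = "SUP x\<in>W. ennreal \<bar>\<phi> x\<bar> + (\<Sum>i. ennreal ((partial i \<phi> x)\<^sup>2))"
  have s: "?s < \<infinity>" using assms by (simp add: C_F_0_def)
  have "\<bar>\<phi> x\<bar> \<le> enn2real ?s" if "x \<in> W" for x
  proof -
    have "ennreal \<bar>\<phi> x\<bar> \<le> ennreal \<bar>\<phi> x\<bar> + (\<Sum>i. ennreal ((partial i \<phi> x)\<^sup>2))" by simp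
    also have "\<dots> \<le> ?s" by (rule SUP_upper[OF that])
    also have "?s = ennreal (enn2real ?s)" using s by simp
    finally show ?thesis by (simp add: ennreal_le_iff)
  qed
  then show ?thesis by (auto simp: bounded_iff)
qed

context flattening
begin

text \<open>The weak chain rule in direction \<open>i > 0\<close> tests the derivative in direction \<open>i\<close> with
  \<open>p = partial 0 g\<close> and the one in direction 0 with \<open>p = partial i g\<close>; the derivatives of
  the weight and the mixed derivatives of \<open>g\<close> then cancel.\<close>

definition test :: "(l2 \<Rightarrow> real) \<Rightarrow> (l2 \<Rightarrow> real) \<Rightarrow> l2 \<Rightarrow> real" where
  "test \<phi> p x = \<phi> (psi x) * wgt x * p x"

definition test_deriv :: "nat \<Rightarrow> (l2 \<Rightarrow> real) \<Rightarrow> (l2 \<Rightarrow> real) \<Rightarrow> l2 \<Rightarrow> real" where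
  "test_deriv i \<phi> p x =
    ((if i = 0 then 0 else partial i \<phi> (psi x)) + partial 0 \<phi> (psi x) * partial i g x) * wgt x * p x +
    \<phi> (psi x) * (wgt x * (((if i = 0 then coord x 0 else 0) - g x * partial i g x) / (a 0)\<^sup>2)) * p x +
    \<phi> (psi x) * wgt x * partial i p x"

lemma has_partial_g: "x \<in> V \<Longrightarrow> has_partial i g x (partial i g x)"
  by (rule has_partial_atD[OF C_F_infD(3)[OF g]])

lemma has_partial_wgt:
  assumes x: "x \<in> V"
  shows "has_partial i wgt x (wgt x * (((if i = 0 then coord x 0 else 0) - g x * partial i g x) / (a 0)\<^sup>2))"
proof -
  have a0: "a 0 \<noteq> 0" using a_pos[of 0] by simp
  have "((\<lambda>t. coord (line x i t) 0) has_real_derivative (if i = 0 then 1 else 0)) (at 0)"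
    by (auto intro!: derivative_eq_intros simp: coord_basis)
  then have "((\<lambda>t. ((coord (line x i t) 0)\<^sup>2 - (g (line x i t))\<^sup>2) / (2 * (a 0)\<^sup>2))
      has_real_derivative ((if i = 0 then coord x 0 else 0) - g x * partial i g x) / (a 0)\<^sup>2) (at 0)"
    using a0 has_partial_g[OF x, of i]
    by (auto intro!: derivative_eq_intros simp: field_simps coord_basis)
  from DERIV_chain2[where f = exp, OF DERIV_exp this] show ?thesis
    by (simp add: wgt_def)
qed

lemma isCont_comp_psi:
  assumes G: "F_continuous_on V' G" and x: "x \<in> V"
  shows "isCont (\<lambda>t. G (psi (line x i t))) 0"
proof -
  let ?\<gamma> = "\<lambda>t. g (line x i t) - g x"
  let ?c = "\<lambda>t. (?\<gamma> t, if i = 0 then 0 else t)"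
  have "psi (line x i t) = psi x + ?\<gamma> t *\<^sub>R basis 0 + (if i = 0 then 0 else t) *\<^sub>R basis i" for t
    by (rule l2_eqI) (auto simp: psi_def coord_set_first coord_basis)
  then have eq: "G (psi (line x i t)) =
      (case ?c t of (s, t) \<Rightarrow> G (psi x + s *\<^sub>R basis 0 + t *\<^sub>R basis i))" for t by simp
  have "isCont ?\<gamma> 0" using DERIV_isCont[OF has_partial_g[OF x]] by (intro continuous_intros)
  then have "isCont ?c 0" by (cases "i = 0") (auto intro!: continuous_intros)
  moreover have "isCont (\<lambda>(s, t). G (psi x + s *\<^sub>R basis 0 + t *\<^sub>R basis i)) (?c 0)"
    using F_continuous_on_plane[OF G open_V' psi_V'[OF x]] by simp
  ultimately show ?thesis unfolding eq by (rule isCont_o2)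
qed

lemma wgt_bounded: "x \<in> V \<Longrightarrow> wgt x \<le> exp (\<delta>\<^sup>2 / (2 * (a 0)\<^sup>2))"
proof -
  assume "x \<in> V"
  then have "(coord x 0)\<^sup>2 \<le> \<delta>\<^sup>2" using first_bound by (subst abs_le_square_iff[symmetric]) (use \<delta>_pos in auto)
  then have "(coord x 0)\<^sup>2 - (g x)\<^sup>2 \<le> \<delta>\<^sup>2" using zero_le_power2[of "g x"] by linarith
  then show ?thesis unfolding wgt_def by (simp add: divide_right_mono)
qed

text \<open>\<open>tau_inside\<close> carries the distance of the support of \<phi> from the
  complement of \<open>V'\<close> over to \<open>V\<close>. Hence \<open>test \<phi> p\<close>,
  extended by zero, is in \<open>line_C1\<close> and admissible in
  \<open>weak_partial_line_C1\<close>, even if its full gradient is unbounded.\<close>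

lemma weak_partial_test:
  assumes w: "has_weak_partial a V i f q" and \<phi>: "\<phi> \<in> C_F_0 V'"
    and p: "p \<in> C_F_inf V" "bounded (p ` V)"
  shows "integrable P (\<lambda>x. indicator V x * (q x * test \<phi> p x))" (is ?i1)
    and "integrable P (\<lambda>x. indicator V x * (f x * (- test_deriv i \<phi> p x + coord x i / (a i)\<^sup>2 * test \<phi> p x)))" (is ?i2)
    and "(\<integral>x. indicator V x * (q x * test \<phi> p x) \<partial>P) =
      (\<integral>x. indicator V x * (f x * (- test_deriv i \<phi> p x + coord x i / (a i)\<^sup>2 * test \<phi> p x)) \<partial>P)" (is ?eq)
proof -
  have \<phi>C: "\<phi> \<in> C_F_inf V'" using \<phi> by (simp add: C_F_0_def)
  have cl: "closure {y \<in> V'. \<phi> y \<noteq> 0} \<Subset>\<^sub>o V'" using \<phi> by (simp add: C_F_0_def)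
  obtain \<rho> R where \<rho>: "\<rho> > 0" "(\<Union>z\<in>tau ` closure {y \<in> V'. \<phi> y \<noteq> 0}. ball z \<rho>) \<subseteq> V"
    and R: "tau ` closure {y \<in> V'. \<phi> y \<noteq> 0} \<subseteq> ball 0 R"
    using tau_inside[OF cl] unfolding inside_def tau_def[abs_def] by blast
  have supp: "ball x \<rho> \<subseteq> V \<and> norm x \<le> R" if x: "x \<in> V" "test \<phi> p x \<noteq> 0" for x
  proof -
    have "psi x \<in> closure {y \<in> V'. \<phi> y \<noteq> 0}"
      using x psi_V'[of x] closure_subset[of "{y \<in> V'. \<phi> y \<noteq> 0}"] by (auto simp: test_def)
    then have "x \<in> tau ` closure {y \<in> V'. \<phi> y \<noteq> 0}" using tau_psi[OF x(1)] by (metis imageI)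
    then have "ball x \<rho> \<subseteq> V" "x \<in> ball 0 R" using \<rho>(2) R by blast+
    then show ?thesis by simp
  qed
  have psi_r: "psi \<in> measurable (restrict_space borel V) (restrict_space borel V')"
    by (rule measurable_restrict_space2) (auto simp: psi_V' space_restrict_space)
  note [measurable] = C_F_infD(1,2)[OF p(1)] C_F_infD(1,2)[OF g]
    measurable_compose[OF psi_r C_F_infD(1)[OF \<phi>C]] measurable_compose[OF psi_r C_F_infD(2)[OF \<phi>C]]
  have sub: "bounded ((\<lambda>x. u (psi x)) ` V)" if "bounded (u ` V')" for u :: "l2 \<Rightarrow> real"
    by (rule bounded_subset[OF that]) (use psi_V' in auto)
  have wb: "bounded (wgt ` V)"
    using wgt_bounded by (auto simp: bounded_iff wgt_def intro!: exI[of _ "exp (\<delta>\<^sup>2 / (2 * (a 0)\<^sup>2))"])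
  have gb: "bounded (g ` V)" "bounded ((\<lambda>x. coord x 0) ` V)"
    using g_bound first_bound by (auto simp: bounded_iff)
  have cb: "bounded ((\<lambda>x. if i = 0 then coord x 0 else 0) ` V)"
    using gb(2) by (cases "i = 0") (auto intro: bounded_subset[of "{0 :: real}"])
  have pb: "bounded ((\<lambda>x. if i = 0 then 0 else partial i \<phi> (psi x)) ` V)"
    using sub[OF C_F_infD(5)[OF \<phi>C, of i]] by (cases "i = 0") (auto intro: bounded_subset[of "{0 :: real}"])
  have kb: "bounded ((\<lambda>_ :: l2. k :: real) ` V)" for k
    by (rule bounded_subset[of "{k}"]) auto
  have L: "line_C1 i (\<lambda>x. indicator V x * test \<phi> p x) (\<lambda>x. indicator V x * test_deriv i \<phi> p x)"
  proof (rule line_C1_extend[OF open_V])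
    show "test \<phi> p \<in> borel_on V"
      unfolding test_def[abs_def] by measurable
    show "test_deriv i \<phi> p \<in> borel_on V"
      unfolding test_deriv_def[abs_def] by measurable
    show "bounded (test \<phi> p ` V)"
      unfolding test_def[abs_def] by (intro bounded_mult_comp sub[OF C_F_0_bounded[OF \<phi>]] wb p(2))
    show "bounded (test_deriv i \<phi> p ` V)"
      unfolding test_deriv_def[abs_def] divide_inverse
      by (intro bounded_plus_comp bounded_minus_comp bounded_mult_comp sub[OF C_F_0_bounded[OF \<phi>]]
          wb p(2) gb cb pb kb sub[OF C_F_infD(5)[OF \<phi>C]] C_F_infD(5)[OF g] C_F_infD(5)[OF p(1)])
    fix x assume x: "x \<in> V"
    note d\<phi> = has_partial_comp_psi[OF \<phi>C x, of i] and dw = has_partial_wgt[OF x, of i]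
      and dp = has_partial_atD[OF C_F_infD(3)[OF p(1) x], of i]
    show "((\<lambda>t. test \<phi> p (line x i t)) has_real_derivative test_deriv i \<phi> p x) (at 0)"
      unfolding test_def
      by (rule DERIV_cong[OF DERIV_mult[OF DERIV_mult[OF d\<phi> dw] dp]])
         (simp add: test_deriv_def algebra_simps)
    have c0: "isCont (\<lambda>t. if i = 0 then 0 else partial i \<phi> (psi (line x i t))) 0"
      using isCont_comp_psi[OF C_F_infD(8)[OF \<phi>C] x] by (cases "i = 0") auto
    have c1: "isCont (\<lambda>t. if i = 0 then coord (line x i t) 0 else 0) 0"
      by (cases "i = 0") (auto intro!: continuous_intros)
    show "isCont (\<lambda>t. test_deriv i \<phi> p (line x i t)) 0"
      unfolding test_deriv_def divide_inverse
      by (intro isCont_add isCont_diff isCont_mult continuous_const c0 c1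
          DERIV_isCont[OF dp] DERIV_isCont[OF dw] DERIV_isCont[OF d\<phi>] DERIV_isCont[OF has_partial_g[OF x]]
          isCont_comp_psi[OF C_F_infD(8)[OF \<phi>C] x]
          F_continuous_on_line[OF C_F_infD(8)[OF g] open_V x]
          F_continuous_on_line[OF C_F_infD(8)[OF p(1)] open_V x])
  qed (use supp \<rho>(1) in auto)
  have fq: "f \<in> L2_on a V" "q \<in> L2_on a V" using w by (auto simp: has_weak_partial_def)
  have e1: "indicator V x * q x * (indicator V x * test \<phi> p x) = indicator V x * (q x * test \<phi> p x)"
    and e2: "indicator V x * f x * (- (indicator V x * test_deriv i \<phi> p x) +
        coord x i / (a i)\<^sup>2 * (indicator V x * test \<phi> p x)) =
      indicator V x * (f x * (- test_deriv i \<phi> p x + coord x i / (a i)\<^sup>2 * test \<phi> p x))" for x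
    by (auto simp: indicator_def)
  show ?i1 using integrable_line_C1(1)[OF borel_V P.prob_space_axioms fq(2) L] unfolding e1 .
  show ?i2 using integrable_line_C1(2)[OF borel_V P.prob_space_axioms fq(1) L] unfolding e2 .
  have "ball x \<rho> \<subseteq> V" if "indicator V x * test \<phi> p x \<noteq> 0" for x
    using supp[of x] that by (auto simp: indicator_def split: if_splits)
  from weak_partial_line_C1[OF open_V P.prob_space_axioms w L \<rho>(1) this]
  show ?eq unfolding set_lebesgue_integral_def real_scaleR_def mult.assoc[of "indicator V _", symmetric] e1 e2 .
qed

section \<open>Square integrability, chain rule and norms under the flattening map\<close>

definition jac_max :: real where
  "jac_max = exp (\<delta>\<^sup>2 / (2 * (a 0)\<^sup>2)) * \<delta>"

lemma jac_max_pos: "0 < jac_max"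
  using \<delta>_pos by (simp add: jac_max_def)

lemma jac_le: "x \<in> V \<Longrightarrow> jac x \<le> jac_max"
  unfolding jac_def jac_max_def
  using wgt_bounded Dg_le Dg_pos by (intro mult_mono) (auto intro: less_imp_le)

lemma measurable_comp_tau:
  assumes "u \<in> borel_on V"
  shows "(\<lambda>y. u (tau y)) \<in> borel_on V'"
proof -
  have "tau \<in> measurable (restrict_space borel V') (restrict_space borel V)"
    by (rule measurable_restrict_space2) (auto simp: tau_V space_restrict_space)
  from measurable_compose[OF this assms] show ?thesis .
qed

lemma measurable_indicator_V':
  assumes "u \<in> borel_on V'"
  shows "(\<lambda>y. indicator V' y * u y :: real) \<in> borel_measurable borel"
  using assms by (subst (asm) borel_measurable_restrict_space_iff) auto

text \<open>The substitution \<open>y = psi x\<close> turns the integral over \<open>V'\<close> into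
  one over \<open>V\<close> with the additional factor \<open>jac\<close>, which is at most
  \<open>jac_max\<close>.\<close>

lemma L2_comp_tau:
  assumes u: "u \<in> L2_on a V"
  shows "(\<lambda>y. u (tau y)) \<in> L2_on a V'"
    and "(LINT y:V'|P. (u (tau y))\<^sup>2) \<le> jac_max * (LINT x:V|P. (u x)\<^sup>2)"
proof -
  note m = measurable_comp_tau[OF measurable_L2[OF u]]
  have [measurable]: "(\<lambda>y. (u (tau y))\<^sup>2) \<in> borel_on V'"
    using m by measurable
  note G = measurable_indicator_V'[OF this]
  have eq: "indicator V x * (jac x * (u (tau (psi x)))\<^sup>2) = indicator V x * (u x)\<^sup>2 * (indicator V x * jac x)" for x
    by (cases "x \<in> V") (simp_all add: tau_psi mult.commute)
  have i: "integrable P (\<lambda>x. indicator V x * (u x)\<^sup>2)"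
    using u by (simp add: L2_on_def set_integrable_def)
  have "integrable P (\<lambda>x. indicator V x * (u x)\<^sup>2 * (indicator V x * jac x))"
  proof (rule integrable_mult_bounded[OF i])
    show "(\<lambda>x. indicator V x * jac x) \<in> borel_measurable P"
      using measurable_jac by (subst (asm) borel_measurable_restrict_space_iff) auto
    show "\<bar>indicator V x * jac x\<bar> \<le> jac_max" for x
      using jac_le[of x] jac_pos[of x] jac_max_pos by (auto simp: indicator_def)
  qed
  then have i': "integrable P (\<lambda>x. indicator V x * (jac x * (u (tau (psi x)))\<^sup>2))" unfolding eq .
  then have "integrable P (\<lambda>y. indicator V' y * (u (tau y))\<^sup>2)"
    using change_of_variables(1)[OF G] by simp
  then show "(\<lambda>y. u (tau y)) \<in> L2_on a V'"
    using m by (simp add: L2_on_def set_integrable_def)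
  have "(LINT y:V'|P. (u (tau y))\<^sup>2) = (\<integral>x. indicator V x * (jac x * (u (tau (psi x)))\<^sup>2) \<partial>P)"
    using change_of_variables(2)[OF G] by (simp add: set_lebesgue_integral_def)
  also have "\<dots> \<le> (\<integral>x. jac_max * (indicator V x * (u x)\<^sup>2) \<partial>P)"
  proof (rule integral_mono[OF i'])
    show "integrable P (\<lambda>x. jac_max * (indicator V x * (u x)\<^sup>2))" using i by simp
    show "indicator V x * (jac x * (u (tau (psi x)))\<^sup>2) \<le> jac_max * (indicator V x * (u x)\<^sup>2)" for x
      using jac_le[of x] by (cases "x \<in> V") (auto simp: tau_psi mult_right_mono)
  qed
  also have "\<dots> = jac_max * (LINT x:V|P. (u x)\<^sup>2)" by (simp add: set_lebesgue_integral_def)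
  finally show "(LINT y:V'|P. (u (tau y))\<^sup>2) \<le> jac_max * (LINT x:V|P. (u x)\<^sup>2)" .
qed

text \<open>The pointwise chain rule for \<open>f \<circ> tau\<close> with \<open>q i\<close> in the
  role of the derivatives of \<open>f\<close>. The first term is absent for \<open>i = 0\<close>
  because \<open>tau\<close> overwrites the first coordinate.\<close>

definition chain :: "(nat \<Rightarrow> l2 \<Rightarrow> real) \<Rightarrow> nat \<Rightarrow> l2 \<Rightarrow> real" where
  "chain q i y = (if i = 0 then 0 else q i (tau y)) + q 0 (tau y) * partial i h y"

lemma L2_chain:
  assumes q: "\<And>i. q i \<in> L2_on a V"
  shows "chain q i \<in> L2_on a V'"
  unfolding chain_def[abs_def]
proof (rule L2_add[OF _ L2_mult_bounded[OF L2_comp_tau(1)[OF q]] borel_V'])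
  show "(\<lambda>y. if i = 0 then 0 else q i (tau y)) \<in> L2_on a V'"
    using L2_comp_tau(1)[OF q] L2_zero by (cases "i = 0") simp_all
qed (use C_F_infD[OF h] borel_V' in auto)

lemma weak_chain_rule:
  assumes w: "\<And>i. has_weak_partial a V i f (q i)"
  shows "has_weak_partial a V' i (f \<circ> tau) (chain q i)"
  unfolding has_weak_partial_def
proof (intro conjI ballI)
  have fL: "f \<in> L2_on a V" and qL: "\<And>i. q i \<in> L2_on a V"
    using w by (auto simp: has_weak_partial_def)
  show "f \<circ> tau \<in> L2_on a V'" using L2_comp_tau(1)[OF fL] by (simp add: comp_def)
  show cL: "chain q i \<in> L2_on a V'" by (rule L2_chain[OF qL])
  fix \<phi> assume \<phi>: "\<phi> \<in> C_F_0 V'"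
  then have \<phi>C: "\<phi> \<in> C_F_inf V'" by (simp add: C_F_0_def)
  note [measurable] = C_F_infD(1)[OF \<phi>C] C_F_infD(2)[OF \<phi>C] measurable_L2[OF cL]
    measurable_comp_tau[OF measurable_L2[OF fL]]
  have "(LINT y:V'|P. chain q i y * \<phi> y) =
      (\<integral>x. indicator V x * (jac x * (chain q i (psi x) * \<phi> (psi x))) \<partial>P)"
    unfolding set_lebesgue_integral_def real_scaleR_def
    by (rule change_of_variables(2)) (rule measurable_indicator_V', measurable)
  also have "\<dots> = (\<integral>x. indicator V x * (jac x * (f x * adj_partial a i \<phi> (psi x))) \<partial>P)"
  proof (cases "i = 0")
    case True
    have "bounded ((\<lambda>_. 1 :: real) ` V)" by (rule bounded_subset[of "{1}"]) auto
    note t = weak_partial_test[OF w[of 0] \<phi> C_F_inf_const[of 1] this]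
    \<comment> \<open>\<open>partial 0 h (psi x)\<close> cancels the factor
      \<open>partial 0 g x\<close> of the Jacobian; the weight alone remains, that is,
      \<open>p = 1\<close>.\<close>
    have l: "indicator V x * (jac x * (chain q i (psi x) * \<phi> (psi x))) =
        indicator V x * (q 0 x * test \<phi> (\<lambda>_. 1) x)" for x
    proof (cases "x \<in> V")
      case x: True
      have "jac x * (chain q i (psi x) * \<phi> (psi x)) =
          q 0 x * test \<phi> (\<lambda>_. 1) x * (partial 0 h (psi x) * partial 0 g x)"
        by (simp add: chain_def True tau_psi[OF x] jac_def test_def)
      then show ?thesis by (simp only: partial_h_psi(1)[OF x] mult_1_right)
    qed simp
    \<comment> \<open>The derivative of the weight cancels the term with \<open>coord x 0\<close>
      and replaces it by \<open>g x\<close> times \<open>partial 0 g x\<close>; and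
      \<open>g x\<close> is the first coordinate of \<open>psi x\<close>, as the adjoint at
      \<open>psi x\<close> demands.\<close>
    have r: "indicator V x * (f x * (- test_deriv 0 \<phi> (\<lambda>_. 1) x + coord x 0 / (a 0)\<^sup>2 * test \<phi> (\<lambda>_. 1) x)) =
        indicator V x * (jac x * (f x * adj_partial a i \<phi> (psi x)))" for x
    proof -
      have "- test_deriv 0 \<phi> (\<lambda>_. 1) x + coord x 0 / (a 0)\<^sup>2 * test \<phi> (\<lambda>_. 1) x =
          jac x * adj_partial a i \<phi> (psi x)"
        by (simp add: test_deriv_def test_def jac_def adj_partial_def True psi_def coord_set_first
            diff_divide_distrib algebra_simps)
      then show ?thesis by simp
    qed
    show ?thesis unfolding l r[symmetric] t(3) ..
  next
    case False
    note t0 = weak_partial_test[OF w[of i] \<phi> C_F_inf_partial[OF g] C_F_infD(5)[OF g], of 0]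
    note ti = weak_partial_test[OF w[of 0] \<phi> C_F_inf_partial[OF g] C_F_infD(5)[OF g], of i]
    \<comment> \<open>\<open>partial i h (psi x) * partial 0 g x = - partial i g x\<close> splits
      the product of Jacobian and \<open>chain\<close> into two tests of \<open>f\<close>, one in
      direction \<open>i\<close> and one in direction 0.\<close>
    have l: "indicator V x * (jac x * (chain q i (psi x) * \<phi> (psi x))) =
        indicator V x * (q i x * test \<phi> (partial 0 g) x) - indicator V x * (q 0 x * test \<phi> (partial i g) x)" for x
    proof (cases "x \<in> V")
      case x: True
      have "jac x * (chain q i (psi x) * \<phi> (psi x)) = q i x * test \<phi> (partial 0 g) x -
          q 0 x * test \<phi> (partial i g) x * (partial 0 h (psi x) * partial 0 g x)"
        by (simp add: chain_def False tau_psi[OF x] jac_def test_def partial_h_psi(2)[OF x False]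
            algebra_simps)
      then show ?thesis using x by (simp only: partial_h_psi(1)[OF x] mult_1_right) simp
    qed simp
    \<comment> \<open>In the difference three pairs cancel: the terms with
      \<open>partial 0 \<phi>\<close>, those with \<open>g x * partial i g x * partial 0 g x\<close>
      from the weight, and the mixed second derivatives of \<open>g\<close>. The
      \<open>coord x 0\<close> term of the weight cancels the one of the adjoint in direction
      0.\<close>
    have r: "indicator V x * (f x * (- test_deriv i \<phi> (partial 0 g) x + coord x i / (a i)\<^sup>2 * test \<phi> (partial 0 g) x)) -
        indicator V x * (f x * (- test_deriv 0 \<phi> (partial i g) x + coord x 0 / (a 0)\<^sup>2 * test \<phi> (partial i g) x)) =
        indicator V x * (jac x * (f x * adj_partial a i \<phi> (psi x)))" for x
    proof (cases "x \<in> V")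
      case x: True
      have "(- test_deriv i \<phi> (partial 0 g) x + coord x i / (a i)\<^sup>2 * test \<phi> (partial 0 g) x) -
          (- test_deriv 0 \<phi> (partial i g) x + coord x 0 / (a 0)\<^sup>2 * test \<phi> (partial i g) x) =
          jac x * adj_partial a i \<phi> (psi x)"
        using False C_F_inf_mixed_partials[OF g open_V x, of 0 i]
        by (simp add: test_deriv_def test_def jac_def adj_partial_def psi_def coord_set_first
            diff_divide_distrib algebra_simps)
      then show ?thesis using x by (simp add: right_diff_distrib[symmetric] mult.left_commute)
    qed simp
    show ?thesis
      unfolding l r[symmetric] Bochner_Integration.integral_diff[OF t0(1) ti(1)]
        Bochner_Integration.integral_diff[OF t0(2) ti(2)] t0(3) ti(3) ..
  qed
  also have "\<dots> = (\<integral>x. indicator V x * (jac x * (f (tau (psi x)) * adj_partial a i \<phi> (psi x))) \<partial>P)"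
    by (intro Bochner_Integration.integral_cong refl) (auto simp: indicator_def tau_psi)
  also have "\<dots> = (LINT y:V'|P. (f \<circ> tau) y * adj_partial a i \<phi> y)"
    unfolding set_lebesgue_integral_def real_scaleR_def comp_def
    by (rule change_of_variables(2)[symmetric])
       (rule measurable_indicator_V', unfold adj_partial_def[abs_def], measurable)
  finally show "(LINT y:V'|P. chain q i y * \<phi> y) = (LINT y:V'|P. (f \<circ> tau) y * adj_partial a i \<phi> y)" .
qed

text \<open>The 2 comes from \<open>power2_add_le\<close> applied to the two terms of
  \<open>chain\<close>, and \<open>jac_max\<close> from the change of variables. The derivative of
  \<open>f\<close> in direction 0 picks up \<sigma> from all directions together, while the norm of
  \<open>f\<close> controls it only with the weight \<open>(a 0)^2\<close>; hence the
  quotient.\<close>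

definition norm_const :: real where
  "norm_const = 2 * jac_max * (1 + \<sigma> / (a 0)\<^sup>2)"

lemma W12_comp_tau:
  assumes f: "f \<in> W12 a V"
  shows "f \<circ> tau \<in> W12 a V'"
    and "W12_norm a V' (f \<circ> tau) \<le> sqrt norm_const * W12_norm a V f"
proof -
  define q where "q = (\<lambda>i. weak_partial a V i f)"
  have w: "has_weak_partial a V i f (q i)" for i
  proof -
    have "\<exists>q. has_weak_partial a V i f q" using f by (simp add: W12_def)
    then show ?thesis unfolding q_def weak_partial_def by (rule someI_ex)
  qed
  have fL: "f \<in> L2_on a V" and qL: "\<And>i. q i \<in> L2_on a V"
    using w by (auto simp: has_weak_partial_def)
  let ?r = "\<lambda>i y. indicator V' y * (q 0 (tau y) * partial i h y)\<^sup>2"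
  have a0: "0 < (a 0)\<^sup>2" using a_pos[of 0] by simp
  define n where "n = (\<lambda>i. LINT x:V|P. (q i x)\<^sup>2)"
  define m where "m = (\<lambda>i. LINT y:V'|P. (chain q i y)\<^sup>2)"
  have wc: "has_weak_partial a V' i (f \<circ> tau) (chain q i)" for i by (rule weak_chain_rule[OF w])
  have m_eq: "(LINT y:V'|P. (weak_partial a V' i (f \<circ> tau) y)\<^sup>2) = m i" for i
    unfolding m_def by (rule set_integral_weak_partial[OF open_V' P.prob_space_axioms wc])
  have n_nonneg: "0 \<le> n i" and m_nonneg: "0 \<le> m i" for i
    unfolding n_def m_def set_lebesgue_integral_def by (auto intro!: integral_nonneg_AE)
  have sn: "summable (\<lambda>i. (a i)\<^sup>2 * n i)"
    using f by (simp add: W12_def n_def q_def)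
  define T where "T = (\<Sum>i. (a i)\<^sup>2 * n i)"
  have T: "(\<Sum>i<N. (a i)\<^sup>2 * n i) \<le> T" for N
    unfolding T_def using sn n_nonneg by (intro sum_le_suminf) auto
  have T0: "n 0 \<le> T / (a 0)\<^sup>2" using T[of 1] a0 by (simp add: field_simps)
  have iq: "integrable P (\<lambda>y. indicator V' y * (q i (tau y))\<^sup>2)" for i
    using L2_comp_tau(1)[OF qL] by (simp add: L2_on_def set_integrable_def)
  have iq0: "integrable P (?r i)" for i
    using L2_mult_bounded[OF L2_comp_tau(1)[OF qL] C_F_infD(2)[OF h] C_F_infD(5)[OF h] borel_V']
    by (simp add: L2_on_def set_integrable_def)
  have m_le: "m i \<le> 2 * (jac_max * n i) + 2 * (\<integral>y. ?r i y \<partial>P)" for i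
  proof -
    have "m i \<le> (\<integral>y. 2 * (indicator V' y * (q i (tau y))\<^sup>2) + 2 * ?r i y \<partial>P)"
      unfolding m_def set_lebesgue_integral_def real_scaleR_def
    proof (rule integral_mono)
      show "integrable P (\<lambda>y. indicator V' y * (chain q i y)\<^sup>2)"
        using L2_chain[OF qL] by (simp add: L2_on_def set_integrable_def)
      show "integrable P (\<lambda>y. 2 * (indicator V' y * (q i (tau y))\<^sup>2) + 2 * ?r i y)"
        using iq iq0 by simp
      from power2_add_le[of "q i (tau y)" "q 0 (tau y) * partial i h y" for y]
      show "indicator V' y * (chain q i y)\<^sup>2 \<le>
          2 * (indicator V' y * (q i (tau y))\<^sup>2) + 2 * ?r i y" for y
        by (cases "i = 0") (auto simp: chain_def indicator_def)
    qed
    also have "\<dots> = 2 * (LINT y:V'|P. (q i (tau y))\<^sup>2) + 2 * (\<integral>y. ?r i y \<partial>P)"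
      using iq iq0 by (simp add: set_lebesgue_integral_def)
    finally show ?thesis using L2_comp_tau(2)[OF qL[of i]] by (simp add: n_def)
  qed
  \<comment> \<open>The bound \<sigma> holds pointwise for the sum over the directions, so the
    finite sum is moved under the integral before it is used.\<close>
  have rest: "(\<Sum>i<N. (a i)\<^sup>2 * (\<integral>y. ?r i y \<partial>P)) \<le> \<sigma> * (jac_max * n 0)" for N
  proof -
    have "(\<Sum>i<N. (a i)\<^sup>2 * (\<integral>y. ?r i y \<partial>P)) =
        (\<integral>y. (\<Sum>i<N. (a i)\<^sup>2 * ?r i y) \<partial>P)"
      using iq0 by (simp add: Bochner_Integration.integral_sum)
    also have "\<dots> \<le> (\<integral>y. \<sigma> * (indicator V' y * (q 0 (tau y))\<^sup>2) \<partial>P)"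
    proof (rule integral_mono)
      show "integrable P (\<lambda>y. \<sigma> * (indicator V' y * (q 0 (tau y))\<^sup>2))" using iq by simp
      show "(\<Sum>i<N. (a i)\<^sup>2 * ?r i y) \<le>
          \<sigma> * (indicator V' y * (q 0 (tau y))\<^sup>2)" for y
      proof (cases "y \<in> V'")
        case True
        have "(\<Sum>i<N. (a i)\<^sup>2 * (q 0 (tau y) * partial i h y)\<^sup>2) =
            (\<Sum>i<N. (a i)\<^sup>2 * (partial i h y)\<^sup>2) * (q 0 (tau y))\<^sup>2"
          unfolding sum_distrib_right by (intro sum.cong refl) (simp add: power_mult_distrib)
        also have "\<dots> \<le> \<sigma> * (q 0 (tau y))\<^sup>2" by (intro mult_right_mono Dh_sum True) simp
        finally show ?thesis using True by simp
      qed simp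
    qed (use iq0 in simp)
    also have "\<dots> = \<sigma> * (LINT y:V'|P. (q 0 (tau y))\<^sup>2)" by (simp add: set_lebesgue_integral_def)
    also have "\<dots> \<le> \<sigma> * (jac_max * n 0)"
      using L2_comp_tau(2)[OF qL[of 0]] \<sigma>_nonneg unfolding n_def by (intro mult_left_mono) auto
    finally show ?thesis .
  qed
  have partial_sums: "(\<Sum>i<N. (a i)\<^sup>2 * m i) \<le> norm_const * T" for N
  proof -
    have "(\<Sum>i<N. (a i)\<^sup>2 * m i) \<le> (\<Sum>i<N. (a i)\<^sup>2 * (2 * (jac_max * n i) +
        2 * (\<integral>y. ?r i y \<partial>P)))"
      by (intro sum_mono mult_left_mono m_le) simp
    also have "\<dots> = 2 * jac_max * (\<Sum>i<N. (a i)\<^sup>2 * n i) +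
        2 * (\<Sum>i<N. (a i)\<^sup>2 * (\<integral>y. ?r i y \<partial>P))"
      by (simp add: sum_distrib_left sum.distrib[symmetric] distrib_left mult_ac)
    also have "\<dots> \<le> 2 * jac_max * T + 2 * (\<sigma> * (jac_max * n 0))"
      using rest[of N] T[of N] jac_max_pos by (intro add_mono mult_left_mono) auto
    also have "\<dots> \<le> 2 * jac_max * T + 2 * (\<sigma> * (jac_max * (T / (a 0)\<^sup>2)))"
      using T0 \<sigma>_nonneg jac_max_pos by (intro add_left_mono mult_left_mono) auto
    also have "\<dots> = norm_const * T" by (simp add: norm_const_def algebra_simps)
    finally show ?thesis .
  qed
  have sm: "summable (\<lambda>i. (a i)\<^sup>2 * m i)"
    by (rule summableI_nonneg_bounded[OF _ partial_sums]) (simp add: m_nonneg)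
  have "(\<Sum>i. (a i)\<^sup>2 * m i) \<le> norm_const * T"
    by (rule suminf_le_const[OF sm partial_sums])
  have fL': "f \<circ> tau \<in> L2_on a V'" using wc[of 0] by (simp add: has_weak_partial_def)
  then show "f \<circ> tau \<in> W12 a V'"
    using wc sm unfolding W12_def by (auto simp: m_eq)
  \<comment> \<open>The term of order zero is estimated with \<open>jac_max\<close>, which has to be
    absorbed into the same constant.\<close>
  have "norm_const = jac_max + jac_max * (1 + 2 * (\<sigma> / (a 0)\<^sup>2))"
    by (simp add: norm_const_def algebra_simps)
  then have c: "jac_max \<le> norm_const" using jac_max_pos \<sigma>_nonneg by simp
  have "0 \<le> (LINT x:V|P. (f x)\<^sup>2)"
    by (auto simp: set_lebesgue_integral_def intro!: integral_nonneg_AE)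
  from order_trans[OF L2_comp_tau(2)[OF fL] mult_right_mono[OF c this]]
  have "(LINT y:V'|P. ((f \<circ> tau) y)\<^sup>2) \<le> norm_const * (LINT x:V|P. (f x)\<^sup>2)" by simp
  then have "(LINT y:V'|P. ((f \<circ> tau) y)\<^sup>2) + (\<Sum>i. (a i)\<^sup>2 * m i) \<le>
      norm_const * ((LINT x:V|P. (f x)\<^sup>2) + T)"
    using \<open>(\<Sum>i. (a i)\<^sup>2 * m i) \<le> norm_const * T\<close> by (simp add: distrib_left)
  then show "W12_norm a V' (f \<circ> tau) \<le> sqrt norm_const * W12_norm a V f"
    unfolding W12_norm_def m_eq real_sqrt_mult[symmetric] T_def n_def q_def by (rule real_sqrt_le_mono)
qed

end

text \<open>Functions that agree on \<open>V\<close> have the same predicate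
  \<open>has_weak_partial a V i\<close>, so \<open>SOME\<close> selects the same representative for
  both.\<close>

lemma W12_norm_cong:
  assumes "\<And>x. x \<in> V \<Longrightarrow> f x = f' x"
  shows "W12_norm a V f = W12_norm a V f'"
proof -
  have eq: "(LINT x:V|M. F (f x) x) = (LINT x:V|M. F (f' x) x)" for M and F :: "real \<Rightarrow> l2 \<Rightarrow> real"
    unfolding set_lebesgue_integral_def
    by (rule Bochner_Integration.integral_cong) (auto simp: indicator_def assms)
  have "f \<in> L2_on a V \<longleftrightarrow> f' \<in> L2_on a V"
    unfolding L2_on_def mem_Collect_eq set_integrable_def
    by (intro conj_cong measurable_cong Bochner_Integration.integrable_cong refl)
       (auto simp: space_restrict_space indicator_def assms)
  then have "has_weak_partial a V i f = has_weak_partial a V i f'" for i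
    unfolding has_weak_partial_def[abs_def]
    using eq[of _ "\<lambda>u x. u * adj_partial a i _ x"] by simp
  then show ?thesis
    unfolding W12_norm_def weak_partial_def using eq[of _ "\<lambda>u x. u\<^sup>2"] by simp
qed

theorem theorem173:
  fixes a :: "nat \<Rightarrow> real" and Q U\<^sub>0 :: "l2 set" and g h :: "l2 \<Rightarrow> real"
    and x\<^sub>0 :: l2 and r :: real and \<psi> \<tau> :: "l2 \<Rightarrow> l2"
  assumes a_pos: "\<And>i. a i > 0" and a_summable: "summable a"
    and Q_open: "open Q" and g_C1: "C1_on UNIV g"
    and Q_bdry: "frontier Q = {x. g x = 0}" and Q_pos: "Q = {x. g x > 0}"
    and Dg_nz: "\<And>x. x \<in> frontier Q \<Longrightarrow> frechet_derivative g (at x) \<noteq> (\<lambda>_. 0)"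
    and x0: "x\<^sub>0 \<in> frontier Q" "partial 0 g x\<^sub>0 > 0"
    and U0: "r > 0" "U\<^sub>0 = ball x\<^sub>0 r"
      "(INF x\<in>U\<^sub>0. ereal (partial 0 g x)) > 0" "(SUP x\<in>U\<^sub>0. ereal (partial 0 g x)) < \<infinity>"
    and psi: "\<psi> = (\<lambda>x. set_first x (g x))"
    and psi_open: "open (\<psi> ` U\<^sub>0)"
    and psi_half: "\<psi> ` (U\<^sub>0 \<inter> Q) = \<psi> ` U\<^sub>0 \<inter> halfspace"
    and h: "\<And>x. x \<in> U\<^sub>0 \<Longrightarrow> h (\<psi> x) = coord x 0" and h_C1: "C1_on (\<psi> ` U\<^sub>0) h"
    and tau: "\<tau> = (\<lambda>y. set_first y (h y))"
    and psi_homeo: "homeomorphism U\<^sub>0 (\<psi> ` U\<^sub>0) \<psi> \<tau>"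
    and cond: "flattening_condition a Q U\<^sub>0 g h \<psi> \<tau>"
  shows "\<exists>C>0.
    (\<forall>f\<in>W12 a (U\<^sub>0 \<inter> Q).
      f \<circ> \<tau> \<in> W12 a (\<psi> ` U\<^sub>0 \<inter> halfspace) \<and>
      inverse C * W12_norm a (U\<^sub>0 \<inter> Q) f \<le> W12_norm a (\<psi> ` U\<^sub>0 \<inter> halfspace) (f \<circ> \<tau>) \<and>
      W12_norm a (\<psi> ` U\<^sub>0 \<inter> halfspace) (f \<circ> \<tau>) \<le> C * W12_norm a (U\<^sub>0 \<inter> Q) f) \<and>
    (\<forall>v\<in>W12 a (\<psi> ` U\<^sub>0 \<inter> halfspace).
      v \<circ> \<psi> \<in> W12 a (U\<^sub>0 \<inter> Q) \<and>
      inverse C * W12_norm a (\<psi> ` U\<^sub>0 \<inter> halfspace) v \<le> W12_norm a (U\<^sub>0 \<inter> Q) (v \<circ> \<psi>) \<and>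
      W12_norm a (U\<^sub>0 \<inter> Q) (v \<circ> \<psi>) \<le> C * W12_norm a (\<psi> ` U\<^sub>0 \<inter> halfspace) v)"
proof -
  define V where "V = U\<^sub>0 \<inter> Q"
  define V' where "V' = \<psi> ` U\<^sub>0 \<inter> halfspace"
  have VU: "x \<in> U\<^sub>0" if "x \<in> V" for x using that by (simp add: V_def)
  have V'U: "y \<in> \<psi> ` U\<^sub>0" if "y \<in> V'" for y using that unfolding V'_def by (rule IntD1)
  have psi_half: "\<psi> ` V = V'" using psi_half by (simp only: V_def V'_def)
  have hC: "h \<in> C_F_inf V'" and gC: "g \<in> C_F_inf V"
    and in_psi: "\<And>E. E \<Subset>\<^sub>o V \<Longrightarrow> \<psi> ` E \<Subset>\<^sub>o V'" and in_tau: "\<And>E. E \<Subset>\<^sub>o V' \<Longrightarrow> \<tau> ` E \<Subset>\<^sub>o V"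
    using cond unfolding flattening_condition_def V_def V'_def by (auto intro: C_F_inf_subset)
  obtain \<delta> where \<delta>: "\<delta> > 0" and bounds: "\<And>x y. x \<in> U\<^sub>0 \<Longrightarrow> y \<in> \<psi> ` U\<^sub>0 \<Longrightarrow>
      \<bar>coord x 0\<bar> < \<delta> \<and> \<bar>coord y 0\<bar> < \<delta> \<and> \<bar>h y\<bar> < \<delta> \<and> \<bar>g x\<bar> < \<delta> \<and>
      1 / \<delta> < partial 0 h y \<and> partial 0 h y < \<delta> \<and>
      1 / \<delta> < partial 0 g x \<and> partial 0 g x < \<delta> \<and>
      (\<Sum>i. ennreal ((a i)\<^sup>2 * (partial i h y)\<^sup>2)) < ennreal \<delta>"
    using cond unfolding flattening_condition_def by blast
  have x0U: "x\<^sub>0 \<in> U\<^sub>0" using U0 by simp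
  \<comment> \<open>The Condition bounds one point of each side simultaneously;
    \<open>x\<^sub>0\<close> and its image fill in for the point of the other side.\<close>
  note bdx = bounds[OF _ imageI[OF x0U]] and bdy = bounds[OF x0U]
  have \<delta>_inv: "0 < 1 / \<delta>" using \<delta> by simp
  have dh_sum: "(\<Sum>i<n. (a i)\<^sup>2 * (partial i h y)\<^sup>2) \<le> \<delta>" if "y \<in> \<psi> ` U\<^sub>0" for y n
  proof -
    have "ennreal (\<Sum>i<n. (a i)\<^sup>2 * (partial i h y)\<^sup>2) = (\<Sum>i<n. ennreal ((a i)\<^sup>2 * (partial i h y)\<^sup>2))"
      by (subst sum_ennreal) auto
    also have "\<dots> \<le> (\<Sum>i. ennreal ((a i)\<^sup>2 * (partial i h y)\<^sup>2))" by (rule sum_le_suminf) auto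
    also have "\<dots> \<le> ennreal \<delta>" using bdy[OF that] by (simp only: less_imp_le)
    finally show ?thesis using \<delta> by (simp add: ennreal_le_iff)
  qed
  have tp: "\<tau> (\<psi> x) = x" if "x \<in> U\<^sub>0" for x using psi_homeo that by (simp add: homeomorphism_def)
  have pt: "\<psi> (\<tau> y) = y" if "y \<in> \<psi> ` U\<^sub>0" for y using that tp by auto
  have psi_V': "\<psi> x \<in> V'" if "x \<in> V" for x
    unfolding psi_half[symmetric] using that by (rule imageI)
  have tau_V: "\<tau> y \<in> V" if "y \<in> V'" for y
  proof -
    have "y \<in> \<psi> ` V" unfolding psi_half by (rule that)
    then obtain x where "x \<in> V" "y = \<psi> x" by (rule imageE)
    then show ?thesis using tp VU by simp
  qed
  have g_tau: "g (\<tau> y) = coord y 0" if "y \<in> \<psi> ` U\<^sub>0" for y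
    using arg_cong[OF pt[OF that], of "\<lambda>z. coord z 0"] by (simp add: psi coord_set_first)
  have opV: "open V" "open V'"
  proof -
    show "open V" using Q_open U0 by (auto simp: V_def)
    have "open halfspace" unfolding halfspace_def by (intro open_Collect_less continuous_intros)
    then show "open V'" using psi_open unfolding V'_def by (rule open_Int[rotated])
  qed
  interpret A: flattening a V V' g h \<delta> \<delta>
  proof
    show "set_first x (g x) \<in> V'" "h (set_first x (g x)) = coord x 0" if "x \<in> V" for x
      using psi_V'[OF that] h[OF VU[OF that]] by (simp_all only: psi)
    show "set_first y (h y) \<in> V" "g (set_first y (h y)) = coord y 0" if "y \<in> V'" for y
      using tau_V[OF that] g_tau[OF V'U[OF that]] by (simp_all only: tau)
    show "\<bar>coord x 0\<bar> \<le> \<delta>" "\<bar>g x\<bar> \<le> \<delta>" "0 < partial 0 g x" "partial 0 g x \<le> \<delta>" if "x \<in> V" for x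
      using bdx[OF VU[OF that]] \<delta>_inv by - (elim conjE, linarith)+
    show "(\<Sum>i<n. (a i)\<^sup>2 * (partial i h y)\<^sup>2) \<le> \<delta>" if "y \<in> V'" for y n
      by (rule dh_sum[OF V'U[OF that]])
    show "(\<lambda>y. set_first y (h y)) ` E \<Subset>\<^sub>o V" if "E \<Subset>\<^sub>o V'" for E
      using in_tau[OF that] by (simp only: tau)
  qed (use a_pos a_summable opV gC hC \<delta> in simp_all)
  \<comment> \<open>The first summand bounds the direction 0, where \<open>partial 0 g\<close> is at
    most \<delta>. In the other directions \<open>partial i g\<close> is, up to sign,
    \<open>partial 0 g\<close> times \<open>partial i h\<close> at the image point, so its weighted
    squares sum to at most \<open>\<delta>^2\<close> times \<delta>.\<close>
  define \<sigma> where "\<sigma> = (a 0)\<^sup>2 * \<delta>\<^sup>2 + \<delta>\<^sup>2 * \<delta>"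
  interpret B: flattening a V' V h g \<delta> \<sigma>
  proof
    show "set_first y (h y) \<in> V" "g (set_first y (h y)) = coord y 0" if "y \<in> V'" for y
      by (rule A.tau_in[OF that] A.g_tau[OF that])+
    show "set_first x (g x) \<in> V'" "h (set_first x (g x)) = coord x 0" if "x \<in> V" for x
      by (rule A.psi_in[OF that] A.h_psi[OF that])+
    show "\<bar>coord y 0\<bar> \<le> \<delta>" "\<bar>h y\<bar> \<le> \<delta>" "0 < partial 0 h y" "partial 0 h y \<le> \<delta>" if "y \<in> V'" for y
      using bdy[OF V'U[OF that]] \<delta>_inv by - (elim conjE, linarith)+
    show "(\<lambda>x. set_first x (g x)) ` E \<Subset>\<^sub>o V'" if "E \<Subset>\<^sub>o V" for E
      using in_psi[OF that] by (simp only: psi)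
    show "(\<Sum>i<n. (a i)\<^sup>2 * (partial i g x)\<^sup>2) \<le> \<sigma>" if x: "x \<in> V" for x n
    proof -
      have dg: "0 < partial 0 g x" "partial 0 g x \<le> \<delta>" by (rule A.Dg_pos[OF x] A.Dg_le[OF x])+
      then have dg2: "(partial 0 g x)\<^sup>2 \<le> \<delta>\<^sup>2" by (intro power_mono) auto
      have le: "(partial i g x)\<^sup>2 \<le> (if i = 0 then \<delta>\<^sup>2 else 0) + \<delta>\<^sup>2 * (partial i h (A.psi x))\<^sup>2" for i
      proof (cases "i = 0")
        case False
        have "partial i h (A.psi x) * partial 0 g x = - (partial 0 h (A.psi x) * partial 0 g x) * partial i g x"
          unfolding A.partial_h_psi(2)[OF x False] by simp
        then have "partial i g x = - (partial 0 g x * partial i h (A.psi x))"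
          unfolding A.partial_h_psi(1)[OF x] by (simp add: mult.commute)
        then have "(partial i g x)\<^sup>2 = (partial 0 g x)\<^sup>2 * (partial i h (A.psi x))\<^sup>2"
          by (simp add: power_mult_distrib)
        then show ?thesis using dg2 False by (simp add: mult_right_mono)
      qed (use dg2 in \<open>simp add: add_increasing2\<close>)
      have "(\<Sum>i<n. (a i)\<^sup>2 * (partial i g x)\<^sup>2) \<le>
          (\<Sum>i<n. (a i)\<^sup>2 * ((if i = 0 then \<delta>\<^sup>2 else 0) + \<delta>\<^sup>2 * (partial i h (A.psi x))\<^sup>2))"
        by (intro sum_mono mult_left_mono le) simp
      also have "\<dots> = (\<Sum>i<n. if i = 0 then (a 0)\<^sup>2 * \<delta>\<^sup>2 else 0) + \<delta>\<^sup>2 * (\<Sum>i<n. (a i)\<^sup>2 * (partial i h (A.psi x))\<^sup>2)"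
        unfolding sum_distrib_left sum.distrib[symmetric]
        by (intro sum.cong refl) (simp add: algebra_simps)
      also have "\<dots> \<le> (a 0)\<^sup>2 * \<delta>\<^sup>2 + \<delta>\<^sup>2 * \<delta>"
        using A.Dh_sum[OF A.psi_V'[OF x]] by (intro add_mono mult_left_mono) auto
      finally show ?thesis by (simp add: \<sigma>_def)
    qed
  qed (use a_pos a_summable opV gC hC \<delta> in \<open>simp_all add: \<sigma>_def\<close>)
  have psi_eq: "B.tau = \<psi>" and tau_eq: "A.tau = \<tau>"
    by (simp_all add: fun_eq_iff A.tau_def B.tau_def psi tau)
  define C where "C = max (sqrt A.norm_const) (sqrt B.norm_const)"
  have "0 < A.norm_const"
    using A.jac_max_pos A.\<sigma>_nonneg unfolding A.norm_const_def by (simp add: add_pos_nonneg)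
  then have C: "C > 0" unfolding C_def by (simp add: less_max_iff_disj)
  have nn: "0 \<le> W12_norm a W u" if "u \<in> W12 a W" for W u
    using that unfolding W12_norm_def W12_def set_lebesgue_integral_def
    by (auto intro!: add_nonneg_nonneg integral_nonneg_AE suminf_nonneg)
  have ATrans: "f \<circ> \<tau> \<in> W12 a V'" "W12_norm a V' (f \<circ> \<tau>) \<le> C * W12_norm a V f" if "f \<in> W12 a V" for f
  proof -
    show "f \<circ> \<tau> \<in> W12 a V'" using A.W12_comp_tau(1)[OF that] by (simp add: tau_eq)
    have "W12_norm a V' (f \<circ> \<tau>) \<le> sqrt A.norm_const * W12_norm a V f"
      using A.W12_comp_tau(2)[OF that] by (simp add: tau_eq)
    also have "\<dots> \<le> C * W12_norm a V f" by (intro mult_right_mono nn[OF that]) (simp add: C_def)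
    finally show "W12_norm a V' (f \<circ> \<tau>) \<le> C * W12_norm a V f" .
  qed
  have BTrans: "v \<circ> \<psi> \<in> W12 a V" "W12_norm a V (v \<circ> \<psi>) \<le> C * W12_norm a V' v" if "v \<in> W12 a V'" for v
  proof -
    show "v \<circ> \<psi> \<in> W12 a V" using B.W12_comp_tau(1)[OF that] by (simp add: psi_eq)
    have "W12_norm a V (v \<circ> \<psi>) \<le> sqrt B.norm_const * W12_norm a V' v"
      using B.W12_comp_tau(2)[OF that] by (simp add: psi_eq)
    also have "\<dots> \<le> C * W12_norm a V' v" by (intro mult_right_mono nn[OF that]) (simp add: C_def)
    finally show "W12_norm a V (v \<circ> \<psi>) \<le> C * W12_norm a V' v" .
  qed
  show ?thesis
    unfolding V_def[symmetric] V'_def[symmetric]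
  proof (intro exI[of _ C] conjI ballI C)
    fix f assume f: "f \<in> W12 a V"
    show "f \<circ> \<tau> \<in> W12 a V'" "W12_norm a V' (f \<circ> \<tau>) \<le> C * W12_norm a V f"
      by (rule ATrans[OF f])+
    \<comment> \<open>The lower bound is the upper bound for \<psi>, applied to
      \<open>f \<circ> \<tau>\<close>. Going back and forth recovers \<open>f\<close> on
      \<open>V\<close> only, so the norms are compared by \<open>W12_norm_cong\<close>.\<close>
    have "W12_norm a V f = W12_norm a V ((f \<circ> \<tau>) \<circ> \<psi>)"
      by (rule W12_norm_cong) (simp add: tp VU)
    also have "\<dots> \<le> C * W12_norm a V' (f \<circ> \<tau>)" by (rule BTrans(2)[OF ATrans(1)[OF f]])
    finally show "inverse C * W12_norm a V f \<le> W12_norm a V' (f \<circ> \<tau>)"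
      using C by (simp add: field_simps)
  next
    fix v assume v: "v \<in> W12 a V'"
    show "v \<circ> \<psi> \<in> W12 a V" "W12_norm a V (v \<circ> \<psi>) \<le> C * W12_norm a V' v"
      by (rule BTrans[OF v])+
    have "W12_norm a V' v = W12_norm a V' ((v \<circ> \<psi>) \<circ> \<tau>)"
      by (rule W12_norm_cong) (simp add: pt V'U)
    also have "\<dots> \<le> C * W12_norm a V (v \<circ> \<psi>)" by (rule ATrans(2)[OF BTrans(1)[OF v]])
    finally show "inverse C * W12_norm a V' v \<le> W12_norm a V (v \<circ> \<psi>)"
      using C by (simp add: field_simps)
  qed
qed

end
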